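(* Let $Q$ be a face operator satisfying (Dihedral invariance) and (2Dsimple). Let $\overline Q^{W}$ and $\overline Q^{E}$ be the West and East half-strip fixed points of $Q$, with blocks $B^W$ and $B^E$. Then $$B^{W}_{[SN],[SN]}=\mathsf F^{W}(\overline Q^{\infty_{WE}}),\qquad B^{E}_{[SN],[SN]}=\mathsf F^{E}(\overline Q^{\infty_{WE}}).$$
   Context: $\mathcal H$ is a finite-dimensional (real or complex) Hilbert space (in the real case functions on $S^1$ take values in the complexification). A face operator is a self-adjoint positive definite operator $Q$ on $\mathcal H_1\oplus\mathcal H_1\oplus\mathcal H_2\oplus\mathcal H_2$, the summands being attached to the South, North, West, East sides ($S,N,W,E$) of a unit square. (Dihedral invariance): $\mathcal H_1=\mathcal H_2=\mathcal H$ and there are self-adjoint $T,A,U$ on $\mathcal H$ with $Q=\begin{pmatrix}T&A&U&U\\ A&T&U&U\\ U&U&T&A\\ U&U&A&T\end{pmatrix}$ (order $S,N,W,E$). (2Dsimple): let $\phi^{SN}(w)=Q_{SS}+Q_{NN}+wQ_{SN}+w^{-1}Q_{NS}$, $\phi^{WE}(z)=Q_{WW}+Q_{EE}+zQ_{WE}+z^{-1}Q_{EW}$, $\Psi_Q(z,w)=\begin{pmatrix}\phi^{SN}(w)&Q_{SW}+zQ_{SE}+w^{-1}Q_{NW}+w^{-1}zQ_{NE}\\ Q_{WS}+z^{-1}Q_{ES}+wQ_{WN}+wz^{-1}Q_{EN}&\phi^{WE}(z)\end{pmatrix}$. The zeroes of $\det\phi^{SN}$, $\det\phi^{WE}$ in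 $\mathbb C^*$ and of $\det\Psi_Q$ in $(\mathbb C^* )^2$ have multiplicity one with one-dimensional kernels there, and those of $\det\Psi_Q$ lie outside $S^1\times S^1$; for $\det\Psi_Q$, multiplicity one is understood in particular to mean that for each fixed $u\in S^1$ the zeroes in $\mathbb C^*$ of $w\mapsto\det\Psi_Q(u,w)$ and $z\mapsto\det\Psi_Q(z,u)$ are simple. Strip operator: $\mathcal S_{WE}(z)=Q_{[SN],[SN]}-(Q_{[SN],W}+zQ_{[SN],E})\phi^{WE}(z)^{-1}(Q_{W,[SN]}+z^{-1}Q_{E,[SN]})\in\mathrm{End}(\mathcal H^2)$ for $z\in S^1$ (block extraction: $Q_{[SN],[SN]}$ is the $2\times2$ block with rows and columns $S,N$, $Q_{[SN],W}$ the column of $Q_{SW},Q_{NW}$, etc.). $\overline Q^{\infty_{WE}}$ is the operator on $\ell^2(\mathbb Z;\mathcal H^2)\simeq\ell^2(\mathbb Z;\mathcal H)^2$ conjugate, through Fourier series $\hat f(e^{i\theta})=\sum_kf(k)e^{ik\theta}$, to pointwise multiplication by $\mathcal S_{WE}$ on $L^2(S^1;\mathcal H^2)$. Folding: let $V$ be a Hilbert space, $P^W,P^E$ the orthogonal projections of $\ell^2(\mathbb Z;V)$ onto $\ell^2(\mathbb Z_{<0};V)$, $\ell^2(\mathbb Z_{\ge0};V)$ and $J$ the involution $(Jf)(k)=f(-1-k)$. For bounded $M$ on $\ell^2(\mathbb Z;V)$ and $b\in\{W,E\}$, $\mathsf F^b(M)=P^bMP^b-P^bMJP^b$, an operator on the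 range of $P^b$. Half-strips: $\mathcal W_W=\ell^2(\mathbb Z_{<0};\mathcal H)$, $\mathcal W_E=\ell^2(\mathbb Z_{\ge0};\mathcal H)$. For $b\in\{W,E\}$, $\mathcal Q_{\infty_b,1}$ is the set of bounded self-adjoint operators $M$ on $\mathcal W_b\oplus\mathcal W_b\oplus\mathcal H$ (sides $S$, $N$ and the vertical side: East if $b=W$, West if $b=E$) with $\inf_{x\ne0}\langle x,Mx\rangle/\langle x,x\rangle>0$. The fixed point $\overline Q^b$ is the element of $\mathcal Q_{\infty_b,1}$ unchanged by gluing with a face $Q$ along its vertical side; gluing means: add the two quadratic forms with a common variable in $\mathcal H$ on the shared vertical edge, take the Schur complement with respect to this variable ($\mathrm{Schur}_{V_2}(M)=M_{11}-M_{12}M_{22}^{-1}M_{21}$), and conjugate by the unitary shifts identifying half-line plus unit segment with the half-line: $D_1^L:\mathcal W_W\oplus\mathcal H\to\mathcal W_W$, $D^L_1(w,h)(-1)=h$, $D_1^L(w,h)(k)=w(k+1)$ for $k<-1$; $D_1^R:\mathcal H\oplus\mathcal W_E\to\mathcal W_E$, $D_1^R(h,w)(0)=h$, $D_1^R(h,w)(k)=w(k-1)$ for $k\ge1$. $B^b_{[SN],[SN]}$ is the block of $\overline Q^b$ on $\mathcal W_b^2\simeq\ell^2(\cdot;\mathcal H^2)$. *)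

theory Defs
  imports "HOL-Analysis.Analysis" "HOL-Library.Function_Algebras"
begin

section \<open>Scalars: the real or the complex field\<close>

text \<open>
  The ground field is \<open>\<real>\<close> or \<open>\<complex>\<close>. The class collects the complete normed fields with an isometric
  real-linear embedding into \<open>\<complex>\<close>; up to isomorphism these are exactly \<open>\<real>\<close> and \<open>\<complex>\<close> (lemma
  \<open>range_to_complex\<close>). The embedding \<open>to_complex\<close> also gives the complexification: a vector or
  matrix over the field is complexified entrywise, which does nothing if the field is \<open>\<complex>\<close>.
\<close>

class real_or_complex = real_normed_field + banach +
  fixes to_complex :: "'a \<Rightarrow> complex"
    and conj :: "'a \<Rightarrow> 'a"
  assumes to_complex_add: "to_complex (x + y) = to_complex x + to_complex y"
    and to_complex_mult: "to_complex (x * y) = to_complex x * to_complex y"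
    and to_complex_scaleR: "to_complex (scaleR r x) = scaleR r (to_complex x)"
    and norm_to_complex: "norm (to_complex x) = norm x"
    and to_complex_conj: "to_complex (conj x) = cnj (to_complex x)"

instantiation real :: real_or_complex
begin
definition to_complex_real :: "real \<Rightarrow> complex" where "to_complex_real x = complex_of_real x"
definition conj_real :: "real \<Rightarrow> real" where "conj_real x = x"
instance
  by standard (simp_all add: to_complex_real_def conj_real_def scaleR_conv_of_real)
end

instantiation complex :: real_or_complex
begin
definition to_complex_complex :: "complex \<Rightarrow> complex" where "to_complex_complex x = x"
definition conj_complex :: "complex \<Rightarrow> complex" where "conj_complex x = cnj x"
instance
  by standard (simp_all add: to_complex_complex_def conj_complex_def)
end

lemma to_complex_of_real: "to_complex (of_real r :: 'a::real_or_complex) = of_real r"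
proof -
  have "to_complex (1::'a) * to_complex (1::'a) = to_complex (1::'a)"
    by (metis mult_1 to_complex_mult)
  moreover have "to_complex (1::'a) \<noteq> 0"
    by (metis norm_to_complex norm_one norm_zero zero_neq_one)
  ultimately have "to_complex (1::'a) = 1"
    by simp
  then show ?thesis
    by (simp add: of_real_def to_complex_scaleR)
qed

lemma range_to_complex:
  "range (to_complex :: 'a::real_or_complex \<Rightarrow> complex) = \<real>
   \<or> range (to_complex :: 'a \<Rightarrow> complex) = UNIV"
proof (cases "range (to_complex :: 'a \<Rightarrow> complex) \<subseteq> \<real>")
  case True
  moreover have "\<real> \<subseteq> range (to_complex :: 'a \<Rightarrow> complex)"
    by (auto simp: Reals_def) (metis rangeI to_complex_of_real)
  ultimately show ?thesis by blast
next
  case False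
  then obtain a :: 'a where a: "Im (to_complex a) \<noteq> 0"
    by (force simp: complex_is_Real_iff)
  have "z \<in> range (to_complex :: 'a \<Rightarrow> complex)" for z
  proof -
    define t where "t = Im z / Im (to_complex a)"
    define r where "r = Re z - t * Re (to_complex a)"
    have "to_complex (scaleR t a + of_real r) = scaleR t (to_complex a) + of_real r"
      by (simp only: to_complex_add to_complex_scaleR to_complex_of_real)
    also have "\<dots> = z"
      using a by (simp add: complex_eq_iff t_def r_def)
    finally have "to_complex (scaleR t a + of_real r) = z" .
    then show ?thesis by (metis rangeI)
  qed
  then show ?thesis by blast
qed

definition cvec :: "'k::real_or_complex ^ 'n \<Rightarrow> complex ^ 'n" where
  "cvec x = (\<chi> i. to_complex (x $ i))"

definition cmat :: "'k::real_or_complex ^ 'n ^ 'm \<Rightarrow> complex ^ 'n ^ 'm" where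
  "cmat A = (\<chi> i j. to_complex (A $ i $ j))"

text \<open>The finite-dimensional Hilbert space \<open>\<H>\<close> is \<open>'k ^ 'n\<close>, with conjugation on the left argument.\<close>

definition hinner :: "'k::real_or_complex ^ 'n \<Rightarrow> 'k ^ 'n \<Rightarrow> 'k" where
  "hinner x y = (\<Sum>i\<in>UNIV. conj (x $ i) * y $ i)"

definition adjoint_mat :: "'k::real_or_complex ^ 'n ^ 'm \<Rightarrow> 'k ^ 'm ^ 'n" where
  "adjoint_mat A = (\<chi> i j. conj (A $ j $ i))"

definition scale_mat :: "complex \<Rightarrow> complex ^ 'n ^ 'm \<Rightarrow> complex ^ 'n ^ 'm" (infixr "*m" 75) where
  "c *m A = (\<chi> i j. c * A $ i $ j)"

text \<open>\<open>\<H>\<^sup>2\<close> is \<open>'k ^ ('n + 'n)\<close>: \<open>Inl\<close> indexes the first summand and \<open>Inr\<close> the second.\<close>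

definition block_mat ::
  "'a ^ 'n ^ 'n \<Rightarrow> 'a ^ 'n ^ 'n \<Rightarrow> 'a ^ 'n ^ 'n \<Rightarrow> 'a ^ 'n ^ 'n \<Rightarrow> 'a ^ ('n + 'n) ^ ('n + 'n)" where
  "block_mat A B C D = (\<chi> i j. case i of
      Inl a \<Rightarrow> (case j of Inl b \<Rightarrow> A $ a $ b | Inr b \<Rightarrow> B $ a $ b)
    | Inr a \<Rightarrow> (case j of Inl b \<Rightarrow> C $ a $ b | Inr b \<Rightarrow> D $ a $ b))"

definition block_col :: "'a ^ 'n ^ 'n \<Rightarrow> 'a ^ 'n ^ 'n \<Rightarrow> 'a ^ 'n ^ ('n + 'n)" where
  "block_col A B = (\<chi> i j. case i of Inl a \<Rightarrow> A $ a $ j | Inr a \<Rightarrow> B $ a $ j)"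

definition block_row :: "'a ^ 'n ^ 'n \<Rightarrow> 'a ^ 'n ^ 'n \<Rightarrow> 'a ^ ('n + 'n) ^ 'n" where
  "block_row A B = (\<chi> i j. case j of Inl b \<Rightarrow> A $ i $ b | Inr b \<Rightarrow> B $ i $ b)"

definition block_vec :: "'a ^ 'n \<Rightarrow> 'a ^ 'n \<Rightarrow> 'a ^ ('n + 'n)" where
  "block_vec x y = (\<chi> i. case i of Inl a \<Rightarrow> x $ a | Inr a \<Rightarrow> y $ a)"

definition fst_block :: "'a ^ ('n + 'n) \<Rightarrow> 'a ^ 'n" where
  "fst_block x = (\<chi> a. x $ Inl a)"

definition snd_block :: "'a ^ ('n + 'n) \<Rightarrow> 'a ^ 'n" where
  "snd_block x = (\<chi> a. x $ Inr a)"


section \<open>Face operators\<close>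

datatype side = South | North | West | East

lemma UNIV_side: "(UNIV :: side set) = {South, North, West, East}"
  using side.exhaust by blast

instance side :: finite
  by standard (simp add: UNIV_side)

text \<open>
  An operator on \<open>\<H>\<^sub>1 \<oplus> \<H>\<^sub>1 \<oplus> \<H>\<^sub>2 \<oplus> \<H>\<^sub>2\<close> is given by its blocks \<open>Q a b\<close> (row \<open>a\<close>, column \<open>b\<close>). Only
  \<open>\<H>\<^sub>1 = \<H>\<^sub>2\<close> is needed, because dihedral invariance requires it.
\<close>

type_synonym ('k, 'n) face = "side \<Rightarrow> side \<Rightarrow> 'k ^ 'n ^ 'n"

definition face_apply ::
  "('k::real_or_complex, 'n::finite) face \<Rightarrow> (side \<Rightarrow> 'k ^ 'n) \<Rightarrow> side \<Rightarrow> 'k ^ 'n" where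
  "face_apply Q x a = (\<Sum>b\<in>UNIV. Q a b *v x b)"

definition face_operator :: "('k::real_or_complex, 'n::finite) face \<Rightarrow> bool" where
  "face_operator Q \<longleftrightarrow>
     (\<forall>a b. Q a b = adjoint_mat (Q b a)) \<and>
     (\<forall>x. (\<exists>a. x a \<noteq> 0) \<longrightarrow>
        0 < Re (to_complex (\<Sum>a\<in>UNIV. hinner (x a) (face_apply Q x a))))"

definition dihedral_invariant :: "('k::real_or_complex, 'n::finite) face \<Rightarrow> bool" where
  "dihedral_invariant Q \<longleftrightarrow> (\<exists>T A U.
     adjoint_mat T = T \<and> adjoint_mat A = A \<and> adjoint_mat U = U \<and>
     Q South South = T \<and> Q South North = A \<and> Q South West = U \<and> Q South East = U \<and>
     Q North South = A \<and> Q North North = T \<and> Q North West = U \<and> Q North East = U \<and>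
     Q West South = U \<and> Q West North = U \<and> Q West West = T \<and> Q West East = A \<and>
     Q East South = U \<and> Q East North = U \<and> Q East West = A \<and> Q East East = T)"

abbreviation cblock :: "('k::real_or_complex, 'n::finite) face \<Rightarrow> side \<Rightarrow> side \<Rightarrow> complex ^ 'n ^ 'n" where
  "cblock Q a b \<equiv> cmat (Q a b)"

definition phi_SN :: "('k::real_or_complex, 'n::finite) face \<Rightarrow> complex \<Rightarrow> complex ^ 'n ^ 'n" where
  "phi_SN Q w = cblock Q South South + cblock Q North North
     + w *m cblock Q South North + inverse w *m cblock Q North South"

definition phi_WE :: "('k::real_or_complex, 'n::finite) face \<Rightarrow> complex \<Rightarrow> complex ^ 'n ^ 'n" where
  "phi_WE Q z = cblock Q West West + cblock Q East East
     + z *m cblock Q West East + inverse z *m cblock Q East West"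

definition Psi ::
  "('k::real_or_complex, 'n::finite) face \<Rightarrow> complex \<Rightarrow> complex \<Rightarrow> complex ^ ('n + 'n) ^ ('n + 'n)" where
  "Psi Q z w = block_mat
     (phi_SN Q w)
     (cblock Q South West + z *m cblock Q South East
        + inverse w *m cblock Q North West + (inverse w * z) *m cblock Q North East)
     (cblock Q West South + inverse z *m cblock Q East South
        + w *m cblock Q West North + (w * inverse z) *m cblock Q East North)
     (phi_WE Q z)"

definition kernel_dim :: "complex ^ 'm ^ 'm \<Rightarrow> nat" where
  "kernel_dim A = vec.dim {x. A *v x = 0}"

definition simple_zero :: "(complex \<Rightarrow> complex) \<Rightarrow> complex \<Rightarrow> bool" where
  "simple_zero f a \<longleftrightarrow> f a = 0 \<and> deriv f a \<noteq> 0"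

text \<open>Multiplicity (order of vanishing) one for a function of two variables: the first-order
  Taylor polynomial does not vanish.\<close>

definition simple_zero2 :: "(complex \<Rightarrow> complex \<Rightarrow> complex) \<Rightarrow> complex \<Rightarrow> complex \<Rightarrow> bool" where
  "simple_zero2 f a b \<longleftrightarrow>
     f a b = 0 \<and> (deriv (\<lambda>z. f z b) a \<noteq> 0 \<or> deriv (\<lambda>w. f a w) b \<noteq> 0)"

definition two_d_simple :: "('k::real_or_complex, 'n::finite) face \<Rightarrow> bool" where
  "two_d_simple Q \<longleftrightarrow>
     (\<forall>w. w \<noteq> 0 \<and> det (phi_SN Q w) = 0 \<longrightarrow>
        simple_zero (\<lambda>w. det (phi_SN Q w)) w \<and> kernel_dim (phi_SN Q w) = 1) \<and>
     (\<forall>z. z \<noteq> 0 \<and> det (phi_WE Q z) = 0 \<longrightarrow>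
        simple_zero (\<lambda>z. det (phi_WE Q z)) z \<and> kernel_dim (phi_WE Q z) = 1) \<and>
     (\<forall>z w. z \<noteq> 0 \<and> w \<noteq> 0 \<and> det (Psi Q z w) = 0 \<longrightarrow>
        simple_zero2 (\<lambda>z w. det (Psi Q z w)) z w \<and> kernel_dim (Psi Q z w) = 1 \<and>
        \<not> (norm z = 1 \<and> norm w = 1)) \<and>
     (\<forall>u. norm u = 1 \<longrightarrow>
        (\<forall>w. w \<noteq> 0 \<and> det (Psi Q u w) = 0 \<longrightarrow> simple_zero (\<lambda>w. det (Psi Q u w)) w) \<and>
        (\<forall>z. z \<noteq> 0 \<and> det (Psi Q z u) = 0 \<longrightarrow> simple_zero (\<lambda>z. det (Psi Q z u)) z))"


section \<open>Square-summable sequences and folding\<close>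

text \<open>\<open>\<ell>\<^sup>2(I; V)\<close> for \<open>I \<subseteq> \<int>\<close> is taken inside \<open>\<ell>\<^sup>2(\<int>; V)\<close>, by extension by zero.\<close>

definition ell2 :: "int set \<Rightarrow> (int \<Rightarrow> 'v::real_normed_vector) set" where
  "ell2 I = {f. (\<forall>k. k \<notin> I \<longrightarrow> f k = 0) \<and> (\<lambda>k. (norm (f k))\<^sup>2) summable_on UNIV}"

definition ell2_inner :: "(int \<Rightarrow> 'k::real_or_complex ^ 'n) \<Rightarrow> (int \<Rightarrow> 'k ^ 'n) \<Rightarrow> 'k" where
  "ell2_inner f g = (\<Sum>\<^sub>\<infinity>k. hinner (f k) (g k))"

definition restrict_seq :: "int set \<Rightarrow> (int \<Rightarrow> 'v::zero) \<Rightarrow> int \<Rightarrow> 'v" where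
  "restrict_seq I f = (\<lambda>k. if k \<in> I then f k else 0)"

definition reflect :: "(int \<Rightarrow> 'v) \<Rightarrow> int \<Rightarrow> 'v" where
  "reflect f = (\<lambda>k. f (- 1 - k))"

text \<open>The folded operator \<open>P M P - P M J P\<close>, to be used on \<open>ell2 I\<close>, the range of \<open>P\<close>.\<close>

definition fold_op ::
  "int set \<Rightarrow> ((int \<Rightarrow> 'v::ab_group_add) \<Rightarrow> int \<Rightarrow> 'v) \<Rightarrow> (int \<Rightarrow> 'v) \<Rightarrow> int \<Rightarrow> 'v" where
  "fold_op I M f = restrict_seq I (M (restrict_seq I f)) - restrict_seq I (M (reflect (restrict_seq I f)))"


section \<open>The strip operator\<close>

definition S_WE ::
  "('k::real_or_complex, 'n::finite) face \<Rightarrow> complex \<Rightarrow> complex ^ ('n + 'n) ^ ('n + 'n)" where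
  "S_WE Q z =
     block_mat (cblock Q South South) (cblock Q South North)
               (cblock Q North South) (cblock Q North North)
     - (block_col (cblock Q South West) (cblock Q North West)
          + z *m block_col (cblock Q South East) (cblock Q North East))
       ** matrix_inv (phi_WE Q z)
       ** (block_row (cblock Q West South) (cblock Q West North)
          + inverse z *m block_row (cblock Q East South) (cblock Q East North))"

text \<open>\<open>F \<in> L\<^sup>2(S\<^sup>1)\<close> is the sum in \<open>L\<^sup>2\<close> of the Fourier series \<open>\<Sum>k. f(k) exp(i k \<theta>)\<close>; the circle is
  parametrised by \<open>\<theta> \<mapsto> cis \<theta>\<close>.\<close>

definition fourier_sum :: "(int \<Rightarrow> complex ^ 'm) \<Rightarrow> (complex \<Rightarrow> complex ^ 'm) \<Rightarrow> bool" where
  "fourier_sum f F \<longleftrightarrow>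
     set_borel_measurable lborel {0..2*pi} (\<lambda>\<theta>. F (cis \<theta>)) \<and>
     set_integrable lborel {0..2*pi} (\<lambda>\<theta>. (norm (F (cis \<theta>)))\<^sup>2) \<and>
     (\<lambda>N. LINT \<theta>:{0..2*pi}|lborel.
        (norm (F (cis \<theta>) - (\<Sum>k = - int N..int N. cis (of_int k * \<theta>) *s f k)))\<^sup>2)
       \<longlonglongrightarrow> 0"

text \<open>The operator on \<open>\<ell>\<^sup>2(\<int>; \<H>\<^sup>2)\<close> conjugate through Fourier series to multiplication by \<open>S_WE Q\<close>.
  Over the reals, functions on the circle take values in the complexification, whence \<open>cvec\<close>.\<close>

definition strip_operator ::
  "('k::real_or_complex, 'n::finite) face
    \<Rightarrow> (int \<Rightarrow> 'k ^ ('n + 'n)) \<Rightarrow> int \<Rightarrow> 'k ^ ('n + 'n)" where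
  "strip_operator Q f = (THE g. g \<in> ell2 UNIV \<and>
     (\<exists>F. fourier_sum (\<lambda>k. cvec (f k)) F \<and>
          fourier_sum (\<lambda>k. cvec (g k)) (\<lambda>z. S_WE Q z *v F z)))"


section \<open>Half-strip operators\<close>

text \<open>Vectors of \<open>\<W> \<oplus> \<W> \<oplus> \<H>\<close> are triples (South, North, vertical side); operators on this space are
  functions whose values outside \<open>half_strip_space I\<close> play no role.\<close>

type_synonym ('k, 'n) hs_vec = "(int \<Rightarrow> 'k ^ 'n) \<times> (int \<Rightarrow> 'k ^ 'n) \<times> ('k ^ 'n)"

definition half_strip_space :: "int set \<Rightarrow> ('k::real_or_complex, 'n::finite) hs_vec set" where
  "half_strip_space I = ell2 I \<times> ell2 I \<times> UNIV"

fun hs_scale :: "'k::real_or_complex \<Rightarrow> ('k, 'n::finite) hs_vec \<Rightarrow> ('k, 'n) hs_vec" where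
  "hs_scale c (s, n, h) = (\<lambda>k. c *s s k, \<lambda>k. c *s n k, c *s h)"

fun hs_inner :: "('k::real_or_complex, 'n::finite) hs_vec \<Rightarrow> ('k, 'n) hs_vec \<Rightarrow> 'k" where
  "hs_inner (s, n, h) (s', n', h') = ell2_inner s s' + ell2_inner n n' + hinner h h'"

definition hs_norm :: "('k::real_or_complex, 'n::finite) hs_vec \<Rightarrow> real" where
  "hs_norm x = sqrt (Re (to_complex (hs_inner x x)))"

definition bounded_self_adjoint ::
  "int set \<Rightarrow> (('k::real_or_complex, 'n::finite) hs_vec \<Rightarrow> ('k, 'n) hs_vec) \<Rightarrow> bool" where
  "bounded_self_adjoint I M \<longleftrightarrow>
     (\<forall>x\<in>half_strip_space I. M x \<in> half_strip_space I) \<and>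
     (\<forall>x\<in>half_strip_space I. \<forall>y\<in>half_strip_space I. M (x + y) = M x + M y) \<and>
     (\<forall>c. \<forall>x\<in>half_strip_space I. M (hs_scale c x) = hs_scale c (M x)) \<and>
     (\<exists>C. \<forall>x\<in>half_strip_space I. hs_norm (M x) \<le> C * hs_norm x) \<and>
     (\<forall>x\<in>half_strip_space I. \<forall>y\<in>half_strip_space I. hs_inner (M x) y = hs_inner x (M y))"

text \<open>The set \<open>\<Q>\<^bsub>\<infinity>b,1\<^esub>\<close>.\<close>

definition half_strip_operator ::
  "int set \<Rightarrow> (('k::real_or_complex, 'n::finite) hs_vec \<Rightarrow> ('k, 'n) hs_vec) \<Rightarrow> bool" where
  "half_strip_operator I M \<longleftrightarrow> bounded_self_adjoint I M \<and>
     0 < (INF x\<in>half_strip_space I - {0}.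
            Re (to_complex (hs_inner x (M x))) / Re (to_complex (hs_inner x x)))"

definition SN_block ::
  "(('k::real_or_complex, 'n::finite) hs_vec \<Rightarrow> ('k, 'n) hs_vec)
    \<Rightarrow> (int \<Rightarrow> 'k ^ ('n + 'n)) \<Rightarrow> int \<Rightarrow> 'k ^ ('n + 'n)" where
  "SN_block M f =
     (case M (\<lambda>k. fst_block (f k), \<lambda>k. snd_block (f k), 0) of
        (s, n, h) \<Rightarrow> \<lambda>k. block_vec (s k) (n k))"


section \<open>Gluing a face to a half-strip\<close>

text \<open>Schur complement \<open>M\<^sub>1\<^sub>1 - M\<^sub>1\<^sub>2 M\<^sub>2\<^sub>2\<^sup>-\<^sup>1 M\<^sub>2\<^sub>1\<close> with respect to the second component.\<close>

definition schur :: "('a::ab_group_add \<times> 'b::zero \<Rightarrow> 'a \<times> 'b) \<Rightarrow> 'a \<Rightarrow> 'a" where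
  "schur M x = fst (M (x, 0)) - fst (M (0, inv (\<lambda>v. snd (M (0, v))) (snd (M (x, 0)))))"

fun shift_L :: "(int \<Rightarrow> 'v::zero) \<times> 'v \<Rightarrow> int \<Rightarrow> 'v" where
  "shift_L (w, h) = (\<lambda>k. if k = - 1 then h else if k < - 1 then w (k + 1) else 0)"

definition unshift_L :: "(int \<Rightarrow> 'v::zero) \<Rightarrow> (int \<Rightarrow> 'v) \<times> 'v" where
  "unshift_L f = (\<lambda>k. if k < 0 then f (k - 1) else 0, f (- 1))"

fun shift_R :: "'v::zero \<times> (int \<Rightarrow> 'v) \<Rightarrow> int \<Rightarrow> 'v" where
  "shift_R (h, w) = (\<lambda>k. if k = 0 then h else if k \<ge> 1 then w (k - 1) else 0)"

definition unshift_R :: "(int \<Rightarrow> 'v::zero) \<Rightarrow> 'v \<times> (int \<Rightarrow> 'v)" where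
  "unshift_R f = (f 0, \<lambda>k. if k \<ge> 0 then f (k + 1) else 0)"

lemma shift_L_unshift_L: "f \<in> ell2 {..<0} \<Longrightarrow> shift_L (unshift_L f) = f"
  by (auto simp: unshift_L_def ell2_def fun_eq_iff)

lemma unshift_L_shift_L: "w \<in> ell2 {..<0} \<Longrightarrow> unshift_L (shift_L (w, h)) = (w, h)"
  by (auto simp: unshift_L_def ell2_def fun_eq_iff)

lemma shift_R_unshift_R: "f \<in> ell2 {0..} \<Longrightarrow> shift_R (unshift_R f) = f"
  by (auto simp: unshift_R_def ell2_def fun_eq_iff)

lemma unshift_R_shift_R: "w \<in> ell2 {0..} \<Longrightarrow> unshift_R (shift_R (h, w)) = (h, w)"
  by (auto simp: unshift_R_def ell2_def fun_eq_iff)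

fun on_sides :: "'v \<Rightarrow> 'v \<Rightarrow> 'v \<Rightarrow> 'v \<Rightarrow> side \<Rightarrow> 'v" where
  "on_sides s n w e South = s"
| "on_sides s n w e North = n"
| "on_sides s n w e West = w"
| "on_sides s n w e East = e"

text \<open>
  The operator of the sum of the two quadratic forms when the face is placed at the East side of a
  West half-strip. The last component \<open>v\<close> is the variable of the shared vertical edge; the others are
  the South and North sides (half-line, then unit segment) and the new East edge.
\<close>

fun join_W ::
  "('k::real_or_complex, 'n::finite) face \<Rightarrow> (('k, 'n) hs_vec \<Rightarrow> ('k, 'n) hs_vec) \<Rightarrow>
   (((int \<Rightarrow> 'k ^ 'n) \<times> ('k ^ 'n)) \<times> ((int \<Rightarrow> 'k ^ 'n) \<times> ('k ^ 'n)) \<times> ('k ^ 'n)) \<times> ('k ^ 'n) \<Rightarrow>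
   (((int \<Rightarrow> 'k ^ 'n) \<times> ('k ^ 'n)) \<times> ((int \<Rightarrow> 'k ^ 'n) \<times> ('k ^ 'n)) \<times> ('k ^ 'n)) \<times> ('k ^ 'n)" where
  "join_W Q M (((s, qs), (n, qn), e), v) =
     (case M (s, n, v) of (s', n', v') \<Rightarrow>
        let q = face_apply Q (on_sides qs qn v e)
        in (((s', q South), (n', q North), q East), v' + q West))"

text \<open>The mirror image: the face is placed at the West side of an East half-strip.\<close>

fun join_E ::
  "('k::real_or_complex, 'n::finite) face \<Rightarrow> (('k, 'n) hs_vec \<Rightarrow> ('k, 'n) hs_vec) \<Rightarrow>
   ((('k ^ 'n) \<times> (int \<Rightarrow> 'k ^ 'n)) \<times> (('k ^ 'n) \<times> (int \<Rightarrow> 'k ^ 'n)) \<times> ('k ^ 'n)) \<times> ('k ^ 'n) \<Rightarrow>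
   ((('k ^ 'n) \<times> (int \<Rightarrow> 'k ^ 'n)) \<times> (('k ^ 'n) \<times> (int \<Rightarrow> 'k ^ 'n)) \<times> ('k ^ 'n)) \<times> ('k ^ 'n)" where
  "join_E Q M (((qs, s), (qn, n), w), v) =
     (case M (s, n, v) of (s', n', v') \<Rightarrow>
        let q = face_apply Q (on_sides qs qn w v)
        in (((q South, s'), (q North, n'), q West), v' + q East))"

definition glue_W ::
  "('k::real_or_complex, 'n::finite) face \<Rightarrow> (('k, 'n) hs_vec \<Rightarrow> ('k, 'n) hs_vec)
    \<Rightarrow> ('k, 'n) hs_vec \<Rightarrow> ('k, 'n) hs_vec" where
  "glue_W Q M = (\<lambda>(s, n, h).
     case schur (join_W Q M) (unshift_L s, unshift_L n, h) of
       (s', n', h') \<Rightarrow> (shift_L s', shift_L n', h'))"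

definition glue_E ::
  "('k::real_or_complex, 'n::finite) face \<Rightarrow> (('k, 'n) hs_vec \<Rightarrow> ('k, 'n) hs_vec)
    \<Rightarrow> ('k, 'n) hs_vec \<Rightarrow> ('k, 'n) hs_vec" where
  "glue_E Q M = (\<lambda>(s, n, h).
     case schur (join_E Q M) (unshift_R s, unshift_R n, h) of
       (s', n', h') \<Rightarrow> (shift_R s', shift_R n', h'))"

definition west_fixed_point ::
  "('k::real_or_complex, 'n::finite) face \<Rightarrow> (('k, 'n) hs_vec \<Rightarrow> ('k, 'n) hs_vec) \<Rightarrow> bool" where
  "west_fixed_point Q M \<longleftrightarrow> half_strip_operator {..<0} M \<and>
     (\<forall>x\<in>half_strip_space {..<0}. glue_W Q M x = M x)"

definition east_fixed_point ::
  "('k::real_or_complex, 'n::finite) face \<Rightarrow> (('k, 'n) hs_vec \<Rightarrow> ('k, 'n) hs_vec) \<Rightarrow> bool" where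
  "east_fixed_point Q M \<longleftrightarrow> half_strip_operator {0..} M \<and>
     (\<forall>x\<in>half_strip_space {0..}. glue_E Q M x = M x)"

end

theory Submission
  imports Defs
begin

text \<open>
  Gluing a face to a half-strip amounts to minimising the energy over the shared vertical edge. Unrolling
  the fixed point equation therefore expresses the half-strip operator through a sequence of vertical
  edge variables that satisfies a three-term recurrence; the energies of the faces telescope, and since
  the face form is coercive the sequence is square summable.

  The recurrence on a half-line with value 0 at the end edge extends, by odd reflection, to the
  recurrence on the whole line, and with vanishing normal force at the end edge it extends by even
  reflection. In Fourier variables the recurrence on \<open>\<int>\<close> reads
  \<open>\<phi>\<^sup>W\<^sup>E(z) V(z) = - (1 + z) U (f\<^sub>S(z) + f\<^sub>N(z))\<close>, and eliminating \<open>V\<close> gives exactly the multiplier \<open>S_WE\<close>.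
  Since odd reflection is \<open>f - J f\<close>, the odd solution yields the folded operator; the even one is
  needed to know that the strip operator is defined at \<open>f\<close> and \<open>J f\<close> separately.
\<close>


section \<open>Square-integrable functions\<close>

text \<open>A dihedral face is unchanged when West and East are exchanged. This is why reflection
  maps solutions to solutions, and why both half-strips can be enumerated outward from their
  vertical side and treated at once. The recurrence is a balance of forces: the edge between the
  faces \<open>k - 1\<close> and \<open>k\<close> is the East edge of one and the West edge of the
  other, and the two rows of the face operator must cancel there. In the [SN],[SN] block the
  vertical side is held at 0, whence the odd reflection and the minus sign of the folding. The
  obstacle is that \<open>strip_operator\<close> is a definite description: a value can be used only
  after an output with the right Fourier sum has been exhibited, and additivity cannot be assumed
  beforehand. Superposition of solutions replaces it: data on one half-line are the half-sum or
  half-difference of their even and odd extensions, and so are the edge sequences. The energy bounds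
  the edges because what remains after each removed face still has nonnegative energy, so the face
  energies add up to at most the initial one.\<close>

definition square_integrable :: "'a measure \<Rightarrow> ('a \<Rightarrow> 'b::{banach, second_countable_topology}) \<Rightarrow> bool" where
  "square_integrable M f \<longleftrightarrow> f \<in> borel_measurable M \<and> integrable M (\<lambda>x. (norm (f x))\<^sup>2)"

lemma norm_add_sq_le: "(norm (a + b))\<^sup>2 \<le> 2 * (norm a)\<^sup>2 + 2 * (norm (b::'b::real_normed_vector))\<^sup>2"
proof -
  have "(norm (a + b))\<^sup>2 \<le> (norm a + norm b)\<^sup>2"
    by (intro power_mono norm_triangle_ineq) auto
  also have "\<dots> \<le> 2 * (norm a)\<^sup>2 + 2 * (norm b)\<^sup>2"
    using sum_squares_bound[of "norm a" "norm b"] by (simp add: power2_sum)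
  finally show ?thesis .
qed

lemma square_integrable_bound:
  fixes f :: "'a \<Rightarrow> 'b::{banach, second_countable_topology}"
    and g :: "'a \<Rightarrow> 'c::{banach, second_countable_topology}"
  assumes "square_integrable M g" "f \<in> borel_measurable M" "\<And>x. x \<in> space M \<Longrightarrow> norm (f x) \<le> C * norm (g x)"
  shows "square_integrable M f"
    and "(\<integral>x. (norm (f x))\<^sup>2 \<partial>M) \<le> C\<^sup>2 * (\<integral>x. (norm (g x))\<^sup>2 \<partial>M)"
proof -
  have [measurable]: "f \<in> borel_measurable M" "g \<in> borel_measurable M"
    and i: "integrable M (\<lambda>x. (norm (g x))\<^sup>2)"
    using assms by (auto simp: square_integrable_def)
  have le: "(norm (f x))\<^sup>2 \<le> C\<^sup>2 * (norm (g x))\<^sup>2" if "x \<in> space M" for x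
    using power_mono[OF assms(3)[OF that], of 2] by (simp add: power_mult_distrib)
  have i2: "integrable M (\<lambda>x. (norm (f x))\<^sup>2)"
    by (rule Bochner_Integration.integrable_bound[OF integrable_mult_right[OF i, of "C\<^sup>2"]])
      (use le in auto)
  then show "square_integrable M f" by (simp add: square_integrable_def)
  have "(\<integral>x. (norm (f x))\<^sup>2 \<partial>M) \<le> (\<integral>x. C\<^sup>2 * (norm (g x))\<^sup>2 \<partial>M)"
    by (rule integral_mono[OF i2 integrable_mult_right[OF i]]) (use le in auto)
  then show "(\<integral>x. (norm (f x))\<^sup>2 \<partial>M) \<le> C\<^sup>2 * (\<integral>x. (norm (g x))\<^sup>2 \<partial>M)" by simp
qed

lemma square_integrable_add:
  fixes f g :: "'a \<Rightarrow> 'b::{banach, second_countable_topology}"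
  assumes "square_integrable M f" "square_integrable M g"
  shows "square_integrable M (\<lambda>x. f x + g x)"
    and "(\<integral>x. (norm (f x + g x))\<^sup>2 \<partial>M) \<le> 2 * (\<integral>x. (norm (f x))\<^sup>2 \<partial>M) + 2 * (\<integral>x. (norm (g x))\<^sup>2 \<partial>M)"
proof -
  have [measurable]: "f \<in> borel_measurable M" "g \<in> borel_measurable M"
    and i: "integrable M (\<lambda>x. (norm (g x))\<^sup>2)" "integrable M (\<lambda>x. (norm (f x))\<^sup>2)"
    using assms by (auto simp: square_integrable_def)
  have i3: "integrable M (\<lambda>x. 2 * (norm (f x))\<^sup>2 + 2 * (norm (g x))\<^sup>2)"
    using i by auto
  have i2: "integrable M (\<lambda>x. (norm (f x + g x))\<^sup>2)"
    by (rule Bochner_Integration.integrable_bound[OF i3]) (use norm_add_sq_le in auto)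
  then show "square_integrable M (\<lambda>x. f x + g x)" by (simp add: square_integrable_def)
  have "(\<integral>x. (norm (f x + g x))\<^sup>2 \<partial>M) \<le> (\<integral>x. 2 * (norm (f x))\<^sup>2 + 2 * (norm (g x))\<^sup>2 \<partial>M)"
    by (rule integral_mono[OF i2 i3]) (rule norm_add_sq_le)
  also have "\<dots> = 2 * (\<integral>x. (norm (f x))\<^sup>2 \<partial>M) + 2 * (\<integral>x. (norm (g x))\<^sup>2 \<partial>M)"
    using i by simp
  finally show "(\<integral>x. (norm (f x + g x))\<^sup>2 \<partial>M) \<le> 2 * (\<integral>x. (norm (f x))\<^sup>2 \<partial>M) + 2 * (\<integral>x. (norm (g x))\<^sup>2 \<partial>M)" .
qed

lemma square_integrable_diff:
  fixes f g :: "'a \<Rightarrow> 'b::{banach, second_countable_topology}"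
  assumes "square_integrable M f" "square_integrable M g"
  shows "square_integrable M (\<lambda>x. f x - g x)"
    and "(\<integral>x. (norm (f x - g x))\<^sup>2 \<partial>M) \<le> 2 * (\<integral>x. (norm (f x))\<^sup>2 \<partial>M) + 2 * (\<integral>x. (norm (g x))\<^sup>2 \<partial>M)"
proof -
  have "square_integrable M (\<lambda>x. - g x)"
    using assms(2) by (simp add: square_integrable_def)
  from square_integrable_add[OF assms(1) this]
  show "square_integrable M (\<lambda>x. f x - g x)"
    and "(\<integral>x. (norm (f x - g x))\<^sup>2 \<partial>M) \<le> 2 * (\<integral>x. (norm (f x))\<^sup>2 \<partial>M) + 2 * (\<integral>x. (norm (g x))\<^sup>2 \<partial>M)"
    by simp_all
qed

text \<open>Pointwise, either \<open>t \<le> e\<close>, or \<open>t > e\<close> and then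
  \<open>t < t^2 / e\<close>. The free parameter \<open>e\<close> balances the two terms and takes
  the place of the Cauchy-Schwarz inequality in passing from L2 to L1.\<close>

lemma L1_le_L2:
  fixes f :: "'a \<Rightarrow> 'b::{banach, second_countable_topology}"
  assumes "finite_measure M" "square_integrable M f" "e > 0"
  shows "integrable M f"
    and "(\<integral>x. norm (f x) \<partial>M) \<le> e * measure M (space M) + (\<integral>x. (norm (f x))\<^sup>2 \<partial>M) / e"
proof -
  interpret finite_measure M by fact
  have [measurable]: "f \<in> borel_measurable M" and i: "integrable M (\<lambda>x. (norm (f x))\<^sup>2)"
    using assms by (auto simp: square_integrable_def)
  have le: "norm (f x) \<le> e + (norm (f x))\<^sup>2 / e" for x
  proof (cases "norm (f x) \<le> e")
    case False
    then have "norm (f x) * e \<le> norm (f x) * norm (f x)" by (intro mult_left_mono) auto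
    then have "norm (f x) \<le> (norm (f x))\<^sup>2 / e"
      using \<open>e > 0\<close> by (simp add: pos_le_divide_eq power2_eq_square)
    then show ?thesis using \<open>e > 0\<close> by linarith
  qed (use \<open>e > 0\<close> in \<open>simp add: add_increasing2\<close>)
  have i2: "integrable M (\<lambda>x. e + (norm (f x))\<^sup>2 / e)" using i by auto
  show "integrable M f"
    by (rule Bochner_Integration.integrable_bound[OF i2])
      (use \<open>e > 0\<close> le in \<open>auto intro!: AE_I2 order_trans[OF le]\<close>)
  then have "(\<integral>x. norm (f x) \<partial>M) \<le> (\<integral>x. e + (norm (f x))\<^sup>2 / e \<partial>M)"
    by (intro integral_mono i2 le) auto
  also have "\<dots> = e * measure M (space M) + (\<integral>x. (norm (f x))\<^sup>2 \<partial>M) / e"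
    using i by simp
  finally show "(\<integral>x. norm (f x) \<partial>M) \<le> e * measure M (space M) + (\<integral>x. (norm (f x))\<^sup>2 \<partial>M) / e" .
qed

text \<open>On a finite measure space an L2-Cauchy sequence is L1-Cauchy, so a subsequence converges
  almost everywhere; Fatou's lemma shows that its pointwise limit is the L2 limit of the whole
  sequence.\<close>

lemma riesz_fischer:
  fixes s :: "nat \<Rightarrow> 'a \<Rightarrow> 'b::{banach, second_countable_topology}"
  assumes fin: "finite_measure M" and s: "\<And>n. square_integrable M (s n)"
    and cauchy: "\<And>e. e > 0 \<Longrightarrow> \<exists>N. \<forall>i\<ge>N. \<forall>j\<ge>N. (\<integral>x. (norm (s i x - s j x))\<^sup>2 \<partial>M) < e"
  shows "\<exists>F. square_integrable M F \<and> (\<lambda>n. \<integral>x. (norm (F x - s n x))\<^sup>2 \<partial>M) \<longlonglongrightarrow> 0"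
proof -
  interpret finite_measure M by fact
  have [measurable]: "s n \<in> borel_measurable M" for n
    using s by (simp add: square_integrable_def)
  have sq: "square_integrable M (\<lambda>x. s i x - s j x)" for i j
    using s by (rule square_integrable_diff(1)[OF _ s])
  have "\<exists>N. \<forall>i\<ge>N. \<forall>j\<ge>N. (\<integral>x. norm (s i x - s j x) \<partial>M) < e" if "e > 0" for e
  proof -
    \<comment> \<open>Adding 1 keeps \<open>m\<close> positive even if the space is null. With
      \<open>d = e / (2 * m)\<close> each of the two terms of \<open>L1_le_L2\<close> stays below
      e/2.\<close>
    define m where "m = measure M (space M) + 1"
    have m: "m > 0" "measure M (space M) < m" by (auto simp: m_def add_nonneg_pos)
    define d where "d = e / (2 * m)"
    have d: "d > 0" using m \<open>e > 0\<close> by (simp add: d_def)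
    obtain N where N: "\<And>i j. i \<ge> N \<Longrightarrow> j \<ge> N \<Longrightarrow> (\<integral>x. (norm (s i x - s j x))\<^sup>2 \<partial>M) < d * (e / 2)"
      using cauchy[of "d * (e / 2)"] d \<open>e > 0\<close> by auto
    have "(\<integral>x. norm (s i x - s j x) \<partial>M) < e" if "i \<ge> N" "j \<ge> N" for i j
    proof -
      have "(\<integral>x. norm (s i x - s j x) \<partial>M) \<le> d * measure M (space M) + (\<integral>x. (norm (s i x - s j x))\<^sup>2 \<partial>M) / d"
        by (rule L1_le_L2(2)[OF fin sq d])
      also have "\<dots> < d * m + (d * (e / 2)) / d"
        using N[OF that] d m by (intro add_strict_mono divide_strict_right_mono mult_strict_left_mono)
      also have "\<dots> = e" using d m by (simp add: d_def)
      finally show ?thesis .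
    qed
    then show ?thesis by blast
  qed
  then obtain r where r: "strict_mono r" "AE x in M. Cauchy (\<lambda>i. s (r i) x)"
    using cauchy_L1_AE_cauchy_subseq[of M s] L1_le_L2(1)[OF fin s zero_less_one]
    by blast
  define F where "F x = lim (\<lambda>i. s (r i) x)" for x
  have [measurable]: "F \<in> borel_measurable M" unfolding F_def by measurable
  have lim: "AE x in M. (\<lambda>i. s (r i) x) \<longlonglongrightarrow> F x"
    using r(2) by eventually_elim (auto simp: F_def Cauchy_convergent_iff convergent_LIMSEQ_iff)
  \<comment> \<open>Fatou along the subsequence \<open>r\<close> with \<open>n\<close> fixed: the
    Cauchy bound passes to \<open>F - s n\<close>, as a weak inequality, and its finiteness also
    gives integrability.\<close>
  have key: "integrable M (\<lambda>x. (norm (F x - s n x))\<^sup>2) \<and> (\<integral>x. (norm (F x - s n x))\<^sup>2 \<partial>M) \<le> e"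
    if "e > 0" and N: "\<And>i j. i \<ge> N \<Longrightarrow> j \<ge> N \<Longrightarrow> (\<integral>x. (norm (s i x - s j x))\<^sup>2 \<partial>M) < e" and "n \<ge> N" for e N n
  proof -
    have "(\<integral>\<^sup>+x. ennreal ((norm (F x - s n x))\<^sup>2) \<partial>M)
        = (\<integral>\<^sup>+x. liminf (\<lambda>i. ennreal ((norm (s (r i) x - s n x))\<^sup>2)) \<partial>M)"
    proof (rule nn_integral_cong_AE)
      show "AE x in M. ennreal ((norm (F x - s n x))\<^sup>2) = liminf (\<lambda>i. ennreal ((norm (s (r i) x - s n x))\<^sup>2))"
        using lim
      proof eventually_elim
        case (elim x)
        have "(\<lambda>i. ennreal ((norm (s (r i) x - s n x))\<^sup>2)) \<longlonglongrightarrow> ennreal ((norm (F x - s n x))\<^sup>2)"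
          by (intro tendsto_intros elim tendsto_ennrealI)
        then show ?case
          by (rule lim_imp_Liminf[OF sequentially_bot, symmetric])
      qed
    qed
    also have "\<dots> \<le> liminf (\<lambda>i. \<integral>\<^sup>+x. ennreal ((norm (s (r i) x - s n x))\<^sup>2) \<partial>M)"
      by (rule nn_integral_liminf) simp
    also have "\<dots> \<le> ennreal e"
    proof (rule Liminf_le)
      show "\<forall>\<^sub>F i in sequentially. (\<integral>\<^sup>+x. ennreal ((norm (s (r i) x - s n x))\<^sup>2) \<partial>M) \<le> ennreal e"
      proof (rule eventually_sequentiallyI[of N])
        fix i assume "i \<ge> N"
        then have "r i \<ge> N" using seq_suble[OF r(1), of i] by simp
        moreover have "(\<integral>\<^sup>+x. ennreal ((norm (s (r i) x - s n x))\<^sup>2) \<partial>M)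
             = ennreal (\<integral>x. (norm (s (r i) x - s n x))\<^sup>2 \<partial>M)"
          by (rule nn_integral_eq_integral) (use sq in \<open>auto simp: square_integrable_def\<close>)
        ultimately show "(\<integral>\<^sup>+x. ennreal ((norm (s (r i) x - s n x))\<^sup>2) \<partial>M) \<le> ennreal e"
          using N[of "r i" n] \<open>n \<ge> N\<close> by (simp add: ennreal_leI)
      qed
    qed simp
    finally have le: "(\<integral>\<^sup>+x. ennreal ((norm (F x - s n x))\<^sup>2) \<partial>M) \<le> ennreal e" .
    have i: "integrable M (\<lambda>x. (norm (F x - s n x))\<^sup>2)"
    proof (rule integrableI_bounded)
      show "(\<integral>\<^sup>+x. ennreal (norm ((norm (F x - s n x))\<^sup>2)) \<partial>M) < \<infinity>"
        using le by (simp add: le_less_trans[OF _ ennreal_less_top])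
    qed simp
    moreover have "ennreal (\<integral>x. (norm (F x - s n x))\<^sup>2 \<partial>M) \<le> ennreal e"
      using le by (simp add: nn_integral_eq_integral[OF i])
    ultimately show ?thesis using \<open>e > 0\<close> by simp
  qed
  show ?thesis
  proof (intro exI conjI)
    obtain N where N: "\<And>i j. i \<ge> N \<Longrightarrow> j \<ge> N \<Longrightarrow> (\<integral>x. (norm (s i x - s j x))\<^sup>2 \<partial>M) < 1"
      using cauchy[of 1] by auto
    have "square_integrable M (\<lambda>x. F x - s N x)"
      using key[of 1 N N] N by (simp add: square_integrable_def)
    from square_integrable_add(1)[OF this s[of N]]
    show "square_integrable M F" by simp
    show "(\<lambda>n. \<integral>x. (norm (F x - s n x))\<^sup>2 \<partial>M) \<longlonglongrightarrow> 0"
    proof (rule LIMSEQ_I)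
      fix e :: real assume "e > 0"
      \<comment> \<open>Half of \<open>e\<close>, because \<open>key\<close> returns only a weak
        inequality.\<close>
      then obtain N where N: "\<And>i j. i \<ge> N \<Longrightarrow> j \<ge> N \<Longrightarrow> (\<integral>x. (norm (s i x - s j x))\<^sup>2 \<partial>M) < e / 2"
        using cauchy[of "e / 2"] by auto
      show "\<exists>no. \<forall>n\<ge>no. norm ((\<integral>x. (norm (F x - s n x))\<^sup>2 \<partial>M) - 0) < e"
        using key[of "e / 2" N] N \<open>e > 0\<close> by (intro exI[of _ N]) fastforce
    qed
  qed
qed

lemma L2_limit_AE_unique:
  fixes F G :: "'a \<Rightarrow> 'b::{banach, second_countable_topology}"
  assumes F: "square_integrable M F" and G: "square_integrable M G" and s: "\<And>n. square_integrable M (s n)"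
    and "(\<lambda>n. \<integral>x. (norm (F x - s n x))\<^sup>2 \<partial>M) \<longlonglongrightarrow> 0"
    and "(\<lambda>n. \<integral>x. (norm (G x - s n x))\<^sup>2 \<partial>M) \<longlonglongrightarrow> 0"
  shows "AE x in M. F x = G x"
proof -
  have FG: "square_integrable M (\<lambda>x. F x - G x)" by (rule square_integrable_diff[OF F G])
  have le: "(\<integral>x. (norm (F x - G x))\<^sup>2 \<partial>M)
      \<le> 2 * (\<integral>x. (norm (F x - s n x))\<^sup>2 \<partial>M) + 2 * (\<integral>x. (norm (G x - s n x))\<^sup>2 \<partial>M)" for n
    using square_integrable_diff(2)[OF square_integrable_diff(1)[OF F s[of n]] square_integrable_diff(1)[OF G s[of n]]]
    by simp
  have "(\<lambda>n. 2 * (\<integral>x. (norm (F x - s n x))\<^sup>2 \<partial>M) + 2 * (\<integral>x. (norm (G x - s n x))\<^sup>2 \<partial>M)) \<longlonglongrightarrow> 2 * 0 + 2 * 0"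
    by (intro tendsto_intros assms)
  then have "(\<integral>x. (norm (F x - G x))\<^sup>2 \<partial>M) \<le> 2 * 0 + 2 * 0"
    using le by (intro LIMSEQ_le_const) auto
  then have "(\<integral>x. (norm (F x - G x))\<^sup>2 \<partial>M) = 0"
    by (simp add: antisym)
  then have "AE x in M. (norm (F x - G x))\<^sup>2 = 0"
    using FG by (subst (asm) integral_nonneg_eq_0_iff_AE) (auto simp: square_integrable_def)
  then show ?thesis by simp
qed


section \<open>Fourier series on the circle\<close>

text \<open>The circle as a finite measure space in the angle, of mass 2 pi, so that the L2 lemmas
  apply to \<open>fourier_sum\<close> through \<open>fourier_sum_iff\<close>. Both endpoints stand
  for the point 1; they are null.\<close>

definition circ :: "real measure" where
  "circ = restrict_space lborel {0..2*pi}"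

definition trig_sum :: "int set \<Rightarrow> (int \<Rightarrow> complex ^ 'm) \<Rightarrow> real \<Rightarrow> complex ^ 'm" where
  "trig_sum A f \<theta> = (\<Sum>k\<in>A. cis (of_int k * \<theta>) *s f k)"

lemma integral_circ:
  fixes f :: "real \<Rightarrow> 'b::{banach, second_countable_topology}"
  shows "(\<integral>\<theta>. f \<theta> \<partial>circ) = (LINT \<theta>:{0..2*pi}|lborel. f \<theta>)"
  by (simp add: circ_def integral_restrict_space set_lebesgue_integral_def)

lemma integrable_circ:
  fixes f :: "real \<Rightarrow> 'b::{banach, second_countable_topology}"
  shows "integrable circ f \<longleftrightarrow> set_integrable lborel {0..2*pi} f"
  by (simp add: circ_def integrable_restrict_space set_integrable_def)

lemma borel_measurable_circ:
  fixes f :: "real \<Rightarrow> 'b::real_normed_vector"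
  shows "f \<in> borel_measurable circ \<longleftrightarrow> set_borel_measurable lborel {0..2*pi} f"
  by (simp add: circ_def borel_measurable_restrict_space_iff set_borel_measurable_def)

lemma finite_measure_circ: "finite_measure circ"
  by (rule finite_measureI) (simp add: circ_def emeasure_restrict_space space_restrict_space)

lemma fourier_sum_iff:
  "fourier_sum f F \<longleftrightarrow> square_integrable circ (\<lambda>\<theta>. F (cis \<theta>)) \<and>
     (\<lambda>N. \<integral>\<theta>. (norm (F (cis \<theta>) - trig_sum {- int N..int N} f \<theta>))\<^sup>2 \<partial>circ) \<longlonglongrightarrow> 0"
  by (simp add: fourier_sum_def square_integrable_def integral_circ integrable_circ
      borel_measurable_circ trig_sum_def)

lemma continuous_imp_measurable_circ:
  "continuous_on UNIV f \<Longrightarrow> f \<in> borel_measurable circ"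
  unfolding circ_def by (intro measurable_restrict_space1) (simp add: borel_measurable_continuous_onI)

lemma measurable_trig_sum [measurable]: "trig_sum A f \<in> borel_measurable circ"
  unfolding trig_sum_def vector_scalar_mult_def
  by (intro continuous_imp_measurable_circ continuous_intros)

text \<open>For \<open>j \<noteq> 0\<close> the antiderivative \<open>cis (j * x) / (i * j)\<close>
  takes the same value at 0 and at 2 pi.\<close>

lemma integral_cis:
  "has_bochner_integral circ (\<lambda>\<theta>. cis (of_int j * \<theta>)) (if j = 0 then 2 * pi else 0)"
proof (cases "j = 0")
  case True
  have "measure circ (space circ) = 2 * pi"
    by (simp add: circ_def measure_restrict_space space_restrict_space)
  with True finite_measure.integrable_const[OF finite_measure_circ, of "1::complex"] show ?thesis
    by (simp add: has_bochner_integral_iff scaleR_conv_of_real)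
next
  case False
  have "has_bochner_integral lborel (\<lambda>x. indicator {0..2*pi} x *\<^sub>R cis (of_int j * x))
      (cis (of_int j * (2 * pi)) / (\<i> * of_int j) - cis (of_int j * 0) / (\<i> * of_int j))"
    using False
    by (intro has_bochner_integral_FTC_Icc)
      (auto intro!: derivative_eq_intros continuous_intros simp: has_vector_derivative_def fun_eq_iff scaleR_conv_of_real
          mult.left_commute[of \<i> "complex_of_real x" for x])
  moreover have "cis (of_int j * (2 * pi)) = 1"
    using cis_multiple_2pi[of "of_int j"] by (simp add: mult_ac)
  ultimately show ?thesis using False
    by (simp add: has_bochner_integral_iff integrable_circ integral_circ set_integrable_def set_lebesgue_integral_def)
qed

text \<open>Squaring leaves only exponentials of frequency \<open>k - l\<close>, whose integrals are
  known; Parseval then reads off the diagonal.\<close>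

lemma norm_trig_sum_sq:
  "(norm (trig_sum A f \<theta>))\<^sup>2
    = (\<Sum>k\<in>A. \<Sum>l\<in>A. Re (cis (of_int (k - l) * \<theta>) * (\<Sum>i\<in>UNIV. f k $ i * cnj (f l $ i))))"
proof -
  have in_cis: "(cis (of_int k * \<theta>) *s x) \<bullet> (cis (of_int l * \<theta>) *s y)
      = Re (cis (of_int (k - l) * \<theta>) * (\<Sum>i\<in>UNIV. x $ i * cnj (y $ i)))" for k l and x y :: "complex ^ 'a"
  proof -
    have ip: "u \<bullet> v = Re (u * cnj v)" for u v :: complex
      by (simp add: inner_complex_def)
    have e: "cis (of_int k * \<theta>) * cnj (cis (of_int l * \<theta>)) = cis (of_int (k - l) * \<theta>)"
      by (simp add: cis_cnj cis_mult algebra_simps)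
    have "(cis (of_int k * \<theta>) *s x) \<bullet> (cis (of_int l * \<theta>) *s y)
      = (\<Sum>i\<in>UNIV. Re ((cis (of_int k * \<theta>) * cnj (cis (of_int l * \<theta>))) * (x $ i * cnj (y $ i))))"
      unfolding inner_vec_def ip by (simp add: mult_ac)
    then show ?thesis
      unfolding e by (simp add: sum_distrib_left)
  qed
  have "(norm (trig_sum A f \<theta>))\<^sup>2 = trig_sum A f \<theta> \<bullet> trig_sum A f \<theta>"
    by (simp add: power2_norm_eq_inner)
  then show ?thesis
    unfolding trig_sum_def inner_sum_left unfolding inner_sum_right in_cis .
qed

lemma trig_sum_parseval:
  assumes "finite A"
  shows "square_integrable circ (trig_sum A f)"
    and "(\<integral>\<theta>. (norm (trig_sum A f \<theta>))\<^sup>2 \<partial>circ) = 2 * pi * (\<Sum>k\<in>A. (norm (f k))\<^sup>2)"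
proof -
  define c where "c k l = (\<Sum>i\<in>UNIV. f k $ i * cnj (f l $ i))" for k l
  have ckk: "Re (c k k) = (norm (f k))\<^sup>2" for k
    by (simp add: c_def power2_norm_eq_inner inner_vec_def inner_complex_def)
  have "has_bochner_integral circ (\<lambda>\<theta>. (norm (trig_sum A f \<theta>))\<^sup>2)
      (\<Sum>k\<in>A. \<Sum>l\<in>A. Re ((if k - l = 0 then 2 * pi else 0) * c k l))"
    unfolding norm_trig_sum_sq c_def
    by (intro has_bochner_integral_sum has_bochner_integral_bounded_linear[OF bounded_linear_Re]
        has_bochner_integral_mult_left integral_cis)
  also have "(\<Sum>k\<in>A. \<Sum>l\<in>A. Re ((if k - l = 0 then 2 * pi else 0) * c k l))
      = (\<Sum>k\<in>A. \<Sum>l\<in>A. if k = l then 2 * pi * (norm (f k))\<^sup>2 else 0)"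
    by (intro sum.cong refl) (auto simp: ckk)
  also have "\<dots> = 2 * pi * (\<Sum>k\<in>A. (norm (f k))\<^sup>2)"
    using assms by (simp add: sum_distrib_left)
  finally show "square_integrable circ (trig_sum A f)"
    and "(\<integral>\<theta>. (norm (trig_sum A f \<theta>))\<^sup>2 \<partial>circ) = 2 * pi * (\<Sum>k\<in>A. (norm (f k))\<^sup>2)"
    by (auto simp: has_bochner_integral_iff square_integrable_def)
qed

section \<open>Tails of square-summable sequences\<close>

lemma summable_on_small_tail:
  fixes f :: "'a \<Rightarrow> real"
  assumes "f summable_on UNIV" "e > 0"
  obtains A where "finite A" "\<And>B. finite B \<Longrightarrow> A \<inter> B = {} \<Longrightarrow> sum f B < e"
proof -
  have "(sum f \<longlongrightarrow> infsum f UNIV) (finite_subsets_at_top UNIV)"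
    using has_sum_infsum[OF assms(1)] by (simp add: has_sum_def)
  then have "\<forall>\<^sub>F B in finite_subsets_at_top UNIV. dist (sum f B) (infsum f UNIV) < e / 2"
    using assms(2) by (intro tendstoD) auto
  then obtain A where A: "finite A" "\<And>B. finite B \<Longrightarrow> A \<subseteq> B \<Longrightarrow> dist (sum f B) (infsum f UNIV) < e / 2"
    by (auto simp: eventually_finite_subsets_at_top)
  show thesis
  proof (rule that[OF A(1)])
    fix B assume B: "finite B" "A \<inter> B = {}"
    have "sum f (A \<union> B) = sum f A + sum f B"
      using A(1) B by (simp add: sum.union_disjoint)
    \<comment> \<open>The sums over \<open>A\<close> and over \<open>A \<union> B\<close> are both
      within e/2 of the total.\<close>
    then show "sum f B < e"
      using A(2)[of A] A(2)[of "A \<union> B"] A(1) B(1) by (auto simp: dist_real_def abs_if split: if_splits)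
  qed
qed

text \<open>Windows are taken symmetric because \<open>fourier_sum\<close> uses symmetric partial
  sums; \<open>N\<close> is the largest absolute value in the finite exceptional set.\<close>

lemma ell2_small_tail:
  fixes f :: "int \<Rightarrow> 'b::real_normed_vector"
  assumes "f \<in> ell2 UNIV" "e > 0"
  obtains N :: nat where "\<And>B. finite B \<Longrightarrow> B \<inter> {- int N..int N} = {} \<Longrightarrow> (\<Sum>k\<in>B. (norm (f k))\<^sup>2) < e"
proof -
  have "(\<lambda>k. (norm (f k))\<^sup>2) summable_on UNIV" using assms by (simp add: ell2_def)
  then obtain A where A: "finite A" "\<And>B. finite B \<Longrightarrow> A \<inter> B = {} \<Longrightarrow> (\<Sum>k\<in>B. (norm (f k))\<^sup>2) < e"
    using summable_on_small_tail[OF _ assms(2)] by blast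
  define N where "N = Max (insert 0 ((\<lambda>k. nat \<bar>k\<bar>) ` A))"
  have "A \<subseteq> {- int N..int N}"
  proof
    fix k assume "k \<in> A"
    then have "nat \<bar>k\<bar> \<le> N" unfolding N_def using A(1) by (intro Max_ge) auto
    then show "k \<in> {- int N..int N}" by auto
  qed
  then show thesis using A(2) by (intro that[of N]) blast
qed

text \<open>A single index outside a large window is a tail. These limits dispose of the boundary
  terms in \<open>fourier_sum_shift\<close>.\<close>

lemma ell2_tendsto_0:
  fixes f :: "int \<Rightarrow> 'b::real_normed_vector"
  assumes "f \<in> ell2 UNIV"
  shows "(\<lambda>N. (norm (f (int N)))\<^sup>2) \<longlonglongrightarrow> 0" "(\<lambda>N. (norm (f (- int N)))\<^sup>2) \<longlonglongrightarrow> 0"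
proof -
  have *: "\<exists>no. \<forall>n\<ge>no. (norm (f (int n)))\<^sup>2 < r \<and> (norm (f (- int n)))\<^sup>2 < r" if r: "r > 0" for r
  proof -
    obtain N where N: "\<And>B. finite B \<Longrightarrow> B \<inter> {- int N..int N} = {} \<Longrightarrow> (\<Sum>k\<in>B. (norm (f k))\<^sup>2) < r"
      using ell2_small_tail[OF assms r] by blast
    show ?thesis
      using N[of "{int n}" for n] N[of "{- int n}" for n] by (intro exI[of _ "Suc N"]) auto
  qed
  show "(\<lambda>N. (norm (f (int N)))\<^sup>2) \<longlonglongrightarrow> 0" "(\<lambda>N. (norm (f (- int N)))\<^sup>2) \<longlonglongrightarrow> 0"
    by (rule LIMSEQ_I; use * in fastforce)+
qed

text \<open>A Fourier sum is determined only up to a null set. Measurability of \<open>G\<close> is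
  a separate premise since \<open>circ\<close> is built from the Borel measure
  \<open>lborel\<close>, which is not complete.\<close>

lemma fourier_sum_AE_cong:
  assumes "fourier_sum f F" "(\<lambda>\<theta>. G (cis \<theta>)) \<in> borel_measurable circ" "AE \<theta> in circ. F (cis \<theta>) = G (cis \<theta>)"
  shows "fourier_sum f G"
proof -
  have [measurable]: "(\<lambda>\<theta>. F (cis \<theta>)) \<in> borel_measurable circ" "(\<lambda>\<theta>. G (cis \<theta>)) \<in> borel_measurable circ"
    using assms by (auto simp: fourier_sum_iff square_integrable_def)
  have "integrable circ (\<lambda>\<theta>. (norm (F (cis \<theta>)))\<^sup>2) \<longleftrightarrow> integrable circ (\<lambda>\<theta>. (norm (G (cis \<theta>)))\<^sup>2)"
    using assms(3) by (intro integrable_cong_AE) auto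
  moreover have "(\<integral>\<theta>. (norm (F (cis \<theta>) - trig_sum {- int N..int N} f \<theta>))\<^sup>2 \<partial>circ)
     = (\<integral>\<theta>. (norm (G (cis \<theta>) - trig_sum {- int N..int N} f \<theta>))\<^sup>2 \<partial>circ)" for N
    using assms(3) by (intro integral_cong_AE) auto
  ultimately show ?thesis
    using assms by (simp add: fourier_sum_iff square_integrable_def)
qed

lemma fourier_sum_AE_unique:
  assumes "fourier_sum f F" "fourier_sum f G"
  shows "AE \<theta> in circ. F (cis \<theta>) = G (cis \<theta>)"
  using assms unfolding fourier_sum_iff
  by (intro L2_limit_AE_unique[where s = "\<lambda>N. trig_sum {- int N..int N} f"]) (auto intro: trig_sum_parseval)

lemma trig_sum_diff: "trig_sum A f \<theta> - trig_sum A g \<theta> = trig_sum A (\<lambda>k. f k - g k) \<theta>"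
  by (simp add: trig_sum_def sum_subtractf vector_sub_rdistrib vec_eq_iff algebra_simps)

text \<open>By Parseval a single coefficient of \<open>f - g\<close> is controlled by the L2 norm of
  the difference of the partial sums, and both partial sums approach the same
  \<open>F\<close>.\<close>

lemma fourier_sum_coeff_unique:
  assumes f: "fourier_sum f F" and g: "fourier_sum g F"
  shows "f = g"
proof (rule ext)
  fix j
  let ?S = "\<lambda>N. {- int N..int N}"
  have le: "2 * pi * (norm (f j - g j))\<^sup>2
     \<le> 2 * (\<integral>\<theta>. (norm (F (cis \<theta>) - trig_sum (?S N) f \<theta>))\<^sup>2 \<partial>circ)
       + 2 * (\<integral>\<theta>. (norm (F (cis \<theta>) - trig_sum (?S N) g \<theta>))\<^sup>2 \<partial>circ)" if "N \<ge> nat \<bar>j\<bar>" for N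
  proof -
    have F: "square_integrable circ (\<lambda>\<theta>. F (cis \<theta>))" using f by (simp add: fourier_sum_iff)
    have sq: "square_integrable circ (\<lambda>\<theta>. F (cis \<theta>) - trig_sum (?S N) h \<theta>)" for h
      by (rule square_integrable_diff(1)[OF F trig_sum_parseval(1)]) simp
    have "2 * pi * (norm (f j - g j))\<^sup>2 \<le> 2 * pi * (\<Sum>k\<in>?S N. (norm (f k - g k))\<^sup>2)"
      using that by (intro mult_left_mono member_le_sum) auto
    also have "\<dots> = (\<integral>\<theta>. (norm (trig_sum (?S N) (\<lambda>k. f k - g k) \<theta>))\<^sup>2 \<partial>circ)"
      by (simp add: trig_sum_parseval(2))
    also have "\<dots> = (\<integral>\<theta>. (norm ((F (cis \<theta>) - trig_sum (?S N) g \<theta>) - (F (cis \<theta>) - trig_sum (?S N) f \<theta>)))\<^sup>2 \<partial>circ)"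
      by (simp flip: trig_sum_diff)
    also have "\<dots> \<le> 2 * (\<integral>\<theta>. (norm (F (cis \<theta>) - trig_sum (?S N) g \<theta>))\<^sup>2 \<partial>circ)
        + 2 * (\<integral>\<theta>. (norm (F (cis \<theta>) - trig_sum (?S N) f \<theta>))\<^sup>2 \<partial>circ)"
      by (rule square_integrable_diff(2)[OF sq sq])
    finally show ?thesis by simp
  qed
  have "(\<lambda>N. 2 * (\<integral>\<theta>. (norm (F (cis \<theta>) - trig_sum (?S N) f \<theta>))\<^sup>2 \<partial>circ)
       + 2 * (\<integral>\<theta>. (norm (F (cis \<theta>) - trig_sum (?S N) g \<theta>))\<^sup>2 \<partial>circ)) \<longlonglongrightarrow> 2 * 0 + 2 * 0"
    using f g by (intro tendsto_intros) (auto simp: fourier_sum_iff)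
  then have "2 * pi * (norm (f j - g j))\<^sup>2 \<le> 2 * 0 + 2 * 0"
    by (rule LIMSEQ_le_const) (use le in blast)
  then show "f j = g j"
    using pi_gt_zero by (simp add: mult_le_0_iff)
qed

section \<open>Operations on Fourier sums: addition, matrices, shifts\<close>

lemma fourier_sum_add:
  assumes "fourier_sum f F" "fourier_sum g G"
  shows "fourier_sum (\<lambda>k. f k + g k) (\<lambda>z. F z + G z)"
proof -
  let ?S = "\<lambda>N. {- int N..int N}"
  have F: "square_integrable circ (\<lambda>\<theta>. F (cis \<theta>))" and G: "square_integrable circ (\<lambda>\<theta>. G (cis \<theta>))"
    using assms by (auto simp: fourier_sum_iff)
  have t: "trig_sum A (\<lambda>k. f k + g k) \<theta> = trig_sum A f \<theta> + trig_sum A g \<theta>" for A \<theta>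
    by (simp add: trig_sum_def sum.distrib vector_add_ldistrib)
  have "(\<lambda>N. \<integral>\<theta>. (norm (F (cis \<theta>) + G (cis \<theta>) - trig_sum (?S N) (\<lambda>k. f k + g k) \<theta>))\<^sup>2 \<partial>circ) \<longlonglongrightarrow> 0"
  proof (rule tendsto_sandwich[OF _ _ tendsto_const])
    show "(\<lambda>N. 2 * (\<integral>\<theta>. (norm (F (cis \<theta>) - trig_sum (?S N) f \<theta>))\<^sup>2 \<partial>circ)
       + 2 * (\<integral>\<theta>. (norm (G (cis \<theta>) - trig_sum (?S N) g \<theta>))\<^sup>2 \<partial>circ)) \<longlonglongrightarrow> 0"
      using assms by (intro tendsto_add_zero tendsto_mult_right_zero) (auto simp: fourier_sum_iff)
    show "\<forall>\<^sub>F N in sequentially. (\<integral>\<theta>. (norm (F (cis \<theta>) + G (cis \<theta>) - trig_sum (?S N) (\<lambda>k. f k + g k) \<theta>))\<^sup>2 \<partial>circ)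
       \<le> 2 * (\<integral>\<theta>. (norm (F (cis \<theta>) - trig_sum (?S N) f \<theta>))\<^sup>2 \<partial>circ)
       + 2 * (\<integral>\<theta>. (norm (G (cis \<theta>) - trig_sum (?S N) g \<theta>))\<^sup>2 \<partial>circ)"
    proof (rule always_eventually, rule allI)
      fix N
      have sq: "square_integrable circ (\<lambda>\<theta>. F (cis \<theta>) - trig_sum (?S N) f \<theta>)"
        "square_integrable circ (\<lambda>\<theta>. G (cis \<theta>) - trig_sum (?S N) g \<theta>)"
        by (rule square_integrable_diff(1)[OF F trig_sum_parseval(1)], simp)
          (rule square_integrable_diff(1)[OF G trig_sum_parseval(1)], simp)
      show "(\<integral>\<theta>. (norm (F (cis \<theta>) + G (cis \<theta>) - trig_sum (?S N) (\<lambda>k. f k + g k) \<theta>))\<^sup>2 \<partial>circ)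
       \<le> 2 * (\<integral>\<theta>. (norm (F (cis \<theta>) - trig_sum (?S N) f \<theta>))\<^sup>2 \<partial>circ)
       + 2 * (\<integral>\<theta>. (norm (G (cis \<theta>) - trig_sum (?S N) g \<theta>))\<^sup>2 \<partial>circ)"
        using square_integrable_add(2)[OF sq] by (simp add: t algebra_simps)
    qed
  qed simp
  then show ?thesis
    using square_integrable_add(1)[OF F G] by (simp add: fourier_sum_iff)
qed

lemma fourier_sum_matrix:
  fixes A :: "complex ^ 'm ^ 'p"
  assumes "fourier_sum f F"
  shows "fourier_sum (\<lambda>k. A *v f k) (\<lambda>z. A *v F z)"
proof -
  let ?S = "\<lambda>N. {- int N..int N}"
  have bl: "bounded_linear ((*v) A)" by simp
  have le: "norm (A *v x) \<le> onorm ((*v) A) * norm x" for x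
    by (rule onorm[OF bl])
  have F: "square_integrable circ (\<lambda>\<theta>. F (cis \<theta>))"
    using assms by (auto simp: fourier_sum_iff)
  then have [measurable]: "(\<lambda>\<theta>. F (cis \<theta>)) \<in> borel_measurable circ" by (simp add: square_integrable_def)
  have meas: "(\<lambda>\<theta>. A *v h \<theta>) \<in> borel_measurable circ" if "h \<in> borel_measurable circ" for h
    using that borel_measurable_continuous_onI[OF linear_continuous_on[OF bl]]
    by (rule measurable_compose)
  have t: "A *v trig_sum B f \<theta> = trig_sum B (\<lambda>k. A *v f k) \<theta>" for B \<theta>
    by (simp add: trig_sum_def vec.linear_sum[OF matrix_vector_mul_linear_gen]
        vec.linear_scale[OF matrix_vector_mul_linear_gen])
  have "(\<lambda>N. \<integral>\<theta>. (norm (A *v F (cis \<theta>) - trig_sum (?S N) (\<lambda>k. A *v f k) \<theta>))\<^sup>2 \<partial>circ) \<longlonglongrightarrow> 0"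
  proof (rule tendsto_sandwich[OF _ _ tendsto_const])
    show "(\<lambda>N. (onorm ((*v) A))\<^sup>2 * (\<integral>\<theta>. (norm (F (cis \<theta>) - trig_sum (?S N) f \<theta>))\<^sup>2 \<partial>circ)) \<longlonglongrightarrow> 0"
      using assms by (intro tendsto_mult_right_zero) (auto simp: fourier_sum_iff)
    show "\<forall>\<^sub>F N in sequentially. (\<integral>\<theta>. (norm (A *v F (cis \<theta>) - trig_sum (?S N) (\<lambda>k. A *v f k) \<theta>))\<^sup>2 \<partial>circ)
       \<le> (onorm ((*v) A))\<^sup>2 * (\<integral>\<theta>. (norm (F (cis \<theta>) - trig_sum (?S N) f \<theta>))\<^sup>2 \<partial>circ)"
    proof (rule always_eventually, rule allI)
      fix N
      have sq: "square_integrable circ (\<lambda>\<theta>. F (cis \<theta>) - trig_sum (?S N) f \<theta>)"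
        by (rule square_integrable_diff(1)[OF F trig_sum_parseval(1)], simp)
      show "(\<integral>\<theta>. (norm (A *v F (cis \<theta>) - trig_sum (?S N) (\<lambda>k. A *v f k) \<theta>))\<^sup>2 \<partial>circ)
       \<le> (onorm ((*v) A))\<^sup>2 * (\<integral>\<theta>. (norm (F (cis \<theta>) - trig_sum (?S N) f \<theta>))\<^sup>2 \<partial>circ)"
        unfolding t[symmetric] matrix_vector_mult_diff_distrib[symmetric]
        by (rule square_integrable_bound(2)[OF sq meas le]) simp
    qed
  qed simp
  then show ?thesis
    using square_integrable_bound(1)[OF F meas le] by (simp add: fourier_sum_iff)
qed

lemma norm_cis_scale: "norm (cis t *s x) = norm (x :: complex ^ 'm)"
  by (simp add: norm_vec_def norm_mult)

text \<open>Multiplication by \<open>z\<close> also moves the window of the partial sums. The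
  symmetric partial sums of the shifted sequence differ from the multiplied ones by one monomial at
  each end, with coefficients tending to 0; this is where square-summability of \<open>f\<close>
  enters.\<close>

lemma fourier_sum_shift:
  fixes f :: "int \<Rightarrow> complex ^ 'm"
  assumes f: "f \<in> ell2 UNIV" and "fourier_sum f F"
  shows "fourier_sum (\<lambda>k. f (k - 1)) (\<lambda>z. z *s F z)"
    and "fourier_sum (\<lambda>k. f (k + 1)) (\<lambda>z. inverse z *s F z)"
proof -
  let ?S = "\<lambda>N. {- int N..int N}"
  have F: "square_integrable circ (\<lambda>\<theta>. F (cis \<theta>))"
    using assms by (auto simp: fourier_sum_iff)
  then have [measurable]: "(\<lambda>\<theta>. F (cis \<theta>)) \<in> borel_measurable circ" by (simp add: square_integrable_def)
  have main: "fourier_sum (\<lambda>k. f (k - c)) G"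
    if G: "\<And>\<theta>. G (cis \<theta>) = cis (of_int c * \<theta>) *s F (cis \<theta>)" and c: "c = 1 \<or> c = -1" for G c
  proof -
    \<comment> \<open>\<open>a N\<close> is the coefficient that the shifted window loses at one end
      and \<open>b N\<close> the one it gains at the other; hence the exponents
      \<open>c * (N + 1)\<close> and \<open>- c * N\<close> in \<open>t\<close>.\<close>
    define a where "a N = (if c = 1 then f (int N) else f (- int N))" for N
    define b where "b N = (if c = 1 then f (- int (Suc N)) else f (int (Suc N)))" for N
    have a: "(\<lambda>N. (norm (a N))\<^sup>2) \<longlonglongrightarrow> 0"
      unfolding a_def using ell2_tendsto_0[OF f] by (cases "c = 1") simp_all
    have b: "(\<lambda>N. (norm (b N))\<^sup>2) \<longlonglongrightarrow> 0"
      unfolding b_def using ell2_tendsto_0[OF f, THEN LIMSEQ_Suc] by (cases "c = 1") simp_all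
    have meas: "(\<lambda>\<theta>. G (cis \<theta>)) \<in> borel_measurable circ"
    proof -
      have [measurable]: "(\<lambda>\<theta>. cis (of_int c * \<theta>)) \<in> borel_measurable circ"
        by (intro continuous_imp_measurable_circ continuous_intros)
      have "continuous_on UNIV (\<lambda>(u::complex, x::complex ^ 'm). u *s x)"
        unfolding vector_scalar_mult_def split_beta by (intro continuous_intros)
      then have "(\<lambda>(u::complex, x::complex ^ 'm). u *s x) \<in> borel_measurable borel"
        by (rule borel_measurable_continuous_onI)
      then have "(\<lambda>\<theta>. (\<lambda>(u::complex, x::complex ^ 'm). u *s x) (cis (of_int c * \<theta>), F (cis \<theta>))) \<in> borel_measurable circ"
        by (rule measurable_compose[rotated]) simp
      then show ?thesis unfolding G by simp
    qed
    have t: "trig_sum (?S N) (\<lambda>k. f (k - c)) \<theta> = cis (of_int c * \<theta>) *s trig_sum (?S N) f \<theta>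
        + trig_sum {- c * int N} (\<lambda>_. b N) \<theta> - trig_sum {c * int (Suc N)} (\<lambda>_. a N) \<theta>" for N \<theta>
    proof -
      have "trig_sum (?S N) (\<lambda>k. f (k - c)) \<theta> = (\<Sum>k\<in>{- int N - c..int N - c}. cis (of_int (k + c) * \<theta>) *s f k)"
        unfolding trig_sum_def
        by (rule sum.reindex_bij_witness[of _ "\<lambda>k. k + c" "\<lambda>k. k - c"]) auto
      also have "\<dots> + cis (of_int (c * int (Suc N)) * \<theta>) *s a N
          = (\<Sum>k\<in>?S N. cis (of_int (k + c) * \<theta>) *s f k) + cis (of_int (- c * int N) * \<theta>) *s b N"
        using c
      proof
        assume c: "c = 1"
        have "{- int N - 1..int N} = insert (int N) {- int N - 1..int N - 1}"
          "{- int N - 1..int N} = insert (- int N - 1) {- int N..int N}" by auto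
        then have "(\<Sum>k\<in>{- int N - 1..int N - 1}. cis (of_int (k + 1) * \<theta>) *s f k) + cis (of_int (int N + 1) * \<theta>) *s f (int N)
           = (\<Sum>k\<in>?S N. cis (of_int (k + 1) * \<theta>) *s f k) + cis (of_int (- int N - 1 + 1) * \<theta>) *s f (- int N - 1)"
          by (metis (no_types, lifting) add.commute atLeastAtMost_iff diff_add_cancel finite_atLeastAtMost_int
              less_irrefl linorder_not_less sum.insert zle_diff1_eq)
        moreover have e: "- int N - 1 = - 1 - int N" by simp
        ultimately show ?thesis by (simp add: c a_def b_def add.commute e)
      next
        assume c: "c = - 1"
        have "{- int N..int N + 1} = insert (- int N) {- int N + 1..int N + 1}"
          "{- int N..int N + 1} = insert (int N + 1) {- int N..int N}" by auto
        then have "(\<Sum>k\<in>{- int N + 1..int N + 1}. cis (of_int (k - 1) * \<theta>) *s f k) + cis (of_int (- int N - 1) * \<theta>) *s f (- int N)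
           = (\<Sum>k\<in>?S N. cis (of_int (k - 1) * \<theta>) *s f k) + cis (of_int (int N + 1 - 1) * \<theta>) *s f (int N + 1)"
          by (smt (verit) add.commute atLeastAtMost_iff finite_atLeastAtMost_int sum.insert)
        moreover have e: "- real N - 1 = - 1 - real N" by simp
        ultimately show ?thesis by (simp add: c a_def b_def add.commute e)
      qed
      finally have "trig_sum (?S N) (\<lambda>k. f (k - c)) \<theta> + cis (of_int (c * int (Suc N)) * \<theta>) *s a N
          = (\<Sum>k\<in>?S N. cis (of_int (k + c) * \<theta>) *s f k) + cis (of_int (- c * int N) * \<theta>) *s b N" .
      moreover have "(\<Sum>k\<in>?S N. cis (of_int (k + c) * \<theta>) *s f k) = cis (of_int c * \<theta>) *s trig_sum (?S N) f \<theta>"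
      proof -
        have "cis (of_int (k + c) * \<theta>) *s f k = cis (of_int c * \<theta>) *s (cis (of_int k * \<theta>) *s f k)" for k
          by (simp add: cis_mult algebra_simps)
        then show ?thesis by (simp only: trig_sum_def vec.scale_sum_right)
      qed
      ultimately show ?thesis by (simp add: trig_sum_def algebra_simps)
    qed
    have "(\<lambda>N. \<integral>\<theta>. (norm (G (cis \<theta>) - trig_sum (?S N) (\<lambda>k. f (k - c)) \<theta>))\<^sup>2 \<partial>circ) \<longlonglongrightarrow> 0"
    proof (rule tendsto_sandwich[OF _ _ tendsto_const])
      show "(\<lambda>N. 2 * (\<integral>\<theta>. (norm (F (cis \<theta>) - trig_sum (?S N) f \<theta>))\<^sup>2 \<partial>circ)
          + 2 * (2 * (2 * pi * (norm (a N))\<^sup>2) + 2 * (2 * pi * (norm (b N))\<^sup>2))) \<longlonglongrightarrow> 0"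
        using assms by (intro tendsto_add_zero tendsto_mult_right_zero a b) (auto simp: fourier_sum_iff)
      show "\<forall>\<^sub>F N in sequentially. (\<integral>\<theta>. (norm (G (cis \<theta>) - trig_sum (?S N) (\<lambda>k. f (k - c)) \<theta>))\<^sup>2 \<partial>circ)
         \<le> 2 * (\<integral>\<theta>. (norm (F (cis \<theta>) - trig_sum (?S N) f \<theta>))\<^sup>2 \<partial>circ)
          + 2 * (2 * (2 * pi * (norm (a N))\<^sup>2) + 2 * (2 * pi * (norm (b N))\<^sup>2))"
      proof (rule always_eventually, rule allI)
        fix N
        let ?R = "\<lambda>\<theta>. trig_sum {c * int (Suc N)} (\<lambda>_. a N) \<theta> - trig_sum {- c * int N} (\<lambda>_. b N) \<theta>"
        have sq0: "square_integrable circ (\<lambda>\<theta>. F (cis \<theta>) - trig_sum (?S N) f \<theta>)"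
          by (rule square_integrable_diff(1)[OF F trig_sum_parseval(1)], simp)
        have e: "G (cis \<theta>) - cis (of_int c * \<theta>) *s trig_sum (?S N) f \<theta>
            = cis (of_int c * \<theta>) *s (F (cis \<theta>) - trig_sum (?S N) f \<theta>)" for \<theta>
          by (simp add: G vec.scale_right_diff_distrib)
        have m: "(\<lambda>\<theta>. G (cis \<theta>) - cis (of_int c * \<theta>) *s trig_sum (?S N) f \<theta>) \<in> borel_measurable circ"
          using meas
          by (intro borel_measurable_diff)
            (auto simp: trig_sum_def vector_scalar_mult_def intro!: continuous_imp_measurable_circ continuous_intros)
        have n: "norm (G (cis \<theta>) - cis (of_int c * \<theta>) *s trig_sum (?S N) f \<theta>)
            \<le> 1 * norm (F (cis \<theta>) - trig_sum (?S N) f \<theta>)" for \<theta>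
          unfolding e norm_cis_scale by simp
        have sq: "square_integrable circ (\<lambda>\<theta>. G (cis \<theta>) - cis (of_int c * \<theta>) *s trig_sum (?S N) f \<theta>)"
          "(\<integral>\<theta>. (norm (G (cis \<theta>) - cis (of_int c * \<theta>) *s trig_sum (?S N) f \<theta>))\<^sup>2 \<partial>circ)
            \<le> (\<integral>\<theta>. (norm (F (cis \<theta>) - trig_sum (?S N) f \<theta>))\<^sup>2 \<partial>circ)"
          using square_integrable_bound[OF sq0 m n] by simp_all
        have r: "square_integrable circ ?R"
          "(\<integral>\<theta>. (norm (?R \<theta>))\<^sup>2 \<partial>circ) \<le> 2 * (2 * pi * (norm (a N))\<^sup>2) + 2 * (2 * pi * (norm (b N))\<^sup>2)"
          using square_integrable_diff[OF trig_sum_parseval(1) trig_sum_parseval(1),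
              of "{c * int (Suc N)}" "{- c * int N}" "\<lambda>_. a N" "\<lambda>_. b N"]
          by (simp_all add: trig_sum_parseval(2))
        have d: "G (cis \<theta>) - trig_sum (?S N) (\<lambda>k. f (k - c)) \<theta>
            = (G (cis \<theta>) - cis (of_int c * \<theta>) *s trig_sum (?S N) f \<theta>) + ?R \<theta>" for \<theta>
          unfolding t by simp
        show "(\<integral>\<theta>. (norm (G (cis \<theta>) - trig_sum (?S N) (\<lambda>k. f (k - c)) \<theta>))\<^sup>2 \<partial>circ)
         \<le> 2 * (\<integral>\<theta>. (norm (F (cis \<theta>) - trig_sum (?S N) f \<theta>))\<^sup>2 \<partial>circ)
          + 2 * (2 * (2 * pi * (norm (a N))\<^sup>2) + 2 * (2 * pi * (norm (b N))\<^sup>2))"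
          unfolding d
          by (rule order_trans[OF square_integrable_add(2)[OF sq(1) r(1)]])
            (intro add_mono mult_left_mono sq(2) r(2); simp)
      qed
    qed simp
    moreover have "square_integrable circ (\<lambda>\<theta>. G (cis \<theta>))"
      by (rule square_integrable_bound(1)[OF F meas, of 1]) (simp add: G norm_cis_scale)
    ultimately show ?thesis by (simp add: fourier_sum_iff)
  qed
  show "fourier_sum (\<lambda>k. f (k - 1)) (\<lambda>z. z *s F z)"
    by (rule main) auto
  have "fourier_sum (\<lambda>k. f (k - (- 1))) (\<lambda>z. inverse z *s F z)"
    by (rule main) auto
  then show "fourier_sum (\<lambda>k. f (k + 1)) (\<lambda>z. inverse z *s F z)" by simp
qed

text \<open>Parseval turns small tails of \<open>f\<close> into the Cauchy property of the partial
  sums, to which \<open>riesz_fischer\<close> applies.\<close>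

lemma fourier_sum_exists:
  fixes f :: "int \<Rightarrow> complex ^ 'm"
  assumes f: "f \<in> ell2 UNIV"
  shows "\<exists>F. fourier_sum f F"
proof -
  let ?S = "\<lambda>N. {- int N..int N}"
  have "\<exists>N. \<forall>i\<ge>N. \<forall>j\<ge>N. (\<integral>\<theta>. (norm (trig_sum (?S i) f \<theta> - trig_sum (?S j) f \<theta>))\<^sup>2 \<partial>circ) < e"
    if e: "e > 0" for e
  proof -
    have e': "e / (2 * pi) > 0" using e by simp
    obtain N where N: "\<And>B. finite B \<Longrightarrow> B \<inter> ?S N = {} \<Longrightarrow> (\<Sum>k\<in>B. (norm (f k))\<^sup>2) < e / (2 * pi)"
      using ell2_small_tail[OF f e'] by blast
    have le: "(\<integral>\<theta>. (norm (trig_sum (?S i) f \<theta> - trig_sum (?S j) f \<theta>))\<^sup>2 \<partial>circ) < e" if "j \<ge> N" "i \<ge> j" for i j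
    proof -
      have "trig_sum (?S i) f \<theta> - trig_sum (?S j) f \<theta> = trig_sum (?S i - ?S j) f \<theta>" for \<theta>
        unfolding trig_sum_def using that by (subst sum_diff) auto
      then have "(\<integral>\<theta>. (norm (trig_sum (?S i) f \<theta> - trig_sum (?S j) f \<theta>))\<^sup>2 \<partial>circ)
          = 2 * pi * (\<Sum>k\<in>?S i - ?S j. (norm (f k))\<^sup>2)"
        by (simp add: trig_sum_parseval(2))
      also have "\<dots> < 2 * pi * (e / (2 * pi))"
        using that by (intro mult_strict_left_mono N) auto
      finally show ?thesis by simp
    qed
    have "(\<integral>\<theta>. (norm (trig_sum (?S i) f \<theta> - trig_sum (?S j) f \<theta>))\<^sup>2 \<partial>circ) < e" if "j \<ge> N" "i \<ge> N" for i j
      using le[of j i] le[of i j] that by (cases "i \<le> j") (auto simp: norm_minus_commute)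
    then show ?thesis by blast
  qed
  then obtain G where G: "square_integrable circ G"
      "(\<lambda>N. \<integral>\<theta>. (norm (G \<theta> - trig_sum (?S N) f \<theta>))\<^sup>2 \<partial>circ) \<longlonglongrightarrow> 0"
    using riesz_fischer[OF finite_measure_circ, of "\<lambda>N. trig_sum (?S N) f"] trig_sum_parseval(1) by blast
  \<comment> \<open>The limit \<open>G\<close> is a function of the angle and must become a function
    on the circle. \<open>Arg2pi\<close> has values in [0, 2 pi), so angle 2 pi receives the value
    \<open>G 0\<close>; this single angle is null.\<close>
  define F where "F z = G (Arg2pi z)" for z
  have Arg: "Arg2pi (cis \<theta>) = \<theta>" if "0 \<le> \<theta>" "\<theta> < 2 * pi" for \<theta>
    using that Arg2pi_unique[of 1 \<theta> "cis \<theta>"] by (simp add: cis_conv_exp)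
  have F: "F (cis \<theta>) = (if \<theta> = 2 * pi then G 0 else G \<theta>)" if "\<theta> \<in> space circ" for \<theta>
    using that Arg[of \<theta>] Arg[of 0] by (auto simp: F_def circ_def space_restrict_space)
  have [measurable]: "G \<in> borel_measurable circ" using G by (simp add: square_integrable_def)
  have [measurable]: "{2*pi} \<in> sets circ"
    by (auto simp: circ_def sets_restrict_space_iff)
  have meas [measurable]: "(\<lambda>\<theta>. F (cis \<theta>)) \<in> borel_measurable circ"
  proof (subst measurable_cong[OF F])
    have "(\<lambda>\<theta>. if \<theta> \<in> {2 * pi} then G 0 else G \<theta>) \<in> borel_measurable circ"
      by (rule measurable_If_set) auto
    then show "(\<lambda>\<theta>. if \<theta> = 2 * pi then G 0 else G \<theta>) \<in> borel_measurable circ" by simp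
  qed
  have ae: "AE \<theta> in circ. F (cis \<theta>) = G \<theta>"
  proof -
    have "AE \<theta> in lborel. \<theta> \<in> {0..2*pi} \<longrightarrow> \<theta> \<noteq> 2 * pi"
      using AE_lborel_singleton[of "2 * pi"] by eventually_elim simp
    then have "AE \<theta> in circ. \<theta> \<noteq> 2 * pi"
      unfolding circ_def by (subst AE_restrict_space_iff) auto
    with AE_space show ?thesis
      by eventually_elim (simp add: F)
  qed
  have "integrable circ (\<lambda>\<theta>. (norm (F (cis \<theta>)))\<^sup>2) \<longleftrightarrow> integrable circ (\<lambda>\<theta>. (norm (G \<theta>))\<^sup>2)"
    using ae by (intro integrable_cong_AE) auto
  moreover have "(\<integral>\<theta>. (norm (F (cis \<theta>) - trig_sum (?S N) f \<theta>))\<^sup>2 \<partial>circ)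
     = (\<integral>\<theta>. (norm (G \<theta> - trig_sum (?S N) f \<theta>))\<^sup>2 \<partial>circ)" for N
    using ae by (intro integral_cong_AE) auto
  ultimately have "fourier_sum f F"
    using G by (simp add: fourier_sum_iff square_integrable_def)
  then show ?thesis by blast
qed


section \<open>Positivity of face operators\<close>

lemma to_complex_0 [simp]: "to_complex 0 = 0"
  by (metis norm_eq_zero norm_to_complex norm_zero)

lemma to_complex_minus: "to_complex (- x) = - to_complex x"
  using to_complex_scaleR[of "-1" x] by simp

lemma to_complex_diff: "to_complex (x - y) = to_complex x - to_complex y"
  using to_complex_add[of x "- y"] by (simp add: to_complex_minus)

lemma to_complex_sum: "to_complex (sum f A) = (\<Sum>x\<in>A. to_complex (f x))"
  by (induction A rule: infinite_finite_induct) (simp_all add: to_complex_add)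

lemma to_complex_eq_iff [simp]: "to_complex x = to_complex y \<longleftrightarrow> x = y"
proof
  assume "to_complex x = to_complex y"
  then have "norm (to_complex (x - y)) = 0" by (simp add: to_complex_diff)
  then show "x = y" by (simp add: norm_to_complex)
qed simp

lemma bounded_linear_to_complex: "bounded_linear (to_complex :: 'a::real_or_complex \<Rightarrow> complex)"
  by (rule bounded_linear_intro[where K = 1])
    (simp_all add: to_complex_add to_complex_scaleR norm_to_complex)

text \<open>The isometric embedding supplies a subsequence whose image converges; it is Cauchy in
  the field, which is complete. The instance makes the unit sphere in \<open>face_coercive\<close>
  compact.\<close>

instance real_or_complex < heine_borel
proof
  fix f :: "nat \<Rightarrow> 'a"
  assume "bounded (range f)"
  then obtain B where B: "\<And>n. norm (f n) \<le> B"
    by (auto simp: bounded_iff)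
  have "bounded (range (\<lambda>n. to_complex (f n)))"
    unfolding bounded_iff by (rule exI[of _ B]) (use B in \<open>auto simp: norm_to_complex\<close>)
  then obtain l r where r: "strict_mono r" "((\<lambda>n. to_complex (f n)) \<circ> r) \<longlonglongrightarrow> l"
    using bounded_imp_convergent_subsequence[of "\<lambda>n. to_complex (f n)"] by blast
  then have "Cauchy ((\<lambda>n. to_complex (f n)) \<circ> r)"
    by (intro convergent_Cauchy) (auto simp: convergent_def)
  moreover have "dist (to_complex x) (to_complex y) = dist x y" for x y :: 'a
    by (simp add: dist_norm norm_to_complex flip: to_complex_diff)
  ultimately have "Cauchy (f \<circ> r)"
    by (simp add: Cauchy_def)
  then show "\<exists>l r. strict_mono r \<and> (f \<circ> r) \<longlonglongrightarrow> l"
    using r(1) by (auto simp: Cauchy_convergent_iff convergent_def)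
qed

lemma cvec_0 [simp]: "cvec 0 = 0"
  by (simp add: cvec_def vec_eq_iff)

lemma cvec_add: "cvec (x + y) = cvec x + cvec y"
  by (simp add: cvec_def vec_eq_iff to_complex_add)

lemma cvec_scaleR: "cvec (r *\<^sub>R x) = r *\<^sub>R cvec x"
  by (simp add: cvec_def vec_eq_iff to_complex_scaleR)

lemma norm_cvec [simp]: "norm (cvec x) = norm x"
  by (simp add: norm_vec_def cvec_def norm_to_complex)

lemma bounded_linear_cvec: "bounded_linear (cvec :: 'a::real_or_complex ^ 'n \<Rightarrow> complex ^ 'n)"
  by (rule bounded_linear_intro[where K = 1]) (simp_all add: cvec_add cvec_scaleR)

lemma cvec_eq_iff [simp]: "cvec x = cvec y \<longleftrightarrow> x = y"
  by (simp add: cvec_def vec_eq_iff)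

lemma cvec_mult: "cvec (A *v x) = cmat A *v cvec x"
  by (simp add: cvec_def cmat_def matrix_vector_mult_def vec_eq_iff to_complex_sum to_complex_mult)

text \<open>Quadratic forms of self-adjoint operators have real values, so the real part carries all
  of the energy. By \<open>rinner_eq\<close> this is the Euclidean inner product of the complexified
  vectors.\<close>

definition rinner :: "'k::real_or_complex ^ 'n \<Rightarrow> 'k ^ 'n \<Rightarrow> real" where
  "rinner x y = Re (to_complex (hinner x y))"

lemma rinner_eq: "rinner x y = cvec x \<bullet> cvec y"
  by (simp add: rinner_def hinner_def to_complex_sum to_complex_mult to_complex_conj inner_vec_def
      cvec_def inner_complex_def)

lemma rinner_add_left: "rinner (x + y) z = rinner x z + rinner y z"
  and rinner_add_right: "rinner z (x + y) = rinner z x + rinner z y"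
  and rinner_self: "rinner x x = (norm x)\<^sup>2"
  and rinner_0 [simp]: "rinner 0 x = 0" "rinner x 0 = 0"
  by (simp_all add: rinner_eq cvec_add inner_add_left inner_add_right flip: power2_norm_eq_inner)

lemma abs_rinner_le: "\<bar>rinner x y\<bar> \<le> norm x * norm y"
  using Cauchy_Schwarz_ineq2[of "cvec x" "cvec y"] by (simp add: rinner_eq)

text \<open>Bounding by the sum of the squares makes inner products of two square-summable sequences
  summable by comparison.\<close>

lemma norm_hinner_le: "norm (hinner x y) \<le> (norm x)\<^sup>2 + (norm y)\<^sup>2"
proof -
  have "norm (hinner x y) \<le> (\<Sum>i\<in>UNIV. norm (x $ i) * norm (y $ i))"
    unfolding hinner_def
    by (rule order_trans[OF norm_sum]) (simp add: norm_mult flip: norm_to_complex[of "conj _"], simp add: to_complex_conj norm_to_complex)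
  also have "\<dots> \<le> (\<Sum>i\<in>UNIV. (norm (x $ i))\<^sup>2 + (norm (y $ i))\<^sup>2)"
  proof (rule sum_mono)
    fix i
    have "norm (x $ i) * norm (y $ i) \<le> 2 * norm (x $ i) * norm (y $ i)" by simp
    also have "\<dots> \<le> (norm (x $ i))\<^sup>2 + (norm (y $ i))\<^sup>2" by (rule sum_squares_bound)
    finally show "norm (x $ i) * norm (y $ i) \<le> (norm (x $ i))\<^sup>2 + (norm (y $ i))\<^sup>2" .
  qed
  also have "\<dots> = (norm x)\<^sup>2 + (norm y)\<^sup>2"
    by (simp add: norm_vec_def L2_set_def sum.distrib sum_nonneg)
  finally show ?thesis .
qed

section \<open>Positivity and coercivity of quadratic forms\<close>

definition face_energy :: "('k::real_or_complex, 'n::finite) face \<Rightarrow> (side \<Rightarrow> 'k ^ 'n) \<Rightarrow> real" where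
  "face_energy Q x = (\<Sum>a\<in>UNIV. rinner (x a) (face_apply Q x a))"

lemma face_energy_pos: "face_operator Q \<Longrightarrow> x a \<noteq> 0 \<Longrightarrow> 0 < face_energy Q x"
  by (auto simp: face_operator_def face_energy_def rinner_def to_complex_sum)

lemma face_energy_scaleR: "face_energy Q (\<lambda>a. r *\<^sub>R x a) = r\<^sup>2 * face_energy Q x"
proof -
  have "face_apply Q (\<lambda>a. r *\<^sub>R x a) = (\<lambda>a. r *\<^sub>R face_apply Q x a)"
    by (simp add: face_apply_def fun_eq_iff matrix_vector_mult_def vec_eq_iff scaleR_sum_right)
  then show ?thesis
    by (simp add: face_energy_def rinner_eq cvec_scaleR sum_distrib_left power2_eq_square mult.assoc)
qed

text \<open>The constant is the minimum of the energy on the compact unit sphere, carried to all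
  vectors by homogeneity. Families indexed by sides are recoded as elements of
  \<open>('k ^ 'n) ^ side\<close> to have a norm.\<close>

lemma face_coercive:
  fixes Q :: "('k::real_or_complex, 'n::finite) face"
  assumes "face_operator Q"
  obtains c where "c > 0" "\<And>x a. c * (norm (x a))\<^sup>2 \<le> face_energy Q x"
proof -
  let ?S = "sphere (0 :: ('k ^ 'n) ^ side) 1"
  let ?e = "\<lambda>y :: ('k ^ 'n) ^ side. face_energy Q (\<lambda>a. y $ a)"
  have mult: "continuous_on S (\<lambda>y. A *v g y)" if "continuous_on S g" for A :: "'k ^ 'n ^ 'n" and g and S :: "(('k ^ 'n) ^ side) set"
    unfolding matrix_vector_mult_def using that by (intro continuous_intros)
  have cont: "continuous_on ?S ?e"
    unfolding face_energy_def rinner_eq face_apply_def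
    by (intro continuous_intros mult bounded_linear.continuous_on[OF bounded_linear_cvec])
  have "compact ?S"
    by (simp add: compact_eq_bounded_closed)
  have "?S \<noteq> {}"
  proof -
    define y where "y = ((\<chi> a i. 1) :: ('k ^ 'n) ^ side)"
    have "y \<noteq> 0" by (simp add: y_def vec_eq_iff)
    then have "(1 / norm y) *\<^sub>R y \<in> ?S" by simp
    then show ?thesis by blast
  qed
  then obtain u where u: "u \<in> ?S" "\<And>y. y \<in> ?S \<Longrightarrow> ?e u \<le> ?e y"
    using continuous_attains_inf[OF \<open>compact ?S\<close> _ cont] by blast
  have "u \<noteq> 0" using u(1) by auto
  then obtain a where "u $ a \<noteq> 0" by (auto simp: vec_eq_iff)
  then have pos: "?e u > 0" by (rule face_energy_pos[OF assms])
  show thesis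
  proof (rule that[OF pos])
    fix x :: "side \<Rightarrow> 'k ^ 'n" and a
    define y where "y = (\<chi> a. x a)"
    have le: "norm (x a) \<le> norm y"
      using Finite_Cartesian_Product.norm_nth_le[of y a] by (simp add: y_def)
    show "?e u * (norm (x a))\<^sup>2 \<le> face_energy Q x"
    proof (cases "y = 0")
      case True
      then have "x = (\<lambda>_. 0)" by (auto simp: y_def vec_eq_iff)
      then show ?thesis by (simp add: face_energy_def)
    next
      case False
      then have "(1 / norm y) *\<^sub>R y \<in> ?S" by simp
      then have "?e u \<le> ?e ((1 / norm y) *\<^sub>R y)" by (rule u(2))
      also have "\<dots> = (1 / norm y)\<^sup>2 * face_energy Q x"
        by (simp add: face_energy_scaleR y_def)
      finally have "?e u * (norm y)\<^sup>2 \<le> face_energy Q x"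
        using False by (simp add: field_simps)
      moreover have "?e u * (norm (x a))\<^sup>2 \<le> ?e u * (norm y)\<^sup>2"
        using le pos by (intro mult_left_mono power_mono) auto
      ultimately show ?thesis by linarith
    qed
  qed
qed

text \<open>\<open>phi_WE\<close> acts on complex vectors even if the face is real. In the real case
  write \<open>V = x + i y\<close>: real and imaginary vectors are orthogonal for the Euclidean
  inner product, so the form at \<open>V\<close> is the sum of the forms at \<open>x\<close> and
  \<open>y\<close>.\<close>

lemma positive_complexified:
  fixes H :: "'k::real_or_complex ^ 'n ^ 'n"
  assumes pos: "\<And>x. x \<noteq> 0 \<Longrightarrow> 0 < rinner x (H *v x)" and "V \<noteq> 0"
  shows "0 < V \<bullet> (cmat H *v V)"
  using range_to_complex[where 'a = 'k]
proof
  assume surj: "range (to_complex :: 'k \<Rightarrow> complex) = UNIV"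
  define x :: "'k ^ 'n" where "x = (\<chi> i. inv to_complex (V $ i))"
  have "V = cvec x"
    using surj_f_inv_f[OF surj] by (simp add: x_def cvec_def vec_eq_iff)
  moreover from this \<open>V \<noteq> 0\<close> have "x \<noteq> 0" by auto
  ultimately show ?thesis using pos[of x] by (simp add: rinner_eq cvec_mult)
next
  assume real: "range (to_complex :: 'k \<Rightarrow> complex) = \<real>"
  define x y :: "'k ^ 'n" where "x = (\<chi> i. of_real (Re (V $ i)))" and "y = (\<chi> i. of_real (Im (V $ i)))"
  have V: "V = cvec x + \<i> *s cvec y"
    by (simp add: x_def y_def cvec_def vec_eq_iff to_complex_of_real complex_eq)
  have im: "Im (to_complex t) = 0" for t :: 'k
    using real rangeI[of to_complex t] by (simp add: complex_is_Real_iff)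
  have r: "cvec u \<bullet> (\<i> *s cvec v) = 0" "(\<i> *s cvec v) \<bullet> cvec u = 0"
    "(\<i> *s cvec v) \<bullet> (\<i> *s cvec u) = rinner v u" for u v :: "'k ^ 'n"
    by (simp_all add: inner_vec_def inner_complex_def cvec_def rinner_eq im)
  have "cmat H *v V = cvec (H *v x) + \<i> *s cvec (H *v y)"
    by (simp add: V matrix_vector_right_distrib cvec_mult vec.linear_scale[OF matrix_vector_mul_linear_gen])
  then have e: "V \<bullet> (cmat H *v V) = rinner x (H *v x) + rinner y (H *v y)"
    by (simp add: V inner_add_left inner_add_right r rinner_eq)
  have "x \<noteq> 0 \<or> y \<noteq> 0" using \<open>V \<noteq> 0\<close> V by auto
  moreover have nonneg: "0 \<le> rinner z (H *v z)" for z
    using pos[of z] by (cases "z = 0") (auto intro: less_imp_le)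
  ultimately show ?thesis
    unfolding e using pos[of x] pos[of y] nonneg[of x] nonneg[of y] by linarith
qed

text \<open>A form without nontrivial zeroes makes the matrix injective, hence invertible on both
  sides in finite dimension, so the choice in \<open>matrix_inv\<close> has a witness.\<close>

lemma invertible_if_positive:
  fixes A :: "complex ^ 'n ^ 'n"
  assumes "\<And>x. x \<noteq> 0 \<Longrightarrow> x \<bullet> (A *v x) \<noteq> 0"
  shows "matrix_inv A *v (A *v x) = x"
proof -
  have "inj ((*v) A)"
    unfolding vec.linear_inj_iff_eq_0[OF matrix_vector_mul_linear_gen]
  proof (intro allI impI)
    fix x assume "A *v x = 0"
    then show "x = 0" using assms[of x] by (cases "x = 0") auto
  qed
  then obtain B where "B ** A = mat 1"
    using matrix_left_invertible_injective by blast
  then have "A ** B = mat 1"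
    by (simp add: matrix_left_right_inverse)
  with \<open>B ** A = mat 1\<close> have "matrix_inv A ** A = mat 1"
    unfolding matrix_inv_def by (metis (mono_tags, lifting) someI_ex)
  then show ?thesis by (simp add: matrix_vector_mul_assoc)
qed


section \<open>Solutions on the infinite strip\<close>

lemma cmat_add: "cmat (A + B) = cmat A + cmat B"
  by (simp add: cmat_def vec_eq_iff to_complex_add)

lemma cmat_diff: "cmat (A - B) = cmat A - cmat B"
  by (simp add: cmat_def vec_eq_iff to_complex_diff)

lemma cmat_block_mat: "cmat (block_mat A B C D) = block_mat (cmat A) (cmat B) (cmat C) (cmat D)"
  by (simp add: cmat_def block_mat_def vec_eq_iff split: sum.split)

lemma cmat_block_col: "cmat (block_col A B) = block_col (cmat A) (cmat B)"
  by (simp add: cmat_def block_col_def vec_eq_iff split: sum.split)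

lemma cmat_block_row: "cmat (block_row A B) = block_row (cmat A) (cmat B)"
  by (simp add: cmat_def block_row_def vec_eq_iff split: sum.split)

lemma matrix_vector_scale: "A *v (c *s x) = c *s (A *v x)" for A :: "'a::field ^ 'n ^ 'm"
  by (simp add: vec.linear_scale[OF matrix_vector_mul_linear_gen])

lemma scale_mat_mult: "(c *m A) *v x = c *s (A *v x)"
  by (simp add: scale_mat_def matrix_vector_mult_def vec_eq_iff sum_distrib_left mult_ac)

text \<open>The block pattern with \<open>T\<close>, \<open>A\<close>, \<open>U\<close> as
  parameters, so that all later statements refer to the same matrices.\<close>

definition dihedral_face :: "('k::real_or_complex, 'n::finite) face \<Rightarrow> 'k ^ 'n ^ 'n \<Rightarrow> 'k ^ 'n ^ 'n \<Rightarrow> 'k ^ 'n ^ 'n \<Rightarrow> bool" where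
  "dihedral_face Q T A U \<longleftrightarrow>
     Q South South = T \<and> Q South North = A \<and> Q South West = U \<and> Q South East = U \<and>
     Q North South = A \<and> Q North North = T \<and> Q North West = U \<and> Q North East = U \<and>
     Q West South = U \<and> Q West North = U \<and> Q West West = T \<and> Q West East = A \<and>
     Q East South = U \<and> Q East North = U \<and> Q East West = A \<and> Q East East = T"

lemma dihedral_face_exists:
  assumes "dihedral_invariant Q"
  obtains T A U where "dihedral_face Q T A U"
  using assms unfolding dihedral_invariant_def dihedral_face_def by blast

lemma face_apply_dihedral:
  assumes "dihedral_face Q T A U"
  shows "face_apply Q x South = T *v x South + A *v x North + U *v (x West + x East)"
    and "face_apply Q x North = A *v x South + T *v x North + U *v (x West + x East)"
    and "face_apply Q x West = U *v (x South + x North) + T *v x West + A *v x East"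
    and "face_apply Q x East = U *v (x South + x North) + A *v x West + T *v x East"
  using assms by (simp_all add: face_apply_def UNIV_side dihedral_face_def matrix_vector_right_distrib add_ac)

lemma face_energy_sides:
  "face_energy Q x = rinner (x South) (face_apply Q x South) + rinner (x North) (face_apply Q x North)
     + rinner (x West) (face_apply Q x West) + rinner (x East) (face_apply Q x East)"
  by (simp add: face_energy_def UNIV_side)

lemma rinner_minus: "rinner (- a) b = - rinner a b" "rinner a (- b) = - rinner a b"
  using rinner_add_left[of a "- a" b] rinner_add_right[of a b "- b"] by auto

lemma rinner_diff_right: "rinner a (b - c) = rinner a b - rinner a c"
  using rinner_add_right[of a "b - c" c] by simp

lemma phi_WE_dihedral:
  "dihedral_face Q T A U \<Longrightarrow> phi_WE Q z *v x
    = cmat T *v x + cmat T *v x + z *s (cmat A *v x) + inverse z *s (cmat A *v x)"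
  unfolding phi_WE_def dihedral_face_def
  by (elim conjE) (simp only: matrix_vector_mult_add_rdistrib scale_mat_mult)

text \<open>On the circle \<open>phi_WE\<close> is
  \<open>(1 + cos t) (T + A) + (1 - cos t) (T - A)\<close>, with nonnegative weights that never
  vanish together. \<open>T + A\<close> and \<open>T - A\<close> are positive because they give half
  the face energy of \<open>(h, h)\<close> and \<open>(h, -h)\<close> on the West and East
  edges.\<close>

lemma phi_WE_positive:
  fixes Q :: "('k::real_or_complex, 'n::finite) face"
  assumes Q: "face_operator Q" and d: "dihedral_face Q T A U" and "V \<noteq> 0"
  shows "0 < V \<bullet> (phi_WE Q (cis t) *v V)"
proof -
  have plus: "0 < rinner h ((T + A) *v h)" if "h \<noteq> 0" for h
    using face_energy_pos[OF Q, of "on_sides 0 0 h h" West] that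
    by (simp add: face_energy_sides face_apply_dihedral[OF d] matrix_vector_mult_add_rdistrib rinner_add_right)
  have minus: "0 < rinner h ((T - A) *v h)" if "h \<noteq> 0" for h
  proof -
    have m: "X *v (- h) = - (X *v h)" for X :: "'k ^ 'n ^ 'n"
      by (simp add: vec.linear_neg[OF matrix_vector_mul_linear_gen])
    show ?thesis
      using face_energy_pos[OF Q, of "on_sides 0 0 h (- h)" West] that
      by (simp add: face_energy_sides face_apply_dihedral[OF d] matrix_vector_mult_diff_rdistrib
          m rinner_minus rinner_diff_right)
  qed
  have p: "0 < V \<bullet> (cmat (T + A) *v V)" and q: "0 < V \<bullet> (cmat (T - A) *v V)"
    using positive_complexified[OF plus \<open>V \<noteq> 0\<close>] positive_complexified[OF minus \<open>V \<noteq> 0\<close>] by auto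
  have "cis t *s y + inverse (cis t) *s y = (2 * cos t) *\<^sub>R y" for y :: "complex ^ 'n"
  proof -
    have "cis t + inverse (cis t) = of_real (2 * cos t)"
      by (simp add: complex_eq_iff)
    then show ?thesis
      by (simp add: vec_eq_iff scaleR_conv_of_real[where 'a = complex] flip: distrib_right)
  qed
  then have "phi_WE Q (cis t) *v V = 2 *\<^sub>R (cmat T *v V) + (2 * cos t) *\<^sub>R (cmat A *v V)"
    by (simp add: phi_WE_dihedral[OF d] add.assoc scaleR_2)
  then have "V \<bullet> (phi_WE Q (cis t) *v V) = (1 + cos t) * (V \<bullet> (cmat (T + A) *v V)) + (1 - cos t) * (V \<bullet> (cmat (T - A) *v V))"
    by (simp add: inner_add_right inner_diff_right cmat_add cmat_diff matrix_vector_mult_add_rdistrib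
        matrix_vector_mult_diff_rdistrib algebra_simps)
  moreover have "0 \<le> 1 + cos t" "0 \<le> 1 - cos t"
    using cos_ge_minus_one[of t] cos_le_one[of t] by linarith+
  moreover have "0 < 1 + cos t \<or> 0 < 1 - cos t" by linarith
  ultimately show ?thesis
    using p q by (metis add_nonneg_pos add_pos_nonneg less_imp_le mult_nonneg_nonneg mult_pos_pos)
qed

text \<open>\<open>V k\<close> is the variable of the edge between the faces \<open>k - 1\<close> and \<open>k\<close>.\<close>

definition strip_solution ::
  "'k::real_or_complex ^ 'n::finite ^ 'n \<Rightarrow> 'k ^ 'n ^ 'n \<Rightarrow> 'k ^ 'n ^ 'n
    \<Rightarrow> (int \<Rightarrow> 'k ^ ('n + 'n)) \<Rightarrow> (int \<Rightarrow> 'k ^ ('n + 'n)) \<Rightarrow> (int \<Rightarrow> 'k ^ 'n) \<Rightarrow> bool" where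
  "strip_solution T A U f g V \<longleftrightarrow> f \<in> ell2 UNIV \<and> g \<in> ell2 UNIV \<and> V \<in> ell2 UNIV \<and>
     (\<forall>k. A *v V (k - 1) + T *v V k + T *v V k + A *v V (k + 1) + block_row U U *v (f (k - 1) + f k) = 0) \<and>
     (\<forall>k. g k = block_mat T A A T *v f k + block_col U U *v (V k + V (k + 1)))"

lemma ell2_cvec: "f \<in> ell2 UNIV \<Longrightarrow> (\<lambda>k. cvec (f k)) \<in> ell2 UNIV"
  by (simp add: ell2_def)

text \<open>Equal couplings \<open>U\<close> to West and East make the column and row factors of
  \<open>S_WE\<close> multiples of one matrix, by \<open>1 + z\<close> and
  \<open>1 + inverse z\<close>.\<close>

lemma S_WE_dihedral:
  assumes "dihedral_face Q T A U"
  shows "S_WE Q z *v x = cmat (block_mat T A A T) *v x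
    - (1 + z) *s (cmat (block_col U U) *v (matrix_inv (phi_WE Q z) *v ((1 + inverse z) *s (cmat (block_row U U) *v x))))"
proof -
  have "S_WE Q z = block_mat (cmat T) (cmat A) (cmat A) (cmat T)
     - (block_col (cmat U) (cmat U) + z *m block_col (cmat U) (cmat U)) ** matrix_inv (phi_WE Q z)
       ** (block_row (cmat U) (cmat U) + inverse z *m block_row (cmat U) (cmat U))"
    using assms by (simp add: S_WE_def dihedral_face_def)
  then show ?thesis
    by (simp add: cmat_block_mat cmat_block_col cmat_block_row vector_sadd_rdistrib
        matrix_vector_mult_diff_rdistrib matrix_vector_mult_add_rdistrib scale_mat_mult
        flip: matrix_vector_mul_assoc)
qed

lemma fourier_sum_cong_circle:
  "fourier_sum f F \<Longrightarrow> (\<And>t. F (cis t) = G (cis t)) \<Longrightarrow> fourier_sum f G"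
  by (simp add: fourier_sum_iff)

lemma fourier_sum_0: "fourier_sum (\<lambda>k. 0) (\<lambda>z. 0)"
  by (simp add: fourier_sum_iff square_integrable_def trig_sum_def)

lemma fourier_sum_measurable: "fourier_sum f F \<Longrightarrow> (\<lambda>\<theta>. F (cis \<theta>)) \<in> borel_measurable circ"
  by (simp add: fourier_sum_iff square_integrable_def)

text \<open>The definite description needs two halves: \<open>g\<close>, with a transform of
  \<open>f\<close>, is a witness; any other candidate has an almost everywhere equal transform and
  hence the same coefficients.\<close>

lemma strip_operator_eq:
  fixes Q :: "('k::real_or_complex, 'n::finite) face"
  assumes Q: "face_operator Q" and d: "dihedral_face Q T A U" and sol: "strip_solution T A U f g V"
  shows "strip_operator Q f = g"
proof -
  let ?K = "cmat (block_mat T A A T)" and ?C = "cmat (block_col U U)" and ?R = "cmat (block_row U U)"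
  let ?f = "\<lambda>k. cvec (f k)" and ?g = "\<lambda>k. cvec (g k)" and ?V = "\<lambda>k. cvec (V k)"
  have f: "?f \<in> ell2 UNIV" and V: "?V \<in> ell2 UNIV" and g: "g \<in> ell2 UNIV"
    and eq: "\<And>k. A *v V (k - 1) + T *v V k + T *v V k + A *v V (k + 1) + block_row U U *v (f (k - 1) + f k) = 0"
    and gk: "\<And>k. g k = block_mat T A A T *v f k + block_col U U *v (V k + V (k + 1))"
    using sol by (auto simp: strip_solution_def intro: ell2_cvec)
  obtain F0 W0 where F0: "fourier_sum ?f F0" and W0: "fourier_sum ?V W0"
    using fourier_sum_exists[OF f] fourier_sum_exists[OF V] by blast
  \<comment> \<open>Transform of the left-hand side of the recurrence: index \<open>k - 1\<close>
    becomes the factor \<open>z\<close>, index \<open>k + 1\<close> the factor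
    \<open>inverse z\<close>.\<close>
  define h where "h z = cmat A *v (z *s W0 z) + cmat T *v W0 z + cmat T *v W0 z + cmat A *v (inverse z *s W0 z)
      + ?R *v (z *s F0 z + F0 z)" for z
  have h: "fourier_sum (\<lambda>k. 0) h"
  proof -
    have "fourier_sum (\<lambda>k. cmat A *v ?V (k - 1) + cmat T *v ?V k + cmat T *v ?V k + cmat A *v ?V (k + 1)
        + ?R *v (?f (k - 1) + ?f k)) h"
      unfolding h_def
      by (intro fourier_sum_add fourier_sum_matrix fourier_sum_shift f V F0 W0)
    moreover have "cmat A *v ?V (k - 1) + cmat T *v ?V k + cmat T *v ?V k + cmat A *v ?V (k + 1)
        + ?R *v (?f (k - 1) + ?f k) = 0" for k
      using arg_cong[OF eq[of k], of cvec] by (simp only: cvec_add cvec_mult cvec_0)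
    ultimately show ?thesis by simp
  qed
  \<comment> \<open>Changing \<open>F0\<close> and \<open>W0\<close> on a null set makes the recurrence hold at every point of the circle, so that
    the measurability of \<open>S_WE Q z *v F z\<close> need not be derived from that of \<open>matrix_inv\<close>.\<close>
  define F where "F z = (if h z = 0 then F0 z else 0)" for z
  define W where "W z = (if h z = 0 then W0 z else 0)" for z
  have ae: "AE \<theta> in circ. h (cis \<theta>) = 0"
    by (rule fourier_sum_AE_unique[OF h fourier_sum_0])
  note [measurable] = fourier_sum_measurable[OF h] fourier_sum_measurable[OF F0] fourier_sum_measurable[OF W0]
  have F: "fourier_sum ?f F"
  proof (rule fourier_sum_AE_cong[OF F0])
    show "(\<lambda>\<theta>. F (cis \<theta>)) \<in> borel_measurable circ" unfolding F_def by measurable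
    show "AE \<theta> in circ. F0 (cis \<theta>) = F (cis \<theta>)" using ae by eventually_elim (simp add: F_def)
  qed
  have W: "fourier_sum ?V W"
  proof (rule fourier_sum_AE_cong[OF W0])
    show "(\<lambda>\<theta>. W (cis \<theta>)) \<in> borel_measurable circ" unfolding W_def by measurable
    show "AE \<theta> in circ. W0 (cis \<theta>) = W (cis \<theta>)" using ae by eventually_elim (simp add: W_def)
  qed
  \<comment> \<open>The recurrence puts \<open>1 + z\<close> next to the row \<open>?R\<close> and
    \<open>1 + inverse z\<close> next to the column \<open>?C\<close>, while \<open>S_WE\<close> has
    them the other way round. Being scalars they may be exchanged, through
    \<open>inverse z * (1 + z) = 1 + inverse z\<close>.\<close>
  have S: "?K *v F z + ?C *v (W z + inverse z *s W z) = S_WE Q z *v F z" if z: "z = cis t" for z t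
  proof -
    have z0: "z \<noteq> 0" using z by simp
    have "h z = phi_WE Q z *v W0 z + (1 + z) *s (?R *v F0 z)"
      by (simp add: h_def phi_WE_dihedral[OF d] cmat_add matrix_vector_mult_add_rdistrib
          matrix_vector_scale matrix_vector_right_distrib vector_sadd_rdistrib add_ac)
    then have "phi_WE Q z *v W0 z = - ((1 + z) *s (?R *v F0 z))" if "h z = 0"
      using that by (simp only: eq_neg_iff_add_eq_0)
    then have "phi_WE Q z *v W z = - ((1 + z) *s (?R *v F z))"
      by (auto simp: W_def F_def)
    moreover have "matrix_inv (phi_WE Q z) *v (phi_WE Q z *v W z) = W z"
      using phi_WE_positive[OF Q d] z by (intro invertible_if_positive) (metis less_irrefl)
    ultimately have Wz: "W z = matrix_inv (phi_WE Q z) *v (- ((1 + z) *s (?R *v F z)))" by simp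
    have e: "inverse z * (1 + z) = 1 + inverse z" "(1 + z) * inverse z = 1 + inverse z"
      using z0 by (simp_all add: field_simps)
    have "(1 + inverse z) *s (?R *v F z) = inverse z *s ((1 + z) *s (?R *v F z))"
      by (simp only: vector_smult_assoc e)
    then have "S_WE Q z *v F z = ?K *v F z + (1 + z) *s (?C *v (inverse z *s W z))"
      unfolding S_WE_dihedral[OF d] Wz
      by (simp only: matrix_vector_scale vec.linear_neg[OF matrix_vector_mul_linear_gen]
          vec.scale_minus_right diff_conv_add_uminus)
    also have "(1 + z) *s (?C *v (inverse z *s W z)) = ?C *v (W z + inverse z *s W z)"
      unfolding matrix_vector_scale vector_smult_assoc e by (simp add: matrix_vector_scale matrix_vector_right_distrib vector_sadd_rdistrib)
    finally show ?thesis by simp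
  qed
  have SF: "fourier_sum ?g (\<lambda>z. S_WE Q z *v F z)"
  proof (rule fourier_sum_cong_circle)
    have "fourier_sum (\<lambda>k. ?K *v ?f k + ?C *v (?V k + ?V (k + 1))) (\<lambda>z. ?K *v F z + ?C *v (W z + inverse z *s W z))"
      by (intro fourier_sum_add fourier_sum_matrix fourier_sum_shift V F W)
    moreover have "?K *v ?f k + ?C *v (?V k + ?V (k + 1)) = ?g k" for k
      by (simp add: gk cvec_add cvec_mult)
    ultimately show "fourier_sum ?g (\<lambda>z. ?K *v F z + ?C *v (W z + inverse z *s W z))" by simp
  qed (rule S, rule refl)
  show ?thesis
    unfolding strip_operator_def
  proof (rule the_equality)
    show "g \<in> ell2 UNIV \<and> (\<exists>F. fourier_sum ?f F \<and> fourier_sum ?g (\<lambda>z. S_WE Q z *v F z))"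
      using g F SF by blast
  next
    fix g' :: "int \<Rightarrow> 'k ^ ('n + 'n)"
    assume "g' \<in> ell2 UNIV \<and> (\<exists>F. fourier_sum ?f F \<and> fourier_sum (\<lambda>k. cvec (g' k)) (\<lambda>z. S_WE Q z *v F z))"
    then obtain F' where F': "fourier_sum ?f F'" "fourier_sum (\<lambda>k. cvec (g' k)) (\<lambda>z. S_WE Q z *v F' z)"
      by blast
    have "AE \<theta> in circ. S_WE Q (cis \<theta>) *v F' (cis \<theta>) = S_WE Q (cis \<theta>) *v F (cis \<theta>)"
      using fourier_sum_AE_unique[OF F'(1) F] by eventually_elim simp
    with F'(2) fourier_sum_measurable[OF SF]
    have "fourier_sum (\<lambda>k. cvec (g' k)) (\<lambda>z. S_WE Q z *v F z)"
      by (rule fourier_sum_AE_cong)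
    from fourier_sum_coeff_unique[OF this SF] show "g' = g"
      by (simp add: fun_eq_iff)
  qed
qed


section \<open>Energy of half-strip operators\<close>

lemma ell2_mono: "f \<in> ell2 I \<Longrightarrow> f \<in> ell2 UNIV"
  by (simp add: ell2_def)

lemma ell2_0 [simp]: "0 \<in> ell2 I" "(\<lambda>k. 0) \<in> ell2 I"
  by (simp_all add: ell2_def)

lemma summable_on_rinner:
  fixes f g :: "int \<Rightarrow> 'k::real_or_complex ^ 'n"
  assumes "f \<in> ell2 UNIV" "g \<in> ell2 UNIV"
  shows "(\<lambda>k. hinner (f k) (g k)) summable_on UNIV" "(\<lambda>k. rinner (f k) (g k)) summable_on UNIV"
    "Re (to_complex (ell2_inner f g)) = (\<Sum>\<^sub>\<infinity>k. rinner (f k) (g k))"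
proof -
  have "(\<lambda>k. (norm (f k))\<^sup>2 + (norm (g k))\<^sup>2) summable_on UNIV"
    using assms by (intro summable_on_add) (auto simp: ell2_def)
  then have "(\<lambda>k. norm (hinner (f k) (g k))) summable_on UNIV"
    by (rule summable_on_comparison_test) (simp_all add: norm_hinner_le)
  then show s: "(\<lambda>k. hinner (f k) (g k)) summable_on UNIV"
    by (rule abs_summable_summable)
  have bl: "bounded_linear (\<lambda>x. Re (to_complex (x :: 'k)))"
    by (rule bounded_linear_compose[OF bounded_linear_Re bounded_linear_to_complex])
  show "(\<lambda>k. rinner (f k) (g k)) summable_on UNIV"
    unfolding rinner_def by (rule summable_on_bounded_linear[OF bl s])
  show "Re (to_complex (ell2_inner f g)) = (\<Sum>\<^sub>\<infinity>k. rinner (f k) (g k))"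
    unfolding rinner_def ell2_inner_def by (intro infsumI[symmetric] has_sum_bounded_linear[OF bl] has_sum_infsum s)
qed

text \<open>Positivity gives injectivity, hence surjectivity in finite dimension.
  \<open>schur\<close> inverts with \<open>inv\<close>, which is a right inverse exactly when the
  block is surjective.\<close>

lemma surj_if_rinner_pos:
  fixes B :: "'k::real_or_complex ^ 'n \<Rightarrow> 'k ^ 'n"
  assumes add: "\<And>x y. B (x + y) = B x + B y" and scale: "\<And>c x. B (c *s x) = c *s B x"
    and pos: "\<And>x. x \<noteq> 0 \<Longrightarrow> 0 < rinner x (B x)"
  shows "surj B"
proof -
  have lin: "Vector_Spaces.linear (*s) (*s) B"
    by unfold_locales (simp_all add: add scale)
  have "inj B"
    unfolding vec.linear_inj_iff_eq_0[OF lin]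
  proof (intro allI impI)
    fix x assume "B x = 0"
    then show "x = 0" using pos[of x] by (cases "x = 0") auto
  qed
  then show ?thesis by (rule vec.linear_inj_imp_surj[OF lin])
qed

definition energy :: "(('k::real_or_complex, 'n::finite) hs_vec \<Rightarrow> ('k, 'n) hs_vec) \<Rightarrow> ('k, 'n) hs_vec \<Rightarrow> real" where
  "energy M x = Re (to_complex (hs_inner x (M x)))"

lemma Re_hs_inner:
  assumes "(s, n, h) \<in> half_strip_space I" "(s', n', h') \<in> half_strip_space I"
  shows "Re (to_complex (hs_inner (s, n, h) (s', n', h')))
    = (\<Sum>\<^sub>\<infinity>k. rinner (s k) (s' k)) + (\<Sum>\<^sub>\<infinity>k. rinner (n k) (n' k)) + rinner h h'"
proof -
  have "s \<in> ell2 UNIV" "n \<in> ell2 UNIV" "s' \<in> ell2 UNIV" "n' \<in> ell2 UNIV"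
    using assms by (auto simp: half_strip_space_def intro: ell2_mono)
  then show ?thesis
    by (simp add: to_complex_add summable_on_rinner(3) flip: rinner_def)
qed

lemma Re_hs_inner_self:
  assumes "x \<in> half_strip_space I"
  shows "0 \<le> Re (to_complex (hs_inner x x))" "Re (to_complex (hs_inner x x)) = 0 \<Longrightarrow> x = 0"
proof -
  obtain s n h where x: "x = (s, n, h)" by (cases x) auto
  have s: "s \<in> ell2 UNIV" and n: "n \<in> ell2 UNIV"
    using assms by (auto simp: x half_strip_space_def intro: ell2_mono)
  have e: "Re (to_complex (hs_inner x x)) = (\<Sum>\<^sub>\<infinity>k. (norm (s k))\<^sup>2) + (\<Sum>\<^sub>\<infinity>k. (norm (n k))\<^sup>2) + (norm h)\<^sup>2"
    using Re_hs_inner[of s n h I s n h] assms by (simp add: x rinner_self)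
  have nn: "0 \<le> (\<Sum>\<^sub>\<infinity>k. (norm (f k))\<^sup>2)" for f :: "int \<Rightarrow> 'a ^ 'b"
    by (rule infsum_nonneg) simp
  show "0 \<le> Re (to_complex (hs_inner x x))" unfolding e using nn[of s] nn[of n] by simp
  assume "Re (to_complex (hs_inner x x)) = 0"
  then have z: "(\<Sum>\<^sub>\<infinity>k. (norm (s k))\<^sup>2) = 0" "(\<Sum>\<^sub>\<infinity>k. (norm (n k))\<^sup>2) = 0" "(norm h)\<^sup>2 = 0"
    unfolding e using nn[of s] nn[of n] zero_le_power2[of "norm h"] by linarith+
  have zero: "f = 0" if "f \<in> ell2 UNIV" "(\<Sum>\<^sub>\<infinity>k. (norm (f k))\<^sup>2) = 0" for f :: "int \<Rightarrow> 'a ^ 'b"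
  proof
    fix k
    have "(norm (f k))\<^sup>2 = 0"
      by (rule nonneg_infsum_le_0D[of "\<lambda>k. (norm (f k))\<^sup>2" UNIV]) (use that in \<open>auto simp: ell2_def\<close>)
    then show "f k = 0 k" by simp
  qed
  show "x = 0" using z zero[OF s] zero[OF n] by (simp add: x zero_prod_def)
qed

text \<open>A positive real \<open>INF\<close> bounds the individual quotients only if they are
  bounded below. Boundedness of \<open>M\<close> ensures this:
  \<open><x, M x> \<ge> - |x|^2 - |M x|^2 \<ge> - (1 + C^2) |x|^2\<close>.\<close>

lemma energy_pos:
  assumes M: "half_strip_operator I M" and x: "x \<in> half_strip_space I" "x \<noteq> 0"
  shows "0 < energy M x"
proof -
  let ?q = "\<lambda>x. Re (to_complex (hs_inner x (M x))) / Re (to_complex (hs_inner x x))"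
  from M obtain C where C: "\<And>x. x \<in> half_strip_space I \<Longrightarrow> hs_norm (M x) \<le> C * hs_norm x"
    and MI: "\<And>x. x \<in> half_strip_space I \<Longrightarrow> M x \<in> half_strip_space I"
    unfolding half_strip_operator_def bounded_self_adjoint_def by blast
  have lower: "- (1 + C\<^sup>2) \<le> ?q x" if x: "x \<in> half_strip_space I - {0}" for x
  proof -
    obtain s n h s' n' h' where e: "x = (s, n, h)" "M x = (s', n', h')" by (cases x, cases "M x") auto
    have xI: "x \<in> half_strip_space I" using x by simp
    then have I: "(s, n, h) \<in> half_strip_space I" "(s', n', h') \<in> half_strip_space I"
      using MI[OF xI, unfolded e(2)] by (simp_all add: e(1))
    have r: "- ((norm a)\<^sup>2 + (norm b)\<^sup>2) \<le> rinner a b" for a b :: "'a ^ 'b"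
    proof -
      have "0 \<le> norm a * norm b" by simp
      then show ?thesis
        using abs_rinner_le[of a b] sum_squares_bound[of "norm a" "norm b"] by linarith
    qed
    have sr: "- ((\<Sum>\<^sub>\<infinity>k. (norm (f k))\<^sup>2) + (\<Sum>\<^sub>\<infinity>k. (norm (g k))\<^sup>2)) \<le> (\<Sum>\<^sub>\<infinity>k. rinner (f k) (g k))"
      if "f \<in> ell2 I" "g \<in> ell2 I" for f g :: "int \<Rightarrow> 'a ^ 'b"
    proof -
      have s: "(\<lambda>k. (norm (f k))\<^sup>2) summable_on UNIV" "(\<lambda>k. (norm (g k))\<^sup>2) summable_on UNIV"
        using that by (auto simp: ell2_def)
      have "- ((\<Sum>\<^sub>\<infinity>k. (norm (f k))\<^sup>2) + (\<Sum>\<^sub>\<infinity>k. (norm (g k))\<^sup>2)) = (\<Sum>\<^sub>\<infinity>k. - ((norm (f k))\<^sup>2 + (norm (g k))\<^sup>2))"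
        by (simp add: infsum_add[OF s] infsum_uminus del: minus_add_distrib)
      also have "\<dots> \<le> (\<Sum>\<^sub>\<infinity>k. rinner (f k) (g k))"
        using that
        by (intro infsum_mono r summable_on_rinner ell2_mono summable_on_uminus[THEN iffD2] summable_on_add s) auto
      finally show ?thesis .
    qed
    have ell: "s \<in> ell2 I" "n \<in> ell2 I" "s' \<in> ell2 I" "n' \<in> ell2 I"
      using I by (auto simp: half_strip_space_def)
    have "- (Re (to_complex (hs_inner x x)) + Re (to_complex (hs_inner (M x) (M x)))) \<le> Re (to_complex (hs_inner x (M x)))"
      unfolding e(2) unfolding e(1) Re_hs_inner[OF I] Re_hs_inner[OF I(1) I(1)] Re_hs_inner[OF I(2) I(2)] rinner_self
      using sr[OF ell(1,3)] sr[OF ell(2,4)] r[of h h'] by linarith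
    moreover have "Re (to_complex (hs_inner (M x) (M x))) \<le> C\<^sup>2 * Re (to_complex (hs_inner x x))"
    proof -
      have "(hs_norm (M x))\<^sup>2 \<le> (C * hs_norm x)\<^sup>2"
        by (rule power_mono[OF C[OF xI]]) (simp add: hs_norm_def Re_hs_inner_self(1)[OF MI[OF xI]])
      then show ?thesis
        by (simp add: hs_norm_def power_mult_distrib Re_hs_inner_self(1)[OF MI[OF xI]] Re_hs_inner_self(1)[OF xI])
    qed
    moreover have "0 < Re (to_complex (hs_inner x x))"
      using Re_hs_inner_self[OF xI] x by (metis Diff_iff insertI1 order_le_less)
    moreover from calculation have "- (1 + C\<^sup>2) * Re (to_complex (hs_inner x x)) \<le> Re (to_complex (hs_inner x (M x)))"
      by (simp add: algebra_simps)
    ultimately show ?thesis by (subst pos_le_divide_eq)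
  qed
  have "0 < (INF x\<in>half_strip_space I - {0}. ?q x)"
    using M by (simp add: half_strip_operator_def)
  also have "\<dots> \<le> ?q x"
    using x lower by (intro cINF_lower bdd_belowI2[of _ "- (1 + C\<^sup>2)"]) auto
  finally show ?thesis
    using Re_hs_inner_self(1)[OF x(1)] by (simp add: energy_def zero_less_divide_iff)
qed

lemma half_strip_operator_maps:
  "half_strip_operator I M \<Longrightarrow> x \<in> half_strip_space I \<Longrightarrow> M x \<in> half_strip_space I"
  by (simp add: half_strip_operator_def bounded_self_adjoint_def)

lemma half_strip_operator_add:
  "half_strip_operator I M \<Longrightarrow> x \<in> half_strip_space I \<Longrightarrow> y \<in> half_strip_space I \<Longrightarrow> M (x + y) = M x + M y"
  by (simp add: half_strip_operator_def bounded_self_adjoint_def)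

lemma half_strip_operator_scale:
  "half_strip_operator I M \<Longrightarrow> x \<in> half_strip_space I \<Longrightarrow> M (hs_scale c x) = hs_scale c (M x)"
  by (simp add: half_strip_operator_def bounded_self_adjoint_def)

lemma vertical_mem: "(0, 0, v) \<in> half_strip_space I"
  by (simp add: half_strip_space_def)

lemma half_strip_operator_0: "half_strip_operator I M \<Longrightarrow> M 0 = 0"
  using half_strip_operator_add[of I M 0 0] vertical_mem[of 0 I] by (simp add: zero_prod_def)

lemma energy_0:
  assumes "half_strip_operator I M"
  shows "energy M 0 = 0"
  using Re_hs_inner[OF vertical_mem[of 0 I] vertical_mem[of 0 I]] half_strip_operator_0[OF assms]
  by (simp add: energy_def zero_prod_def del: hs_inner.simps)

lemma energy_nonneg:
  assumes "half_strip_operator I M" "x \<in> half_strip_space I"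
  shows "0 \<le> energy M x"
  using energy_pos[OF assms] energy_0[OF assms(1)] by (cases "x = 0") simp_all

section \<open>The diagonal block on the vertical edge\<close>

definition vertical_block ::
  "(('k::real_or_complex, 'n::finite) hs_vec \<Rightarrow> ('k, 'n) hs_vec) \<Rightarrow> 'k ^ 'n \<Rightarrow> 'k ^ 'n" where
  "vertical_block M v = snd (snd (M (0, 0, v)))"

lemma
  assumes M: "half_strip_operator I M"
  shows vertical_block_add: "vertical_block M (u + v) = vertical_block M u + vertical_block M v"
    and vertical_block_scale: "vertical_block M (c *s v) = c *s vertical_block M v"
    and rinner_vertical_block: "rinner v (vertical_block M v) = energy M (0, 0, v)"
proof -
  show "vertical_block M (u + v) = vertical_block M u + vertical_block M v"
    using half_strip_operator_add[OF M vertical_mem vertical_mem, of u v] by (simp add: vertical_block_def)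
  have "hs_scale c (0, 0, v) = (0, 0, c *s v)" by (simp add: zero_fun_def)
  then show "vertical_block M (c *s v) = c *s vertical_block M v"
    using half_strip_operator_scale[OF M vertical_mem, of c v]
    by (cases "M (0, 0, v)") (simp add: vertical_block_def)
  obtain s n h where e: "M (0, 0, v) = (s, n, h)" by (cases "M (0, 0, v)") auto
  have "(s, n, h) \<in> half_strip_space I"
    using half_strip_operator_maps[OF M vertical_mem, of v] by (simp add: e)
  from Re_hs_inner[OF vertical_mem this] show "rinner v (vertical_block M v) = energy M (0, 0, v)"
    by (simp add: vertical_block_def energy_def e del: hs_inner.simps)
qed

lemma surj_vertical_block:
  assumes M: "half_strip_operator I M"
  shows "surj (vertical_block M)"
proof (rule surj_if_rinner_pos)
  fix v :: "'a ^ 'b" assume "v \<noteq> 0"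
  then show "0 < rinner v (vertical_block M v)"
    unfolding rinner_vertical_block[OF M] by (intro energy_pos[OF M] vertical_mem) (simp add: zero_prod_def)
qed (rule vertical_block_add[OF M] vertical_block_scale[OF M])+

text \<open>This is the block inverted in the gluing: the shared edge belongs both to the half-strip
  and to the face. The part \<open>T\<close> is positive as the energy of a face with data on one
  edge only.\<close>

lemma surj_vertical_block_add:
  fixes Q :: "('k::real_or_complex, 'n::finite) face"
  assumes M: "half_strip_operator I M" and Q: "face_operator Q" and d: "dihedral_face Q T A U"
  shows "surj (\<lambda>v. vertical_block M v + T *v v)"
proof (rule surj_if_rinner_pos)
  fix v :: "'k ^ 'n" assume "v \<noteq> 0"
  then have "0 < face_energy Q (on_sides 0 0 v 0)"
    by (intro face_energy_pos[OF Q, of _ West]) simp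
  then have "0 < rinner v (T *v v)"
    by (simp add: face_energy_sides face_apply_dihedral[OF d])
  then show "0 < rinner v (vertical_block M v + T *v v)"
    using energy_nonneg[OF M vertical_mem, of v] by (simp add: rinner_add_right rinner_vertical_block[OF M])
qed (simp_all add: vertical_block_add[OF M] vertical_block_scale[OF M] matrix_vector_right_distrib
    matrix_vector_scale vec.scale_right_distrib)


section \<open>Unrolling the fixed point\<close>

text \<open>\<open>pos\<close> numbers the cells starting next to the vertical side:
  \<open>-1 - m\<close> for the West and \<open>m\<close> for the East half-line. In this numbering
  \<open>advance\<close>, which removes the cell next to the side, is the inverse shift of either
  gluing.\<close>

locale half_line =
  fixes I :: "int set" and pos :: "nat \<Rightarrow> int"
  assumes bij_pos: "bij_betw pos UNIV I"
begin

definition advance :: "(int \<Rightarrow> 'v::zero) \<Rightarrow> int \<Rightarrow> 'v" where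
  "advance f = (\<lambda>k. if k \<in> I then f (pos (Suc (inv pos k))) else 0)"

lemma pos_in [simp]: "pos m \<in> I"
  using bij_pos by (auto simp: bij_betw_def)

lemma advance_pos [simp]: "advance f (pos m) = f (pos (Suc m))"
  using bij_pos by (simp add: advance_def bij_betw_def)

lemma pos_cases:
  assumes "k \<in> I"
  obtains m where "k = pos m"
  using assms bij_pos by (auto simp: bij_betw_def)

lemma eq_on_half_line:
  assumes "f \<in> ell2 I" "g \<in> ell2 I" "\<And>m. f (pos m) = g (pos m)"
  shows "f = g"
proof
  fix k show "f k = g k"
  proof (cases "k \<in> I")
    case True
    then show ?thesis using assms(3) by (auto elim: pos_cases)
  qed (use assms in \<open>simp add: ell2_def\<close>)
qed

lemma summable_on_pos:
  fixes f :: "int \<Rightarrow> 'b::{topological_comm_monoid_add, t2_space}"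
  assumes "\<And>k. k \<notin> I \<Longrightarrow> f k = 0"
  shows "f summable_on UNIV \<longleftrightarrow> (\<lambda>m. f (pos m)) summable_on UNIV"
proof -
  have "f summable_on UNIV \<longleftrightarrow> f summable_on I"
    by (rule summable_on_cong_neutral) (use assms in auto)
  then show ?thesis
    using summable_on_reindex_bij_betw[OF bij_pos, of f] by simp
qed

lemma infsum_pos:
  fixes f :: "int \<Rightarrow> 'b::{topological_comm_monoid_add, t2_space}"
  assumes "\<And>k. k \<notin> I \<Longrightarrow> f k = 0"
  shows "(\<Sum>\<^sub>\<infinity>k. f k) = (\<Sum>\<^sub>\<infinity>m. f (pos m))"
proof -
  have "infsum f UNIV = infsum f I"
    by (rule infsum_cong_neutral) (use assms in auto)
  then show ?thesis
    using infsum_reindex_bij_betw[OF bij_pos, of f] by simp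
qed

lemma ell2_iff_summable:
  "f \<in> ell2 I \<longleftrightarrow> (\<forall>k. k \<notin> I \<longrightarrow> f k = 0) \<and> summable (\<lambda>m. (norm (f (pos m)))\<^sup>2)"
proof -
  have "(\<lambda>k. (norm (f k))\<^sup>2) summable_on UNIV \<longleftrightarrow> summable (\<lambda>m. (norm (f (pos m)))\<^sup>2)"
    if "\<forall>k. k \<notin> I \<longrightarrow> f k = 0"
    using that by (subst summable_on_pos) (auto simp: summable_on_UNIV_nonneg_real_iff)
  then show ?thesis by (auto simp: ell2_def)
qed

lemma ell2_advance: "f \<in> ell2 I \<Longrightarrow> advance f \<in> ell2 I"
  unfolding ell2_iff_summable using summable_Suc_iff[of "\<lambda>m. (norm (f (pos m)))\<^sup>2"]
  by (simp, simp add: advance_def)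

text \<open>Separates the contribution of the cell removed by one gluing step; the telescoping of
  energies rests on this.\<close>

lemma infsum_rinner_split:
  assumes f: "f \<in> ell2 I" and g: "g \<in> ell2 I"
  shows "(\<Sum>\<^sub>\<infinity>k. rinner (f k) (g k))
    = rinner (f (pos 0)) (g (pos 0)) + (\<Sum>\<^sub>\<infinity>k. rinner (advance f k) (advance g k))"
proof -
  let ?r = "\<lambda>m. rinner (f (pos m)) (g (pos m))"
  have z: "rinner (f k) (g k) = 0" "rinner (advance f k) (advance g k) = 0" if "k \<notin> I" for k
    using that f by (auto simp: ell2_def advance_def)
  have s: "?r summable_on UNIV"
    using summable_on_rinner(2)[OF ell2_mono[OF f] ell2_mono[OF g]] z(1) by (subst (asm) summable_on_pos) auto
  have "(\<Sum>\<^sub>\<infinity>k. rinner (f k) (g k)) = infsum ?r (insert 0 (range Suc))"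
    using infsum_pos[of "\<lambda>k. rinner (f k) (g k)"] z(1) by (simp add: UNIV_nat_eq[symmetric])
  also have "\<dots> = ?r 0 + infsum ?r (range Suc)"
    by (rule infsum_insert) (use summable_on_subset_banach[OF s] in auto)
  also have "infsum ?r (range Suc) = (\<Sum>\<^sub>\<infinity>m. ?r (Suc m))"
    by (simp add: infsum_reindex o_def)
  also have "\<dots> = (\<Sum>\<^sub>\<infinity>k. rinner (advance f k) (advance g k))"
    by (subst infsum_pos) (use z(2) in auto)
  finally show ?thesis .
qed

end

text \<open>\<open>step\<close> is the fixed point equation made explicit. \<open>h\<close> sits on
  the free vertical edge and \<open>v\<close> on the edge shared with the rest: the forces at
  \<open>v\<close> cancel, the face at \<open>pos 0\<close> alone determines the outputs on its own
  sides, and all other outputs are those of the remaining half-strip.\<close>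

locale half_strip = half_line I pos
  for I :: "int set" and pos :: "nat \<Rightarrow> int" +
  fixes Q :: "('k::real_or_complex, 'n::finite) face" and T A U :: "'k ^ 'n ^ 'n"
    and M :: "('k, 'n) hs_vec \<Rightarrow> ('k, 'n) hs_vec"
  assumes face: "face_operator Q" and dihedral: "dihedral_face Q T A U"
    and operator: "half_strip_operator I M"
    and step: "\<And>s n h. (s, n, h) \<in> half_strip_space I \<Longrightarrow> \<exists>v s' n' v' s'' n''.
      M (advance s, advance n, v) = (s', n', v') \<and>
      v' + (U *v (s (pos 0) + n (pos 0)) + T *v v + A *v h) = 0 \<and>
      M (s, n, h) = (s'', n'', U *v (s (pos 0) + n (pos 0)) + A *v v + T *v h) \<and>
      s'' (pos 0) = T *v s (pos 0) + A *v n (pos 0) + U *v (v + h) \<and>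
      n'' (pos 0) = A *v s (pos 0) + T *v n (pos 0) + U *v (v + h) \<and>
      (\<forall>m. s'' (pos (Suc m)) = s' (pos m)) \<and> (\<forall>m. n'' (pos (Suc m)) = n' (pos m))"
begin

text \<open>The balance of forces at the edges 1, 2, ...; edge 0 is left to the boundary
  condition.\<close>

definition edge_equation :: "(nat \<Rightarrow> 'k ^ 'n) \<Rightarrow> (nat \<Rightarrow> 'k ^ 'n) \<Rightarrow> bool" where
  "edge_equation a v \<longleftrightarrow>
     (\<forall>m. A *v v m + T *v v (Suc m) + T *v v (Suc m) + A *v v (Suc (Suc m)) + U *v (a m + a (Suc m)) = 0)"

text \<open>Iterates \<open>step\<close>, each time taking the shared edge as the free edge of what
  remains; \<open>v m\<close> is the value on the free edge after \<open>m\<close> removals.\<close>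

lemma vertical_edges:
  assumes x: "(s, n, h) \<in> half_strip_space I"
  obtains v s' n' where "v 0 = h" "summable (\<lambda>m. (norm (v m))\<^sup>2)"
    "edge_equation (\<lambda>m. s (pos m) + n (pos m)) v"
    "M (s, n, h) = (s', n', U *v (s (pos 0) + n (pos 0)) + A *v v 1 + T *v v 0)"
    "\<And>m. s' (pos m) = T *v s (pos m) + A *v n (pos m) + U *v (v m + v (Suc m))"
    "\<And>m. n' (pos m) = A *v s (pos m) + T *v n (pos m) + U *v (v m + v (Suc m))"
proof -
  have "\<forall>x\<in>half_strip_space I. \<exists>v s' n' v' s'' n''.
      M (advance (fst x), advance (fst (snd x)), v) = (s', n', v') \<and>
      v' + (U *v (fst x (pos 0) + fst (snd x) (pos 0)) + T *v v + A *v snd (snd x)) = 0 \<and>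
      M x = (s'', n'', U *v (fst x (pos 0) + fst (snd x) (pos 0)) + A *v v + T *v snd (snd x)) \<and>
      s'' (pos 0) = T *v fst x (pos 0) + A *v fst (snd x) (pos 0) + U *v (v + snd (snd x)) \<and>
      n'' (pos 0) = A *v fst x (pos 0) + T *v fst (snd x) (pos 0) + U *v (v + snd (snd x)) \<and>
      (\<forall>m. s'' (pos (Suc m)) = s' (pos m)) \<and> (\<forall>m. n'' (pos (Suc m)) = n' (pos m))"
    using step by auto
  then obtain w where w: "\<And>x. x \<in> half_strip_space I \<Longrightarrow> \<exists>s' n' v' s'' n''.
      M (advance (fst x), advance (fst (snd x)), w x) = (s', n', v') \<and>
      v' + (U *v (fst x (pos 0) + fst (snd x) (pos 0)) + T *v w x + A *v snd (snd x)) = 0 \<and>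
      M x = (s'', n'', U *v (fst x (pos 0) + fst (snd x) (pos 0)) + A *v w x + T *v snd (snd x)) \<and>
      s'' (pos 0) = T *v fst x (pos 0) + A *v fst (snd x) (pos 0) + U *v (w x + snd (snd x)) \<and>
      n'' (pos 0) = A *v fst x (pos 0) + T *v fst (snd x) (pos 0) + U *v (w x + snd (snd x)) \<and>
      (\<forall>m. s'' (pos (Suc m)) = s' (pos m)) \<and> (\<forall>m. n'' (pos (Suc m)) = n' (pos m))"
    by (elim bchoice[THEN exE]) blast
  \<comment> \<open>The half-strip vector after \<open>m\<close> removals: the remaining South and
    North data and the value at the last cut.\<close>
  define X where "X = rec_nat (s, n, h) (\<lambda>_ x. (advance (fst x), advance (fst (snd x)), w x))"
  define S where "S m = fst (X m)" for m
  define N where "N m = fst (snd (X m))" for m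
  define v where "v m = snd (snd (X m))" for m
  define S' where "S' m = fst (M (X m))" for m
  define N' where "N' m = fst (snd (M (X m)))" for m
  define v' where "v' m = snd (snd (M (X m)))" for m
  have X0: "X 0 = (s, n, h)" and XSuc: "X (Suc m) = (advance (S m), advance (N m), w (X m))" for m
    by (simp_all add: X_def S_def N_def)
  have X: "X m = (S m, N m, v m)" and MX: "M (X m) = (S' m, N' m, v' m)" for m
    by (simp_all add: S_def N_def v_def S'_def N'_def v'_def)
  have XI: "X m \<in> half_strip_space I" for m
  proof (induction m)
    case (Suc m)
    then show ?case unfolding XSuc unfolding X by (auto simp: half_strip_space_def intro: ell2_advance)
  qed (simp add: X0 x)
  have ell: "S m \<in> ell2 I" "N m \<in> ell2 I" for m
    using XI[of m] unfolding X by (auto simp: half_strip_space_def)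
  have MXI: "M (X m) \<in> half_strip_space I" for m
    by (rule half_strip_operator_maps[OF operator XI])
  then have ell': "S' m \<in> ell2 I" "N' m \<in> ell2 I" for m
    using MXI[of m] unfolding MX by (auto simp: half_strip_space_def)
  have SNSuc: "S (Suc m) = advance (S m)" "N (Suc m) = advance (N m)" "v (Suc m) = w (X m)" for m
    using X[of "Suc m"] unfolding XSuc by simp_all
  have SN0: "S 0 = s" "N 0 = n" by (simp_all add: S_def N_def X0)
  have S_pos: "S m (pos j) = s (pos (m + j))" and N_pos: "N m (pos j) = n (pos (m + j))" for m j
    by (induction m arbitrary: j) (simp_all add: SNSuc SN0)
  have st: "v' (Suc m) + (U *v (s (pos m) + n (pos m)) + T *v v (Suc m) + A *v v m) = 0 \<and>
      v' m = U *v (s (pos m) + n (pos m)) + A *v v (Suc m) + T *v v m \<and>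
      S' m (pos 0) = T *v s (pos m) + A *v n (pos m) + U *v (v (Suc m) + v m) \<and>
      N' m (pos 0) = A *v s (pos m) + T *v n (pos m) + U *v (v (Suc m) + v m) \<and>
      (\<forall>j. S' m (pos (Suc j)) = S' (Suc m) (pos j)) \<and> (\<forall>j. N' m (pos (Suc j)) = N' (Suc m) (pos j))" for m
  proof -
    have "X (Suc m) = (advance (fst (X m)), advance (fst (snd (X m))), w (X m))"
      by (simp add: XSuc S_def N_def)
    then show ?thesis
      using w[OF XI[of m]] S_pos[of m 0] N_pos[of m 0]
      by (auto simp: S'_def N'_def v'_def SNSuc(3) S_def N_def v_def)
  qed
  have adv: "advance (S' m) = S' (Suc m)" "advance (N' m) = N' (Suc m)" for m
    using st[of m] by (auto intro!: eq_on_half_line ell2_advance ell')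
  have step_pos: "S' m (pos (Suc j)) = S' (Suc m) (pos j)" "N' m (pos (Suc j)) = N' (Suc m) (pos j)" for m j
    using st[of m] by blast+
  have S'_pos: "S' 0 (pos (m + j)) = S' m (pos j)" and N'_pos: "N' 0 (pos (m + j)) = N' m (pos j)" for m j
    by (induction m arbitrary: j) (simp_all add: step_pos flip: add_Suc_right)
  \<comment> \<open>The shared edge is entered as West and the free one as East, as in a West
    half-strip. For an East half-strip they are exchanged, which does not change the energy of a
    dihedral face.\<close>
  define \<epsilon> where "\<epsilon> m = face_energy Q (on_sides (s (pos m)) (n (pos m)) (v (Suc m)) (v m))" for m
  have en: "energy M (X m) = \<epsilon> m + energy M (X (Suc m))" for m
  proof -
    have e: "energy M (X m) = (\<Sum>\<^sub>\<infinity>k. rinner (S m k) (S' m k)) + (\<Sum>\<^sub>\<infinity>k. rinner (N m k) (N' m k)) + rinner (v m) (v' m)" for m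
      unfolding energy_def MX unfolding X
      by (rule Re_hs_inner[OF XI[of m, unfolded X] MXI[of m, unfolded MX]])
    \<comment> \<open>Stationarity: at the shared edge the contributions of the face and of the
      remaining half-strip are opposite and cancel in the sum of the energies.\<close>
    have "v' (Suc m) = - (U *v (s (pos m) + n (pos m)) + T *v v (Suc m) + A *v v m)"
      using st[of m] by (simp only: eq_neg_iff_add_eq_0)
    then have "rinner (v (Suc m)) (v' (Suc m)) = - rinner (v (Suc m)) (U *v (s (pos m) + n (pos m)) + T *v v (Suc m) + A *v v m)"
      by (simp only: rinner_minus)
    moreover have "\<epsilon> m = rinner (s (pos m)) (S' m (pos 0)) + rinner (n (pos m)) (N' m (pos 0))
        + rinner (v (Suc m)) (U *v (s (pos m) + n (pos m)) + T *v v (Suc m) + A *v v m) + rinner (v m) (v' m)"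
      using st[of m] by (simp add: \<epsilon>_def face_energy_sides face_apply_dihedral[OF dihedral])
    moreover note infsum_rinner_split[OF ell(1)[of m] ell'(1)[of m], unfolded adv SNSuc(1,2)[symmetric] S_pos]
      infsum_rinner_split[OF ell(2)[of m] ell'(2)[of m], unfolded adv SNSuc(1,2)[symmetric] N_pos]
    ultimately show ?thesis
      unfolding e by simp
  qed
  obtain c where c: "c > 0" "\<And>x a. c * (norm (x a))\<^sup>2 \<le> face_energy Q x"
    using face_coercive[OF face] by blast
  have "summable (\<lambda>m. (norm (v m))\<^sup>2)"
  proof (rule bounded_imp_summable)
    fix k
    have "(\<Sum>m<j. \<epsilon> m) + energy M (X j) = energy M (X 0)" for j
    proof (induction j)
      case (Suc j)
      then show ?case using en[of j] by simp
    qed simp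
    \<comment> \<open>Dropping the nonnegative energy of the remainder bounds the face energies
      uniformly in \<open>k\<close>.\<close>
    from this[of "Suc k"] have le: "(\<Sum>m\<le>k. \<epsilon> m) \<le> energy M (X 0)"
      using energy_nonneg[OF operator XI[of "Suc k"]] by (simp add: lessThan_Suc_atMost)
    have "c * (\<Sum>m\<le>k. (norm (v m))\<^sup>2) \<le> (\<Sum>m\<le>k. \<epsilon> m)"
      unfolding sum_distrib_left \<epsilon>_def
      by (rule sum_mono) (metis c(2) on_sides.simps(4))
    with le have "c * (\<Sum>m\<le>k. (norm (v m))\<^sup>2) \<le> energy M (X 0)" by linarith
    then show "(\<Sum>m\<le>k. (norm (v m))\<^sup>2) \<le> energy M (X 0) / c"
      using c(1) by (simp add: pos_le_divide_eq mult.commute)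
  qed simp
  moreover have "edge_equation (\<lambda>m. s (pos m) + n (pos m)) v"
    unfolding edge_equation_def
  proof
    fix m
    \<comment> \<open>\<open>v' (Suc m)\<close> is known twice: it cancels the force of face
      \<open>m\<close> on the shared edge, and it is the output of face \<open>m + 1\<close> on its
      free edge. Equating the two gives the recurrence.\<close>
    have "v' (Suc m) + (U *v (s (pos m) + n (pos m)) + T *v v (Suc m) + A *v v m) = 0"
      "v' (Suc m) = U *v (s (pos (Suc m)) + n (pos (Suc m))) + A *v v (Suc (Suc m)) + T *v v (Suc m)"
      using st[of m] st[of "Suc m"] by blast+
    then show "A *v v m + T *v v (Suc m) + T *v v (Suc m) + A *v v (Suc (Suc m))
        + U *v (s (pos m) + n (pos m) + (s (pos (Suc m)) + n (pos (Suc m)))) = 0"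
      by (simp add: matrix_vector_right_distrib add_ac)
  qed
  moreover have "v 0 = h" by (simp add: v_def X0)
  moreover have "M (s, n, h) = (S' 0, N' 0, U *v (s (pos 0) + n (pos 0)) + A *v v 1 + T *v v 0)"
    using MX[of 0] st[of 0] by (simp add: X0)
  moreover have "S' 0 (pos m) = T *v s (pos m) + A *v n (pos m) + U *v (v m + v (Suc m))"
    "N' 0 (pos m) = A *v s (pos m) + T *v n (pos m) + U *v (v m + v (Suc m))" for m
    using S'_pos[of m 0] N'_pos[of m 0] st[of m] by (simp_all add: add.commute)
  ultimately show thesis using that[of v "S' 0" "N' 0"] by blast
qed

end


section \<open>Reflection\<close>

text \<open>Extension of a sequence on \<open>\<nat>\<close> to \<open>\<int>\<close>, even for \<open>e = 1\<close> and odd for \<open>e = -1\<close>: about the edge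
  \<open>0\<close> for edge variables, and about \<open>-1/2\<close> for face variables.\<close>

definition extend_edges :: "real \<Rightarrow> (nat \<Rightarrow> 'v::real_vector) \<Rightarrow> int \<Rightarrow> 'v" where
  "extend_edges e v k = (if k \<ge> 0 then v (nat k) else e *\<^sub>R v (nat (- k)))"

definition extend_faces :: "real \<Rightarrow> (nat \<Rightarrow> 'v::real_vector) \<Rightarrow> int \<Rightarrow> 'v" where
  "extend_faces e f k = (if k \<ge> 0 then f (nat k) else e *\<^sub>R f (nat (- 1 - k)))"

lemma half_line_nonneg: "half_line {0..} int"
  by unfold_locales (rule bij_betwI[where g = nat], auto)

lemma half_line_neg: "half_line {..<0} (\<lambda>m. - 1 - int m)"
  by unfold_locales (rule bij_betwI[where g = "\<lambda>k. nat (- 1 - k)"], auto)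

lemma ell2_UNIV_split:
  assumes "summable (\<lambda>m. (norm (f (int m)))\<^sup>2)" "summable (\<lambda>m. (norm (f (- 1 - int m)))\<^sup>2)"
  shows "f \<in> ell2 UNIV"
proof -
  have "restrict_seq {0..} f \<in> ell2 {0..}"
    unfolding half_line.ell2_iff_summable[OF half_line_nonneg] using assms by (simp add: restrict_seq_def)
  moreover have "restrict_seq {..<0} f \<in> ell2 {..<0}"
    unfolding half_line.ell2_iff_summable[OF half_line_neg] using assms by (simp add: restrict_seq_def)
  ultimately have "(\<lambda>k. (norm (restrict_seq {0..} f k))\<^sup>2 + (norm (restrict_seq {..<0} f k))\<^sup>2) summable_on UNIV"
    by (intro summable_on_add) (auto simp: ell2_def)
  also have "(\<lambda>k. (norm (restrict_seq {0..} f k))\<^sup>2 + (norm (restrict_seq {..<0} f k))\<^sup>2) = (\<lambda>k. (norm (f k))\<^sup>2)"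
    by (auto simp: restrict_seq_def)
  finally show ?thesis by (simp add: ell2_def)
qed

lemma ell2_extend_faces: "summable (\<lambda>m. (norm (f m))\<^sup>2) \<Longrightarrow> extend_faces e f \<in> ell2 UNIV"
  by (rule ell2_UNIV_split) (auto simp: extend_faces_def power_mult_distrib intro: summable_mult)

lemma ell2_extend_edges: "summable (\<lambda>m. (norm (v m))\<^sup>2) \<Longrightarrow> extend_edges e v \<in> ell2 UNIV"
proof (rule ell2_UNIV_split)
  assume s: "summable (\<lambda>m. (norm (v m))\<^sup>2)"
  then show "summable (\<lambda>m. (norm (extend_edges e v (int m)))\<^sup>2)" by (simp add: extend_edges_def)
  have "extend_edges e v (- 1 - int m) = e *\<^sub>R v (Suc m)" for m
    by (simp add: extend_edges_def nat_add_distrib)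
  then show "summable (\<lambda>m. (norm (extend_edges e v (- 1 - int m)))\<^sup>2)"
    using s by (simp add: power_mult_distrib summable_mult summable_Suc_iff[of "\<lambda>m. (norm (v m))\<^sup>2"])
qed

lemma matrix_vector_mult_scaleR_right: "X *v (r *\<^sub>R x) = r *\<^sub>R (X *v x)"
  for X :: "'k::real_or_complex ^ 'n ^ 'm"
  by (simp add: matrix_vector_mult_def vec_eq_iff scaleR_sum_right)

text \<open>The recurrence is symmetric under \<open>k\<close> to \<open>- k\<close> for edges and
  \<open>k\<close> to \<open>- 1 - k\<close> for faces, so the negative edges repeat the hypothesis.
  Only edge 0 uses the boundary condition: in the odd case the terms cancel in pairs and
  \<open>v 0 = 0\<close>, in the even case the equation is twice the vanishing of the force.\<close>

lemma strip_solution_extend: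
  fixes f :: "nat \<Rightarrow> 'k::real_or_complex ^ ('n::finite + 'n)"
  assumes f: "summable (\<lambda>m. (norm (f m))\<^sup>2)" and v: "summable (\<lambda>m. (norm (v m))\<^sup>2)"
    and g: "summable (\<lambda>m. (norm (g m))\<^sup>2)"
    and gm: "\<And>m. g m = block_mat T A A T *v f m + block_col U U *v (v m + v (Suc m))"
    and edge: "\<And>m. A *v v m + T *v v (Suc m) + T *v v (Suc m) + A *v v (Suc (Suc m))
      + block_row U U *v (f m + f (Suc m)) = 0"
    and bdry: "e = - 1 \<and> v 0 = 0 \<or> e = 1 \<and> block_row U U *v f 0 + A *v v 1 + T *v v 0 = 0"
  shows "strip_solution T A U (extend_faces e f) (extend_faces e g) (extend_edges e v)"
  unfolding strip_solution_def
proof (intro conjI allI)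
  show "extend_faces e f \<in> ell2 UNIV" "extend_faces e g \<in> ell2 UNIV" "extend_edges e v \<in> ell2 UNIV"
    by (rule ell2_extend_faces ell2_extend_edges f g v)+
  let ?F = "extend_faces e f" and ?V = "extend_edges e v"
  note R = matrix_vector_mult_scaleR_right
  fix k
  consider m where "k = 1 + int m" | "k = 0" | m where "k = - 1 - int m"
  proof -
    assume a: "\<And>m. k = 1 + int m \<Longrightarrow> thesis" "k = 0 \<Longrightarrow> thesis" "\<And>m. k = - 1 - int m \<Longrightarrow> thesis"
    show thesis
      using a(1)[of "nat (k - 1)"] a(2) a(3)[of "nat (- 1 - k)"] by (cases "k > 0"; cases "k = 0") auto
  qed
  then show "A *v ?V (k - 1) + T *v ?V k + T *v ?V k + A *v ?V (k + 1) + block_row U U *v (?F (k - 1) + ?F k) = 0"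
  proof cases
    case 1
    have n: "nat (1 + int m) = Suc m" "nat (2 + int m) = Suc (Suc m)" by simp_all
    from edge[of m] show ?thesis
      by (simp add: 1 extend_faces_def extend_edges_def n)
  next
    case 2
    have V: "?V (k - 1) = e *\<^sub>R v 1" "?V k = v 0" "?V (k + 1) = v 1" "?F (k - 1) = e *\<^sub>R f 0" "?F k = f 0"
      by (simp_all add: 2 extend_faces_def extend_edges_def)
    show ?thesis using bdry
    proof
      assume "e = 1 \<and> block_row U U *v f 0 + A *v v 1 + T *v v 0 = 0"
      then have e: "e = 1" and z: "block_row U U *v f 0 + A *v v 1 + T *v v 0 = 0" by auto
      have "A *v v 1 + T *v v 0 + T *v v 0 + A *v v 1 + block_row U U *v (f 0 + f 0)
        = (block_row U U *v f 0 + A *v v 1 + T *v v 0) + (block_row U U *v f 0 + A *v v 1 + T *v v 0)"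
        by (simp only: matrix_vector_right_distrib add_ac)
      then show ?thesis unfolding V unfolding e scaleR_one by (simp only: z add_0_left)
    next
      assume "e = - 1 \<and> v 0 = 0"
      then show ?thesis unfolding V by (simp add: R vec.linear_neg[OF matrix_vector_mul_linear_gen])
    qed
  next
    case 3
    have n: "nat (int m + 1) = Suc m" "nat (1 + int m) = Suc m" "nat (int m + 2) = Suc (Suc m)" by simp_all
    have V: "?V (k - 1) = e *\<^sub>R v (Suc (Suc m))" "?V k = e *\<^sub>R v (Suc m)" "?F (k - 1) = e *\<^sub>R f (Suc m)" "?F k = e *\<^sub>R f m"
      by (simp_all add: 3 extend_faces_def extend_edges_def n)
    \<comment> \<open>For \<open>m = 0\<close> this is edge 0, the fixed point of the reflection;
      there \<open>v 0 = e *\<^sub>R v 0\<close> because \<open>e = 1\<close> or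
      \<open>v 0 = 0\<close>.\<close>
    have V': "?V (k + 1) = e *\<^sub>R v m"
      using bdry by (cases "m = 0") (auto simp: 3 extend_edges_def)
    have "A *v ?V (k - 1) + T *v ?V k + T *v ?V k + A *v ?V (k + 1) + block_row U U *v (?F (k - 1) + ?F k)
      = e *\<^sub>R (A *v v m + T *v v (Suc m) + T *v v (Suc m) + A *v v (Suc (Suc m)) + block_row U U *v (f m + f (Suc m)))"
      unfolding V V' by (simp only: R matrix_vector_right_distrib scaleR_add_right add_ac)
    then show ?thesis by (simp only: edge scaleR_zero_right)
  qed
  show "extend_faces e g k = block_mat T A A T *v ?F k + block_col U U *v (?V k + ?V (k + 1))"
  proof (cases "k \<ge> 0")
    case True
    then have "nat (k + 1) = Suc (nat k)" by simp
    with True show ?thesis by (simp add: extend_faces_def extend_edges_def gm)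
  next
    case False
    define m where "m = nat (- 1 - k)"
    have k: "k = - 1 - int m" using False by (simp add: m_def)
    have n: "nat (int m + 1) = Suc m" "nat (1 + int m) = Suc m" by simp_all
    have V: "?V k = e *\<^sub>R v (Suc m)" "?F k = e *\<^sub>R f m" "extend_faces e g k = e *\<^sub>R g m"
      by (simp_all add: k extend_faces_def extend_edges_def n)
    have V': "?V (k + 1) = e *\<^sub>R v m"
      using bdry by (cases "m = 0") (auto simp: k extend_edges_def)
    show ?thesis
      unfolding V V' gm by (simp only: R matrix_vector_right_distrib scaleR_add_right add_ac)
  qed
qed

section \<open>Superposition of solutions\<close>

lemma ell2_add: "f \<in> ell2 I \<Longrightarrow> g \<in> ell2 I \<Longrightarrow> (\<lambda>k. f k + g k) \<in> ell2 I"
proof -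
  assume "f \<in> ell2 I" "g \<in> ell2 I"
  then have "(\<lambda>k. 2 * (norm (f k))\<^sup>2 + 2 * (norm (g k))\<^sup>2) summable_on UNIV"
    by (intro summable_on_add summable_on_cmult_right) (auto simp: ell2_def)
  then have "(\<lambda>k. (norm (f k + g k))\<^sup>2) summable_on UNIV"
    by (rule summable_on_comparison_test) (auto intro: norm_add_sq_le)
  with \<open>f \<in> ell2 I\<close> \<open>g \<in> ell2 I\<close> show ?thesis by (simp add: ell2_def)
qed

lemma ell2_scaleR: "f \<in> ell2 I \<Longrightarrow> (\<lambda>k. r *\<^sub>R f k) \<in> ell2 I"
  by (auto simp: ell2_def power_mult_distrib intro: summable_on_cmult_right)

lemma strip_solution_add:
  assumes "strip_solution T A U f g V" "strip_solution T A U f' g' V'"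
  shows "strip_solution T A U (\<lambda>k. f k + f' k) (\<lambda>k. g k + g' k) (\<lambda>k. V k + V' k)"
  unfolding strip_solution_def
proof (intro conjI allI)
  fix k
  have "A *v V (k - 1) + T *v V k + T *v V k + A *v V (k + 1) + block_row U U *v (f (k - 1) + f k)
    + (A *v V' (k - 1) + T *v V' k + T *v V' k + A *v V' (k + 1) + block_row U U *v (f' (k - 1) + f' k)) = 0"
    using assms by (simp add: strip_solution_def)
  then show "A *v (V (k - 1) + V' (k - 1)) + T *v (V k + V' k) + T *v (V k + V' k) + A *v (V (k + 1) + V' (k + 1))
      + block_row U U *v (f (k - 1) + f' (k - 1) + (f k + f' k)) = 0"
    by (simp only: matrix_vector_right_distrib add_ac)
  show "g k + g' k = block_mat T A A T *v (f k + f' k) + block_col U U *v (V k + V' k + (V (k + 1) + V' (k + 1)))"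
    using assms by (simp only: strip_solution_def matrix_vector_right_distrib add_ac)
next
  have "f \<in> ell2 UNIV" "f' \<in> ell2 UNIV" "g \<in> ell2 UNIV" "g' \<in> ell2 UNIV" "V \<in> ell2 UNIV" "V' \<in> ell2 UNIV"
    using assms unfolding strip_solution_def by blast+
  then show "(\<lambda>k. f k + f' k) \<in> ell2 UNIV" "(\<lambda>k. g k + g' k) \<in> ell2 UNIV" "(\<lambda>k. V k + V' k) \<in> ell2 UNIV"
    by (blast intro: ell2_add)+
qed

lemma strip_solution_scaleR:
  assumes "strip_solution T A U f g V"
  shows "strip_solution T A U (\<lambda>k. r *\<^sub>R f k) (\<lambda>k. r *\<^sub>R g k) (\<lambda>k. r *\<^sub>R V k)"
  unfolding strip_solution_def
proof (intro conjI allI)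
  fix k
  have "r *\<^sub>R (A *v V (k - 1) + T *v V k + T *v V k + A *v V (k + 1) + block_row U U *v (f (k - 1) + f k)) = 0"
    using assms by (simp add: strip_solution_def)
  then show "A *v (r *\<^sub>R V (k - 1)) + T *v (r *\<^sub>R V k) + T *v (r *\<^sub>R V k) + A *v (r *\<^sub>R V (k + 1))
      + block_row U U *v (r *\<^sub>R f (k - 1) + r *\<^sub>R f k) = 0"
    by (simp only: matrix_vector_mult_scaleR_right scaleR_add_right matrix_vector_right_distrib)
  show "r *\<^sub>R g k = block_mat T A A T *v (r *\<^sub>R f k) + block_col U U *v (r *\<^sub>R V k + r *\<^sub>R V (k + 1))"
    using assms by (simp only: strip_solution_def matrix_vector_mult_scaleR_right scaleR_add_right matrix_vector_right_distrib)
next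
  have "f \<in> ell2 UNIV" "g \<in> ell2 UNIV" "V \<in> ell2 UNIV"
    using assms unfolding strip_solution_def by blast+
  then show "(\<lambda>k. r *\<^sub>R f k) \<in> ell2 UNIV" "(\<lambda>k. r *\<^sub>R g k) \<in> ell2 UNIV" "(\<lambda>k. r *\<^sub>R V k) \<in> ell2 UNIV"
    by (blast intro: ell2_scaleR)+
qed

text \<open>The even and the odd extension of \<open>f\<close> are \<open>f' + J f'\<close> and \<open>f' - J f'\<close>, where \<open>f'\<close> is the extension by zero.\<close>

lemma strip_operator_extend_zero:
  assumes Q: "face_operator Q" and d: "dihedral_face Q T A U"
    and even: "strip_solution T A U (extend_faces 1 f) (extend_faces 1 g) V"
    and odd: "strip_solution T A U (extend_faces (- 1) f) (extend_faces (- 1) g') V'"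
  shows "strip_operator Q (\<lambda>k. if k \<ge> 0 then f (nat k) else 0) k
     - strip_operator Q (\<lambda>k. if k \<ge> 0 then 0 else f (nat (- 1 - k))) k = extend_faces (- 1) g' k"
proof -
  have half: "(1 / 2) *\<^sub>R x + (1 / 2) *\<^sub>R x = x" for x :: "'a ^ ('b + 'b)"
    by (simp flip: scaleR_add_left)
  have f1: "(\<lambda>k. if k \<ge> 0 then f (nat k) else 0)
      = (\<lambda>k. (1 / 2) *\<^sub>R extend_faces 1 f k + (1 / 2) *\<^sub>R extend_faces (- 1) f k)"
    by (auto simp: extend_faces_def half)
  have f2: "(\<lambda>k. if k \<ge> 0 then 0 else f (nat (- 1 - k)))
      = (\<lambda>k. (1 / 2) *\<^sub>R extend_faces 1 f k + (- 1 / 2) *\<^sub>R extend_faces (- 1) f k)"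
    by (auto simp: extend_faces_def half)
  \<comment> \<open>The even output \<open>g\<close> has weight 1/2 in both values and cancels in
    their difference; the odd output \<open>g'\<close> has weights 1/2 and -1/2 and survives with
    weight 1.\<close>
  have "strip_operator Q (\<lambda>k. if k \<ge> 0 then f (nat k) else 0)
      = (\<lambda>k. (1 / 2) *\<^sub>R extend_faces 1 g k + (1 / 2) *\<^sub>R extend_faces (- 1) g' k)"
    unfolding f1
    by (rule strip_operator_eq[OF Q d strip_solution_add[OF strip_solution_scaleR[OF even] strip_solution_scaleR[OF odd]]])
  moreover have "strip_operator Q (\<lambda>k. if k \<ge> 0 then 0 else f (nat (- 1 - k)))
      = (\<lambda>k. (1 / 2) *\<^sub>R extend_faces 1 g k + (- 1 / 2) *\<^sub>R extend_faces (- 1) g' k)"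
    unfolding f2
    by (rule strip_operator_eq[OF Q d strip_solution_add[OF strip_solution_scaleR[OF even] strip_solution_scaleR[OF odd]]])
  ultimately show ?thesis
    by (simp add: half)
qed

section \<open>Block vectors and block matrices\<close>

lemma block_mat_mult:
  "block_mat A B C D *v x = block_vec (A *v fst_block x + B *v snd_block x) (C *v fst_block x + D *v snd_block x)"
  by (auto simp: block_mat_def block_vec_def fst_block_def snd_block_def matrix_vector_mult_def vec_eq_iff
      UNIV_sum sum.Plus[OF finite finite, unfolded Plus_def] split: sum.split)

lemma block_row_mult: "block_row A B *v x = A *v fst_block x + B *v snd_block x"
  by (simp add: block_row_def fst_block_def snd_block_def matrix_vector_mult_def vec_eq_iff
      UNIV_sum sum.Plus[OF finite finite, unfolded Plus_def])

lemma block_col_mult: "block_col A B *v x = block_vec (A *v x) (B *v x)"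
  by (auto simp: block_col_def block_vec_def matrix_vector_mult_def vec_eq_iff split: sum.split)

lemma block_vec_add: "block_vec x y + block_vec x' y' = block_vec (x + x') (y + y')"
  by (auto simp: block_vec_def vec_eq_iff split: sum.split)

lemma fst_block_add: "fst_block (x + y) = fst_block x + fst_block y"
  and snd_block_add: "snd_block (x + y) = snd_block x + snd_block y"
  and block_vec_0: "block_vec 0 0 = 0"
  by (auto simp: block_vec_def fst_block_def snd_block_def vec_eq_iff split: sum.split)

lemma norm_block_vec: "(norm (block_vec x y))\<^sup>2 = (norm x)\<^sup>2 + (norm y)\<^sup>2"
  by (simp add: norm_vec_def L2_set_def sum_nonneg block_vec_def UNIV_sum sum.Plus[OF finite finite, unfolded Plus_def])

lemma block_vec_blocks: "block_vec (fst_block x) (snd_block x) = x"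
  by (auto simp: block_vec_def fst_block_def snd_block_def vec_eq_iff split: sum.split)

lemma ell2_blocks:
  assumes "f \<in> ell2 I"
  shows "(\<lambda>k. fst_block (f k)) \<in> ell2 I" "(\<lambda>k. snd_block (f k)) \<in> ell2 I"
proof -
  have n: "(norm (f k))\<^sup>2 = (norm (fst_block (f k)))\<^sup>2 + (norm (snd_block (f k)))\<^sup>2" for k
    by (metis block_vec_blocks norm_block_vec)
  have s: "(\<lambda>k. (norm (f k))\<^sup>2) summable_on UNIV" using assms by (simp add: ell2_def)
  have "(\<lambda>k. (norm (fst_block (f k)))\<^sup>2) summable_on UNIV" "(\<lambda>k. (norm (snd_block (f k)))\<^sup>2) summable_on UNIV"
    by (rule summable_on_comparison_test[OF s]; simp add: n)+
  then show "(\<lambda>k. fst_block (f k)) \<in> ell2 I" "(\<lambda>k. snd_block (f k)) \<in> ell2 I"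
    using assms by (auto simp: ell2_def fst_block_def snd_block_def vec_eq_iff)
qed

context half_strip
begin

text \<open>The sign of the reflection matches the condition at the free edge: value 0
  (\<open>h = 0\<close>) for the odd extension, force 0 (\<open>h' = 0\<close>) for the even
  one.\<close>

lemma extended_solution:
  assumes f: "f \<in> ell2 I" and "M (\<lambda>k. fst_block (f k), \<lambda>k. snd_block (f k), h) = (s', n', h')"
    and bdry: "e = - 1 \<and> h = 0 \<or> e = 1 \<and> h' = 0"
  shows "\<exists>V. strip_solution T A U (extend_faces e (\<lambda>m. f (pos m)))
    (extend_faces e (\<lambda>m. block_vec (s' (pos m)) (n' (pos m)))) V"
proof -
  let ?s = "\<lambda>k. fst_block (f k)" and ?n = "\<lambda>k. snd_block (f k)"
  have mem: "(?s, ?n, h) \<in> half_strip_space I"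
    using ell2_blocks[OF f] by (simp add: half_strip_space_def)
  from vertical_edges[OF this] obtain v s'' n'' where v: "v 0 = h" "summable (\<lambda>m. (norm (v m))\<^sup>2)"
    "edge_equation (\<lambda>m. ?s (pos m) + ?n (pos m)) v"
    "M (?s, ?n, h) = (s'', n'', U *v (?s (pos 0) + ?n (pos 0)) + A *v v 1 + T *v v 0)"
    "\<And>m. s'' (pos m) = T *v ?s (pos m) + A *v ?n (pos m) + U *v (v m + v (Suc m))"
    "\<And>m. n'' (pos m) = A *v ?s (pos m) + T *v ?n (pos m) + U *v (v m + v (Suc m))"
    by blast
  with assms(2) have e: "s'' = s'" "n'' = n'" "h' = U *v (?s (pos 0) + ?n (pos 0)) + A *v v 1 + T *v v 0" by auto
  have "s' \<in> ell2 I" "n' \<in> ell2 I"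
    using half_strip_operator_maps[OF operator mem] assms(2) by (auto simp: half_strip_space_def)
  then have g: "summable (\<lambda>m. (norm (block_vec (s' (pos m)) (n' (pos m))))\<^sup>2)"
    unfolding norm_block_vec by (intro summable_add) (auto simp: ell2_iff_summable)
  have fs: "summable (\<lambda>m. (norm (f (pos m)))\<^sup>2)"
    using f by (simp add: ell2_iff_summable)
  have "strip_solution T A U (extend_faces e (\<lambda>m. f (pos m)))
    (extend_faces e (\<lambda>m. block_vec (s' (pos m)) (n' (pos m)))) (extend_edges e v)"
  proof (rule strip_solution_extend[OF fs v(2) g])
    show "block_vec (s' (pos m)) (n' (pos m)) = block_mat T A A T *v f (pos m) + block_col U U *v (v m + v (Suc m))" for m
      using v(5,6)[of m] by (simp add: e block_mat_mult block_col_mult block_vec_add)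
    show "A *v v m + T *v v (Suc m) + T *v v (Suc m) + A *v v (Suc (Suc m))
      + block_row U U *v (f (pos m) + f (pos (Suc m))) = 0" for m
    proof -
      have "block_row U U *v (f (pos m) + f (pos (Suc m)))
          = U *v (?s (pos m) + ?n (pos m) + (?s (pos (Suc m)) + ?n (pos (Suc m))))"
        by (simp only: block_row_mult fst_block_add snd_block_add matrix_vector_right_distrib add_ac)
      then show ?thesis using v(3) by (simp only: edge_equation_def)
    qed
    show "e = - 1 \<and> v 0 = 0 \<or> e = 1 \<and> block_row U U *v f (pos 0) + A *v v 1 + T *v v 0 = 0"
      using bdry v(1) e(3) by (auto simp: block_row_mult matrix_vector_right_distrib)
  qed
  then show ?thesis by blast
qed

text \<open>The vertical block is surjective, so the edge value can be chosen to cancel the vertical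
  output. This is the source of the even solution.\<close>

lemma neumann_value:
  assumes "(s, n, 0) \<in> half_strip_space I"
  obtains h s' n' where "M (s, n, h) = (s', n', 0)"
proof -
  obtain h where h: "vertical_block M h = - snd (snd (M (s, n, 0)))"
    using surj_vertical_block[OF operator] by (metis surjD)
  have "M ((s, n, 0) + (0, 0, h)) = M (s, n, 0) + M (0, 0, h)"
    by (rule half_strip_operator_add[OF operator assms vertical_mem])
  then have "snd (snd (M (s, n, h))) = 0"
    using h by (simp add: vertical_block_def)
  then show thesis
    using that[of h "fst (M (s, n, h))" "fst (snd (M (s, n, h)))"] by (cases "M (s, n, h)") simp
qed

text \<open>With the vertical side at 0 the half-strip output is one half of the output of the odd
  extension on the whole strip. It is read at a face and, with opposite sign, at its mirror image:
  the first form fits the East half-line, where \<open>pos\<close> increases from 0, the second the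
  West.\<close>

lemma SN_block_eq:
  assumes f: "f \<in> ell2 I"
  shows "SN_block M f (pos m) = strip_operator Q (\<lambda>k. if k \<ge> 0 then f (pos (nat k)) else 0) (int m)
     - strip_operator Q (\<lambda>k. if k \<ge> 0 then 0 else f (pos (nat (- 1 - k)))) (int m)"
    and "SN_block M f (pos m) = strip_operator Q (\<lambda>k. if k \<ge> 0 then 0 else f (pos (nat (- 1 - k)))) (- 1 - int m)
     - strip_operator Q (\<lambda>k. if k \<ge> 0 then f (pos (nat k)) else 0) (- 1 - int m)"
    and "k \<notin> I \<Longrightarrow> SN_block M f k = 0"
proof -
  let ?s = "\<lambda>k. fst_block (f k)" and ?n = "\<lambda>k. snd_block (f k)"
  have mem: "(?s, ?n, 0) \<in> half_strip_space I"
    using ell2_blocks[OF f] by (simp add: half_strip_space_def)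
  obtain s' n' h' where M: "M (?s, ?n, 0) = (s', n', h')" by (cases "M (?s, ?n, 0)") auto
  obtain h s'' n'' where M': "M (?s, ?n, h) = (s'', n'', 0)" using neumann_value[OF mem] by blast
  obtain V where odd: "strip_solution T A U (extend_faces (- 1) (\<lambda>m. f (pos m)))
      (extend_faces (- 1) (\<lambda>m. block_vec (s' (pos m)) (n' (pos m)))) V"
    using extended_solution[OF f M, of "- 1"] by blast
  obtain V' where even: "strip_solution T A U (extend_faces 1 (\<lambda>m. f (pos m)))
      (extend_faces 1 (\<lambda>m. block_vec (s'' (pos m)) (n'' (pos m)))) V'"
    using extended_solution[OF f M', of 1] by blast
  have SN: "SN_block M f k = block_vec (s' k) (n' k)" for k
    by (simp add: SN_block_def M)
  note st = strip_operator_extend_zero[OF face dihedral even odd]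
  show "SN_block M f (pos m) = strip_operator Q (\<lambda>k. if k \<ge> 0 then f (pos (nat k)) else 0) (int m)
     - strip_operator Q (\<lambda>k. if k \<ge> 0 then 0 else f (pos (nat (- 1 - k)))) (int m)"
    unfolding st by (simp add: SN extend_faces_def)
  have "extend_faces (- 1) (\<lambda>m. block_vec (s' (pos m)) (n' (pos m))) (- 1 - int m) = - SN_block M f (pos m)"
    by (simp add: SN extend_faces_def)
  from st[of "- 1 - int m", unfolded this] show "SN_block M f (pos m)
     = strip_operator Q (\<lambda>k. if k \<ge> 0 then 0 else f (pos (nat (- 1 - k)))) (- 1 - int m)
     - strip_operator Q (\<lambda>k. if k \<ge> 0 then f (pos (nat k)) else 0) (- 1 - int m)"
    by (simp add: algebra_simps)
  assume "k \<notin> I"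
  moreover have "s' \<in> ell2 I" "n' \<in> ell2 I"
    using half_strip_operator_maps[OF operator mem] M by (auto simp: half_strip_space_def)
  ultimately show "SN_block M f k = 0" by (simp add: SN ell2_def block_vec_0)
qed

end


section \<open>West and East fixed points\<close>

text \<open>In \<open>schur\<close>, \<open>w\<close> is the term \<open>inv (M22) (M21 x)\<close>,
  so the stationary value of the shared edge is \<open>- w\<close>. Linearity turns the Schur
  correction into evaluation of \<open>M\<close> at \<open>- w\<close>, and the equation defining
  \<open>w\<close> into the cancellation of forces; \<open>y\<close> is the force of the face on the
  shared edge when that edge has value 0.\<close>

lemma vertical_solution:
  fixes Q :: "('k::real_or_complex, 'n::finite) face"
  assumes M: "half_strip_operator I M" and Q: "face_operator Q" and d: "dihedral_face Q T A U"
    and x: "(s, n, 0) \<in> half_strip_space I"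
    and w: "w = inv (\<lambda>v. vertical_block M v + T *v v) (snd (snd (M (s, n, 0))) + y)"
    and e: "M (s, n, - w) = (s', n', v')"
  shows "M (s, n, 0) - M (0, 0, w) = (s', n', v')"
    and "v' + (y + T *v (- w)) = 0"
proof -
  have "(s, n, - w) \<in> half_strip_space I" using x by (simp add: half_strip_space_def)
  from half_strip_operator_add[OF M this vertical_mem, of w]
  have *: "M (s, n, 0) = (s', n', v') + M (0, 0, w)" by (simp add: e)
  then show "M (s, n, 0) - M (0, 0, w) = (s', n', v')" by simp
  have "vertical_block M w + T *v w = snd (snd (M (s, n, 0))) + y"
    unfolding w by (rule surj_f_inv_f[OF surj_vertical_block_add[OF M Q d]])
  then have "T *v w = v' + y"
    unfolding * by (simp add: vertical_block_def)
  then show "v' + (y + T *v (- w)) = 0"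
    by (simp add: vec.linear_neg[OF matrix_vector_mul_linear_gen])
qed

text \<open>One gluing, unfolded at the stationary shared edge \<open>- w\<close>.
  \<open>unshift_L\<close> splits off the cell \<open>-1\<close>, which belongs to the new face, and
  leaves the advanced sequence to the half-strip.\<close>

lemma half_strip_west:
  fixes Q :: "('k::real_or_complex, 'n::finite) face"
  assumes Q: "face_operator Q" and d: "dihedral_face Q T A U" and fp: "west_fixed_point Q M"
  shows "half_strip {..<0} (\<lambda>m. - 1 - int m) Q T A U M"
proof -
  interpret half_line "{..<0}" "\<lambda>m. - 1 - int m" by (rule half_line_neg)
  have M: "half_strip_operator {..<0} M" and glue: "\<And>x. x \<in> half_strip_space {..<0} \<Longrightarrow> glue_W Q M x = M x"
    using fp by (auto simp: west_fixed_point_def)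
  have unshift: "unshift_L f = (advance f, f (- 1))" for f :: "int \<Rightarrow> 'k ^ 'n"
  proof -
    have "advance f k = (if k < 0 then f (k - 1) else 0)" for k
    proof (cases "k < 0")
      case True
      then obtain m where k: "k = - 1 - int m" using pos_cases[of k] by auto
      show ?thesis using advance_pos[of f m] True unfolding k by (simp add: algebra_simps)
    qed (simp add: advance_def)
    then show ?thesis by (auto simp: unshift_L_def)
  qed
  show ?thesis
  proof (unfold_locales, rule Q, rule d, rule M)
    fix s n :: "int \<Rightarrow> 'k ^ 'n" and h
    assume x: "(s, n, h) \<in> half_strip_space {..<0}"
    let ?a = "s (- 1) + n (- 1)"
    have x0: "(advance s, advance n, 0) \<in> half_strip_space {..<0}"
      using x by (auto simp: half_strip_space_def intro: ell2_advance)
    define w where "w = inv (\<lambda>v. vertical_block M v + T *v v)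
      (snd (snd (M (advance s, advance n, 0))) + (U *v ?a + A *v h))"
    obtain s' n' v' where e: "M (advance s, advance n, - w) = (s', n', v')"
      by (cases "M (advance s, advance n, - w)") auto
    note w = vertical_solution[OF M Q d x0 w_def e]
    obtain p q r where m1: "M (advance s, advance n, 0) = (p, q, r)" by (cases "M (advance s, advance n, 0)") auto
    obtain p' q' r' where m2: "M (0, 0, w) = (p', q', r')" by (cases "M (0, 0, w)") auto
    have w_eq: "inv (\<lambda>v. vertical_block M v + T *v v) (r + (U *v ?a + A *v h)) = w"
      by (simp add: w_def m1)
    have diff: "p - p' = s'" "q - q' = n'" using w(1) by (simp_all add: m1 m2)
    \<comment> \<open>\<open>J0\<close> yields the column of the shared edge, that is
      \<open>M12\<close> and \<open>M22\<close> of the Schur complement; \<open>J1\<close> yields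
      \<open>M11\<close> and \<open>M21\<close> applied to the data.\<close>
    have J0: "join_W Q M (0, v) = (((fst (M (0, 0, v)), U *v v), (fst (snd (M (0, 0, v))), U *v v), A *v v), vertical_block M v + T *v v)" for v
      by (cases "M (0, 0, v)") (simp add: zero_prod_def vertical_block_def face_apply_dihedral[OF d])
    have J1: "join_W Q M (((advance s, s (- 1)), (advance n, n (- 1)), h), 0)
        = (((p, T *v s (- 1) + A *v n (- 1) + U *v h), (q, A *v s (- 1) + T *v n (- 1) + U *v h), U *v ?a + T *v h), r + (U *v ?a + A *v h))"
      by (simp add: m1 face_apply_dihedral[OF d])
    define s2 where "s2 = shift_L (s', T *v s (- 1) + A *v n (- 1) + U *v (- w + h))"
    define n2 where "n2 = shift_L (n', A *v s (- 1) + T *v n (- 1) + U *v (- w + h))"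
    have "schur (join_W Q M) ((advance s, s (- 1)), (advance n, n (- 1)), h)
        = ((s', T *v s (- 1) + A *v n (- 1) + U *v (- w + h)), (n', A *v s (- 1) + T *v n (- 1) + U *v (- w + h)), U *v ?a + A *v (- w) + T *v h)"
      unfolding schur_def J0 J1 fst_conv snd_conv w_eq m2 diff[symmetric]
      by (simp add: matrix_vector_right_distrib matrix_vector_mult_diff_distrib
          vec.linear_neg[OF matrix_vector_mul_linear_gen])
    then have Mx: "M (s, n, h) = (s2, n2, U *v ?a + A *v (- w) + T *v h)"
      using glue[OF x] by (simp add: glue_W_def unshift s2_def n2_def)
    have "s2 (- 1) = T *v s (- 1) + A *v n (- 1) + U *v (- w + h)" "n2 (- 1) = A *v s (- 1) + T *v n (- 1) + U *v (- w + h)"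
      "s2 (- 1 - int (Suc m)) = s' (- 1 - int m)" "n2 (- 1 - int (Suc m)) = n' (- 1 - int m)" for m
      by (simp_all add: s2_def n2_def)
    moreover have "v' + (U *v ?a + T *v (- w) + A *v h) = 0"
      using w(2) by (simp only: add_ac)
    ultimately show "\<exists>v s' n' v' s'' n''.
      M (advance s, advance n, v) = (s', n', v') \<and>
      v' + (U *v (s (- 1 - int 0) + n (- 1 - int 0)) + T *v v + A *v h) = 0 \<and>
      M (s, n, h) = (s'', n'', U *v (s (- 1 - int 0) + n (- 1 - int 0)) + A *v v + T *v h) \<and>
      s'' (- 1 - int 0) = T *v s (- 1 - int 0) + A *v n (- 1 - int 0) + U *v (v + h) \<and>
      n'' (- 1 - int 0) = A *v s (- 1 - int 0) + T *v n (- 1 - int 0) + U *v (v + h) \<and>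
      (\<forall>m. s'' (- 1 - int (Suc m)) = s' (- 1 - int m)) \<and> (\<forall>m. n'' (- 1 - int (Suc m)) = n' (- 1 - int m))"
      using e Mx
      by (intro exI[of _ "- w"] exI[of _ s'] exI[of _ n'] exI[of _ v'] exI[of _ s2] exI[of _ n2]) simp
  qed
qed

text \<open>Mirror image of the West case: the shared edge is now the East edge of the face, whose
  cell is \<open>0\<close>. Dihedral invariance produces the same equations in \<open>T\<close>,
  \<open>A\<close>, \<open>U\<close>.\<close>

lemma half_strip_east:
  fixes Q :: "('k::real_or_complex, 'n::finite) face"
  assumes Q: "face_operator Q" and d: "dihedral_face Q T A U" and fp: "east_fixed_point Q M"
  shows "half_strip {0..} int Q T A U M"
proof -
  interpret half_line "{0..}" int by (rule half_line_nonneg)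
  have M: "half_strip_operator {0..} M" and glue: "\<And>x. x \<in> half_strip_space {0..} \<Longrightarrow> glue_E Q M x = M x"
    using fp by (auto simp: east_fixed_point_def)
  have unshift: "unshift_R f = (f 0, advance f)" for f :: "int \<Rightarrow> 'k ^ 'n"
  proof -
    have "advance f k = (if k \<ge> 0 then f (k + 1) else 0)" for k
    proof (cases "k \<ge> 0")
      case True
      then obtain m where k: "k = int m" using pos_cases[of k] by auto
      show ?thesis using advance_pos[of f m] True unfolding k by (simp add: algebra_simps)
    qed (simp add: advance_def)
    then show ?thesis by (auto simp: unshift_R_def)
  qed
  show ?thesis
  proof (unfold_locales, rule Q, rule d, rule M)
    fix s n :: "int \<Rightarrow> 'k ^ 'n" and h
    assume x: "(s, n, h) \<in> half_strip_space {0..}"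
    let ?a = "s 0 + n 0"
    have x0: "(advance s, advance n, 0) \<in> half_strip_space {0..}"
      using x by (auto simp: half_strip_space_def intro: ell2_advance)
    define w where "w = inv (\<lambda>v. vertical_block M v + T *v v)
      (snd (snd (M (advance s, advance n, 0))) + (U *v ?a + A *v h))"
    obtain s' n' v' where e: "M (advance s, advance n, - w) = (s', n', v')"
      by (cases "M (advance s, advance n, - w)") auto
    note w = vertical_solution[OF M Q d x0 w_def e]
    obtain p q r where m1: "M (advance s, advance n, 0) = (p, q, r)" by (cases "M (advance s, advance n, 0)") auto
    obtain p' q' r' where m2: "M (0, 0, w) = (p', q', r')" by (cases "M (0, 0, w)") auto
    have w_eq: "inv (\<lambda>v. vertical_block M v + T *v v) (r + (U *v ?a + A *v h)) = w"
      by (simp add: w_def m1)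
    have diff: "p - p' = s'" "q - q' = n'" using w(1) by (simp_all add: m1 m2)
    have J0: "join_E Q M (0, v) = (((U *v v, fst (M (0, 0, v))), (U *v v, fst (snd (M (0, 0, v)))), A *v v), vertical_block M v + T *v v)" for v
      by (cases "M (0, 0, v)") (simp add: zero_prod_def vertical_block_def face_apply_dihedral[OF d])
    have J1: "join_E Q M (((s 0, advance s), (n 0, advance n), h), 0)
        = (((T *v s 0 + A *v n 0 + U *v h, p), (A *v s 0 + T *v n 0 + U *v h, q), U *v ?a + T *v h), r + (U *v ?a + A *v h))"
      by (simp add: m1 face_apply_dihedral[OF d])
    define s2 where "s2 = shift_R (T *v s 0 + A *v n 0 + U *v (- w + h), s')"
    define n2 where "n2 = shift_R (A *v s 0 + T *v n 0 + U *v (- w + h), n')"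
    have "schur (join_E Q M) ((s 0, advance s), (n 0, advance n), h)
        = ((T *v s 0 + A *v n 0 + U *v (- w + h), s'), (A *v s 0 + T *v n 0 + U *v (- w + h), n'), U *v ?a + A *v (- w) + T *v h)"
      unfolding schur_def J0 J1 fst_conv snd_conv w_eq m2 diff[symmetric]
      by (simp add: matrix_vector_right_distrib matrix_vector_mult_diff_distrib
          vec.linear_neg[OF matrix_vector_mul_linear_gen])
    then have Mx: "M (s, n, h) = (s2, n2, U *v ?a + A *v (- w) + T *v h)"
      using glue[OF x] by (simp add: glue_E_def unshift s2_def n2_def)
    have "s2 0 = T *v s 0 + A *v n 0 + U *v (- w + h)" "n2 0 = A *v s 0 + T *v n 0 + U *v (- w + h)"
      "s2 (int (Suc m)) = s' (int m)" "n2 (int (Suc m)) = n' (int m)" for m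
      by (simp_all add: s2_def n2_def)
    moreover have "v' + (U *v ?a + T *v (- w) + A *v h) = 0"
      using w(2) by (simp only: add_ac)
    ultimately show "\<exists>v s' n' v' s'' n''.
      M (advance s, advance n, v) = (s', n', v') \<and>
      v' + (U *v (s (int 0) + n (int 0)) + T *v v + A *v h) = 0 \<and>
      M (s, n, h) = (s'', n'', U *v (s (int 0) + n (int 0)) + A *v v + T *v h) \<and>
      s'' (int 0) = T *v s (int 0) + A *v n (int 0) + U *v (v + h) \<and>
      n'' (int 0) = A *v s (int 0) + T *v n (int 0) + U *v (v + h) \<and>
      (\<forall>m. s'' (int (Suc m)) = s' (int m)) \<and> (\<forall>m. n'' (int (Suc m)) = n' (int m))"
      using e Mx
      by (intro exI[of _ "- w"] exI[of _ s'] exI[of _ n'] exI[of _ v'] exI[of _ s2] exI[of _ n2]) simp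
  qed
qed

lemma restrict_seq_ell2: "f \<in> ell2 I \<Longrightarrow> restrict_seq I f = f"
  by (auto simp: ell2_def restrict_seq_def)

theorem theorem3p10:
  fixes Q :: "('k::real_or_complex, 'n::finite) face"
    and QW QE :: "('k, 'n) hs_vec \<Rightarrow> ('k, 'n) hs_vec"
  assumes "face_operator Q"
    and "dihedral_invariant Q"
    and "two_d_simple Q"
    and "west_fixed_point Q QW"
    and "east_fixed_point Q QE"
  shows "(\<forall>f\<in>ell2 {..<0}. SN_block QW f = fold_op {..<0} (strip_operator Q) f) \<and>
         (\<forall>f\<in>ell2 {0..}. SN_block QE f = fold_op {0..} (strip_operator Q) f)"
proof (intro conjI ballI ext)
  obtain T A U where d: "dihedral_face Q T A U"
    using dihedral_face_exists[OF assms(2)] .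
  fix f :: "int \<Rightarrow> 'k ^ ('n + 'n)" and k
  {
    assume f: "f \<in> ell2 {..<0}"
    interpret half_strip "{..<0}" "\<lambda>m. - 1 - int m" Q T A U QW
      by (rule half_strip_west[OF assms(1) d assms(4)])
    \<comment> \<open>Here \<open>pos\<close> runs leftwards, so on the nonnegative side the
      extension shows the mirror image \<open>reflect f\<close>, and \<open>f\<close> itself stands
      on the negative side; hence the second form of \<open>SN_block_eq\<close>.\<close>
    have fs: "(\<lambda>k. if k \<ge> 0 then 0 else f (- 1 - int (nat (- 1 - k)))) = f"
      "(\<lambda>k. if k \<ge> 0 then f (- 1 - int (nat k)) else 0) = reflect f"
      using f by (auto simp: ell2_def reflect_def)
    show "SN_block QW f k = fold_op {..<0} (strip_operator Q) f k"
    proof (cases "k < 0")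
      case True
      define m where "m = nat (- 1 - k)"
      have k: "k = - 1 - int m" using True by (simp add: m_def)
      show ?thesis
        using SN_block_eq(2)[OF f, of m] unfolding fs k
        by (simp add: fold_op_def restrict_seq_ell2[OF f]) (simp add: restrict_seq_def)
    next
      case False
      then show ?thesis
        using SN_block_eq(3)[OF f, of k] by (simp add: fold_op_def restrict_seq_def)
    qed
  next
    assume f: "f \<in> ell2 {0..}"
    interpret half_strip "{0..}" int Q T A U QE
      by (rule half_strip_east[OF assms(1) d assms(5)])
    have fs: "(\<lambda>k. if k \<ge> 0 then f (int (nat k)) else 0) = f"
      "(\<lambda>k. if k \<ge> 0 then 0 else f (int (nat (- 1 - k)))) = reflect f"
      using f by (auto simp: ell2_def reflect_def)
    show "SN_block QE f k = fold_op {0..} (strip_operator Q) f k"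
    proof (cases "k \<ge> 0")
      case True
      then have k: "k = int (nat k)" by simp
      show ?thesis
        using SN_block_eq(1)[OF f, of "nat k"] True unfolding fs
        by (simp add: fold_op_def restrict_seq_ell2[OF f]) (simp add: restrict_seq_def)
    next
      case False
      then show ?thesis
        using SN_block_eq(3)[OF f, of k] by (simp add: fold_op_def restrict_seq_def)
    qed
  }
qed

end
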